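(* Let $k>1$ and consider the domain $\mathcal{D}=\mathcal{D}_k=\{(x,y)\in\mathbb{R}^2:0\le x\le1,\ 0\le y\le x^k\}$, with $d=2$, $t=(0,0)$ and $\rho=1$. Let $\mathcal{K}=(0,1]\times(0,\infty)$, and let $\hat f(t)$ be the adaptive estimator built with the polynomial degrees $m_\ell=0$ for all $\ell\in\mathbb{N}$. The following assertions hold: 1. The adaptive rate of convergence (ARC) over $\{\Sigma(s,L):(s,L)\in\mathcal{K}\}$ is the admissible collection $\phi$ given by $$\phi_n(s,L)=\left(\frac{\log n}{n}\right)^{s/(2s+k+1)},\quad(s,L)\in(0,1]\times(0,\infty),\ n\in\mathbb{N}.$$ 2. Let $(s,L)\in(0,1]\times(0,\infty)$ be given. There exists a positive real constant $\tilde C(s,L,k,\delta)>0$ such that $$\limsup_{n\to\infty}\ \sup_{f\in\Sigma(s,L)}\left(\frac{\log n}{n}\right)^{-s/(2s+k+1)}R_n(\hat f,f)\le\tilde C(s,L,k,\delta).$$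
   Context: Setting. With $d=2$, $\mathcal{D}=\mathcal{D}_k$, $t=(0,0)$, $\rho=1$: $\|\cdot\|_\infty$ is the sup norm on $\mathbb{R}^2$, $\Delta=[-1,1]^2$ and $\mathcal{V}(h)=\{u\in\mathbb{R}^2:t+u\in\mathcal{D},\ \|u\|_\infty\le h\}$. $X_1,\dots,X_n$ are i.i.d. random variables supported on $\mathcal{D}$ with density $f$ with respect to Lebesgue measure; $\mathsf{E}$ is the corresponding expectation. An estimator is a measurable function of $(X_1,\dots,X_n)$; its pointwise risk is $R_n(\tilde f,f)=(\mathsf{E}[\{\tilde f(t)-f(t)\}^2])^{1/2}$. Hölder class. For $\alpha\in\mathbb{N}_0^2$, $|\alpha|=\alpha_1+\alpha_2$, $\varphi_\alpha(u)=u_1^{\alpha_1}u_2^{\alpha_2}$; $\mathcal{P}_m=\mathrm{Span}(\varphi_\alpha:|\alpha|\le m)$ has dimension $D_m=\binom{m+2}{2}$. For $s,L>0$, a density $f:\mathcal{D}\to\mathbb{R}$ belongs to $\Sigma(s,L)$ if there is $q\in\mathcal{P}_{\lceil s\rceil-1}$ with $|f(t+u)-q(u)|\le L\|u\|_\infty^s$ for all $u\in\mathcal{V}(\rho)$ ($\lceil s\rceil-1$ is the greatest integer strictly less than $s$). Adaptive rate of convergence. For nonnegative sequences, $u_n\lesssim v_n$ means $\limsup_{n\to\infty}u_n/v_n<\infty$. A collection is a family $\phi=\{\phi_n(s,L):(s,L)\in\mathcal{K},n\in\mathbb{N}\}$ of nonnegative numbers. It is admissible if there is an estimator $\tilde f_n$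 with $\sup_{f\in\Sigma(s,L)}R_n(\tilde f_n,f)\lesssim\phi_n(s,L)$ for all $(s,L)\in\mathcal{K}$. For collections $\phi,\psi$: $$[\psi\ll\phi]=\left\{(s,L)\in\mathcal{K}:\lim_{n\to\infty}\frac{\psi_n(s,L)}{\phi_n(s,L)}=0\right\},$$ $$[\psi\ggg\phi]=\left\{(s,L)\in\mathcal{K}:\limsup_{n\to\infty}\frac{\psi_n(s,L)}{\phi_n(s,L)}\times\frac{\psi_n(s',L')}{\phi_n(s',L')}=\infty\ \ \forall(s',L')\in[\psi\ll\phi]\right\}.$$ An admissible collection $\phi$ is an ARC if for any other admissible collection $\psi$, $[\psi\ll\phi]$ is contained in a $(\dim(\mathcal{K})-1)$-dimensional manifold and $[\psi\ggg\phi]$ contains an open subset of $\mathcal{K}$. (The ARC is unique up to asymptotic order, hence "the" ARC.) Local polynomial estimators. For $\gamma=(m,h)\in\mathbb{N}_0\times(0,\rho]$: $K=\mathbf{1}_\Delta$, $w_h(u)=h^{-d}K(h^{-1}u)\mathbf{1}_{\mathcal{D}}(t+u)$, $W_h=\int w_h(u)\,du$; $\Phi_\gamma(u)=(\varphi_\alpha(u/h))_{|\alpha|\le m}$ as a column vector of length $D_m$ (graded by $|\alpha|$, lexicographic order within each degree); $\mathcal{B}_\gamma=\int\Phi_\gamma(u)\Phi_\gamma^\top(u)w_h(u)\,du$ (symmetric positive definite), with smallest eigenvalue $\lambda_\gamma>0$; $\mathcal{B}_\gamma^{1/2}$ is the lower triangular Cholesky factor of $\mathcal{B}_\gamma$;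 $H_\gamma(u)=\mathcal{B}_\gamma^{-1/2}\Phi_\gamma(u)$; and $\hat f_\gamma(t)=\frac1n\sum_{i=1}^n H_\gamma^\top(0)H_\gamma(X_i-t)w_h(X_i-t)$. Selection procedure. Fix $\delta>1$. Set $h_\ell=\rho\exp(-\ell)$ for $\ell\in\mathbb{N}$, with the degrees $m_\ell$ specified in the claim. Let $\mathcal{L}_n=\{1\le\ell\le\lfloor\log n\rfloor: nh_\ell^dW_{h_\ell}\ge(\log n)^3\}$ and $\Gamma_n=\{(m_\ell,h_\ell):\ell\in\mathcal{L}_n\}$ (nonempty for $n$ large). For $\gamma=(m,h)\in\Gamma_n$ put $$\hat v_\gamma=\frac1{n^2}\sum_{i=1}^n\{H_\gamma^\top(0)H_\gamma(X_i-t)w_h(X_i-t)\}^2,\quad c_\gamma=\frac{\sqrt{D_m}}{nh^d\lambda_\gamma},\quad \varepsilon_\gamma=\frac{(\delta-1)D_mW_h}{nh^d\lambda_\gamma^2},\quad \Lambda_\gamma=2|\log\lambda_\gamma|,$$ $$r_\gamma(v,x)=\sqrt{2vx}+c_\gamma x,\qquad \mathrm{pen}(\gamma)=d\delta|\log h|+\Lambda_\gamma,\qquad \hat{\mathbb{U}}_\gamma=r_\gamma\{\hat v_\gamma+\varepsilon_\gamma,\mathrm{pen}(\gamma)\}.$$ Order $\Gamma_n$ by $(m_\ell,h_\ell)\preceq(m_{\ell'},h_{\ell'})$ iff $h_\ell\le h_{\ell'}$, and let $\gamma\vee\gamma'$ be the maximum for this total order. With $(x)_+=\max\{x,0\}$,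 put $$\hat A_\gamma=\max_{\gamma'\in\Gamma_n}\left\{|\hat f_{\gamma\vee\gamma'}(t)-\hat f_{\gamma'}(t)|-\hat{\mathbb{U}}_{\gamma\vee\gamma'}-\hat{\mathbb{U}}_{\gamma'}\right\}_+,\qquad \hat\gamma=\mathop{\mathrm{arg\,min}}_{\gamma\in\Gamma_n}(\hat A_\gamma+\hat{\mathbb{U}}_\gamma),\qquad \hat f(t)=\hat f_{\hat\gamma}(t).$$
   Formalization: In the definition of ARC, the open subset of K contained in [ψ⋙φ] is required to be nonempty except when [ψ≪φ] is nonempty and lies in the boundary of K (the edge s=1); there it may be empty, since the log factor can be removed at s=1 at no cost for s<1. *)

theory Defs
  imports
    "HOL-Probability.Probability"
    "Jordan_Normal_Form.Gauss_Jordan_Elimination"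
    "Jordan_Normal_Form.Char_Poly"
begin

section \<open>Setting\<close>

abbreviation (input) t0 :: "real \<times> real" where "t0 \<equiv> (0, 0)"

abbreviation (input) rho :: real where "rho \<equiv> 1"

definition cusp :: "real \<Rightarrow> (real \<times> real) set" where
  "cusp k = {(x, y). 0 \<le> x \<and> x \<le> 1 \<and> 0 \<le> y \<and> y \<le> x powr k}"

definition Vnbh :: "(real \<times> real) set \<Rightarrow> real \<Rightarrow> (real \<times> real) set" where
  "Vnbh D h = {u. t0 + u \<in> D \<and> infnorm u \<le> h}"

text \<open>Densities and elements of the Hoelder class are functions on the whole plane, of which only
  the values on the domain are ever used.\<close>

definition is_density :: "(real \<times> real) set \<Rightarrow> (real \<times> real \<Rightarrow> real) \<Rightarrow> bool" where
  "is_density D f \<longleftrightarrow>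
     f \<in> borel_measurable (restrict_space borel D) \<and> (\<forall>x\<in>D. 0 \<le> f x) \<and>
     (\<integral>\<^sup>+x\<in>D. ennreal (f x) \<partial>lborel) = 1"

definition sample_law :: "(real \<times> real) set \<Rightarrow> nat \<Rightarrow> (real \<times> real \<Rightarrow> real)
    \<Rightarrow> (nat \<Rightarrow> real \<times> real) measure" where
  "sample_law D n f = (\<Pi>\<^sub>M i\<in>{1..n}. density lborel (\<lambda>x. ennreal (f x) * indicator D x))"

text \<open>A sequence of estimators, one for each sample size.\<close>

definition is_estimator :: "(nat \<Rightarrow> (nat \<Rightarrow> real \<times> real) \<Rightarrow> real) \<Rightarrow> bool" where
  "is_estimator T \<longleftrightarrow> (\<forall>n. T n \<in> borel_measurable (\<Pi>\<^sub>M i\<in>{1..n}. (borel :: (real \<times> real) measure)))"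

definition ennsqrt :: "ennreal \<Rightarrow> ennreal" where
  "ennsqrt x = (if x = \<infinity> then \<infinity> else ennreal (sqrt (enn2real x)))"

definition risk :: "(real \<times> real) set \<Rightarrow> nat \<Rightarrow> ((nat \<Rightarrow> real \<times> real) \<Rightarrow> real)
    \<Rightarrow> (real \<times> real \<Rightarrow> real) \<Rightarrow> ennreal" where
  "risk D n T f = ennsqrt (\<integral>\<^sup>+X. ennreal ((T X - f t0)\<^sup>2) \<partial>sample_law D n f)"


section \<open>Hoelder classes\<close>

definition mono_fun :: "nat \<times> nat \<Rightarrow> real \<times> real \<Rightarrow> real" where
  "mono_fun \<alpha> u = fst u ^ fst \<alpha> * snd u ^ snd \<alpha>"

definition Poly :: "nat \<Rightarrow> (real \<times> real \<Rightarrow> real) set" where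
  "Poly m = {q. \<exists>c. q = (\<lambda>u. \<Sum>\<alpha> | fst \<alpha> + snd \<alpha> \<le> m. c \<alpha> * mono_fun \<alpha> u)}"

definition Sigma_class :: "(real \<times> real) set \<Rightarrow> real \<Rightarrow> real \<Rightarrow> (real \<times> real \<Rightarrow> real) set" where
  "Sigma_class D s L = {f. is_density D f \<and>
     (\<exists>q\<in>Poly (nat (\<lceil>s\<rceil> - 1)). \<forall>u\<in>Vnbh D rho. \<bar>f (t0 + u) - q u\<bar> \<le> L * infnorm u powr s)}"


section \<open>Adaptive rate of convergence\<close>

text \<open>Ratios are taken in \<open>ennreal\<close>, so that a positive number divided by zero is infinite; the real
  convention \<open>x / 0 = 0\<close> would make the zero collection admissible.\<close>

definition lesssim :: "(nat \<Rightarrow> ennreal) \<Rightarrow> (nat \<Rightarrow> ennreal) \<Rightarrow> bool" where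
  "lesssim u v \<longleftrightarrow> limsup (\<lambda>n. u n / v n) < \<infinity>"

definition is_collection :: "(real \<times> real) set \<Rightarrow> (real \<times> real \<Rightarrow> nat \<Rightarrow> real) \<Rightarrow> bool" where
  "is_collection K \<phi> \<longleftrightarrow> (\<forall>\<theta>\<in>K. \<forall>n. 0 \<le> \<phi> \<theta> n)"

definition admissible ::
  "(real \<times> real) set \<Rightarrow> (real \<times> real) set \<Rightarrow> (real \<times> real \<Rightarrow> nat \<Rightarrow> real) \<Rightarrow> bool" where
  "admissible D K \<phi> \<longleftrightarrow> is_collection K \<phi> \<and>
     (\<exists>T. is_estimator T \<and>
        (\<forall>(s, L)\<in>K. lesssim (\<lambda>n. SUP f\<in>Sigma_class D s L. risk D n (T n) f)
                              (\<lambda>n. ennreal (\<phi> (s, L) n))))"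

definition rratio :: "(real \<times> real \<Rightarrow> nat \<Rightarrow> real) \<Rightarrow> (real \<times> real \<Rightarrow> nat \<Rightarrow> real)
    \<Rightarrow> real \<times> real \<Rightarrow> nat \<Rightarrow> ennreal" where
  "rratio \<psi> \<phi> \<theta> n = ennreal (\<psi> \<theta> n) / ennreal (\<phi> \<theta> n)"

definition ll_set :: "(real \<times> real) set \<Rightarrow> (real \<times> real \<Rightarrow> nat \<Rightarrow> real)
    \<Rightarrow> (real \<times> real \<Rightarrow> nat \<Rightarrow> real) \<Rightarrow> (real \<times> real) set" where
  "ll_set K \<psi> \<phi> = {\<theta>\<in>K. rratio \<psi> \<phi> \<theta> \<longlonglongrightarrow> 0}"

definition ggg_set :: "(real \<times> real) set \<Rightarrow> (real \<times> real \<Rightarrow> nat \<Rightarrow> real)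
    \<Rightarrow> (real \<times> real \<Rightarrow> nat \<Rightarrow> real) \<Rightarrow> (real \<times> real) set" where
  "ggg_set K \<psi> \<phi> = {\<theta>\<in>K. \<forall>\<theta>'\<in>ll_set K \<psi> \<phi>.
     limsup (\<lambda>n. rratio \<psi> \<phi> \<theta> n * rratio \<psi> \<phi> \<theta>' n) = \<infinity>}"

definition C1_on :: "'a::euclidean_space set \<Rightarrow> ('a \<Rightarrow> 'a) \<Rightarrow> bool" where
  "C1_on W g \<longleftrightarrow> (\<exists>g' :: 'a \<Rightarrow> 'a \<Rightarrow>\<^sub>L 'a.
     (\<forall>x\<in>W. (g has_derivative blinfun_apply (g' x)) (at x)) \<and> continuous_on W g')"

text \<open>Embedded submanifolds: near each of its points, \<open>M\<close> is straightened by a local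
  \<open>C\<^sup>1\<close>-diffeomorphism of the ambient space to a linear subspace of dimension \<open>d\<close>.\<close>

definition submanifold :: "nat \<Rightarrow> 'a::euclidean_space set \<Rightarrow> bool" where
  "submanifold d M \<longleftrightarrow> (\<forall>x\<in>M. \<exists>W W' g g' S.
     open W \<and> x \<in> W \<and> open W' \<and> homeomorphism W W' g g' \<and> C1_on W g \<and> C1_on W' g' \<and>
     subspace S \<and> dim S = d \<and> g ` (M \<inter> W) = S \<inter> W')"

text \<open>The requirement that \<open>ggg_set\<close> contain an open subset \<open>U\<close> of \<open>K\<close> would be void if \<open>U\<close> could
  always be empty. It cannot be nonempty in every case either: when \<open>K\<close> contains a largest
  smoothness \<open>s\<^sub>0\<close>, the logarithm at \<open>s\<^sub>0\<close> can be removed without any loss for \<open>s < s\<^sub>0\<close>, and the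
  resulting \<open>\<psi>\<close> has an empty \<open>ggg_set\<close>. Hence an empty \<open>U\<close> is tolerated only if
  \<open>ll_set\<close> is a nonempty set of boundary points of \<open>K\<close>.\<close>

definition is_ARC ::
  "(real \<times> real) set \<Rightarrow> (real \<times> real) set \<Rightarrow> (real \<times> real \<Rightarrow> nat \<Rightarrow> real) \<Rightarrow> bool" where
  "is_ARC D K \<phi> \<longleftrightarrow> admissible D K \<phi> \<and>
     (\<forall>\<psi>. admissible D K \<psi> \<longrightarrow>
        (\<exists>M. submanifold (nat (aff_dim K) - 1) M \<and> ll_set K \<psi> \<phi> \<subseteq> M) \<and>
        (\<exists>U. openin (top_of_set K) U \<and> U \<subseteq> ggg_set K \<psi> \<phi> \<and>
             (U = {} \<longrightarrow> ll_set K \<psi> \<phi> \<noteq> {} \<and> ll_set K \<psi> \<phi> \<subseteq> frontier K)))"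


section \<open>Local polynomial estimators\<close>

definition Delta :: "(real \<times> real) set" where
  "Delta = {-1..1} \<times> {-1..1}"

definition wker :: "(real \<times> real) set \<Rightarrow> real \<Rightarrow> real \<times> real \<Rightarrow> real" where
  "wker D h u = 1 / h\<^sup>2 * indicator Delta (u /\<^sub>R h) * indicator D (t0 + u)"

definition Wker :: "(real \<times> real) set \<Rightarrow> real \<Rightarrow> real" where
  "Wker D h = (LINT u|lborel. wker D h u)"

definition Dm :: "nat \<Rightarrow> nat" where
  "Dm m = (m + 2) choose 2"

text \<open>Multi-indices graded by total degree, lexicographic within each degree.\<close>

definition mindices :: "nat \<Rightarrow> (nat \<times> nat) list" where
  "mindices m = concat (map (\<lambda>j. map (\<lambda>i. (i, j - i)) [0..<Suc j]) [0..<Suc m])"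

lemma set_mindices: "set (mindices m) = {\<alpha>. fst \<alpha> + snd \<alpha> \<le> m}"
proof -
  have "(a, b) \<in> set (mindices m) \<longleftrightarrow> a + b \<le> m" for a b
    unfolding mindices_def
    by (auto simp: image_iff less_Suc_eq_le intro!: bexI[of _ "a + b"])
  then show ?thesis by auto
qed

lemma length_mindices: "length (mindices m) = Dm m"
proof (induction m)
  case 0
  then show ?case by (simp add: mindices_def Dm_def choose_two)
next
  case (Suc m)
  have "mindices (Suc m) = mindices m @ map (\<lambda>i. (i, Suc m - i)) [0..<Suc (Suc m)]"
    by (simp add: mindices_def)
  then show ?case using Suc by (simp add: Dm_def numeral_2_eq_2)
qed

text \<open>In what follows a parameter \<open>\<gamma>\<close> is a pair of a degree and a bandwidth.\<close>

definition Phi :: "nat \<times> real \<Rightarrow> real \<times> real \<Rightarrow> real Matrix.vec" where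
  "Phi \<gamma> u = Matrix.vec (Dm (fst \<gamma>)) (\<lambda>i. mono_fun (mindices (fst \<gamma>) ! i) (u /\<^sub>R snd \<gamma>))"

definition Bmat :: "(real \<times> real) set \<Rightarrow> nat \<times> real \<Rightarrow> real Matrix.mat" where
  "Bmat D \<gamma> = Matrix.mat (Dm (fst \<gamma>)) (Dm (fst \<gamma>)) (\<lambda>(i, j).
     LINT u|lborel. vec_index (Phi \<gamma> u) i * vec_index (Phi \<gamma> u) j * wker D (snd \<gamma>) u)"

definition lam :: "(real \<times> real) set \<Rightarrow> nat \<times> real \<Rightarrow> real" where
  "lam D \<gamma> = Min {e. eigenvalue (Bmat D \<gamma>) e}"

definition cholesky :: "real Matrix.mat \<Rightarrow> real Matrix.mat" where
  "cholesky A = (THE G. G \<in> carrier_mat (dim_row A) (dim_row A) \<and>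
     upper_triangular (transpose_mat G) \<and> (\<forall>i<dim_row A. 0 < G $$ (i, i)) \<and>
     G * transpose_mat G = A)"

definition Hvec :: "(real \<times> real) set \<Rightarrow> nat \<times> real \<Rightarrow> real \<times> real \<Rightarrow> real Matrix.vec" where
  "Hvec D \<gamma> u = mult_mat_vec (the (mat_inverse (cholesky (Bmat D \<gamma>)))) (Phi \<gamma> u)"

definition lp_weight :: "(real \<times> real) set \<Rightarrow> nat \<times> real \<Rightarrow> real \<times> real \<Rightarrow> real" where
  "lp_weight D \<gamma> u = scalar_prod (Hvec D \<gamma> t0) (Hvec D \<gamma> u) * wker D (snd \<gamma>) u"

definition fhat :: "(real \<times> real) set \<Rightarrow> nat \<times> real \<Rightarrow> nat \<Rightarrow> (nat \<Rightarrow> real \<times> real) \<Rightarrow> real" where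
  "fhat D \<gamma> n X = 1 / real n * (\<Sum>i = 1..n. lp_weight D \<gamma> (X i - t0))"


section \<open>Selection procedure\<close>

definition bw :: "nat \<Rightarrow> real" where
  "bw l = rho * exp (- real l)"

definition Lset :: "(real \<times> real) set \<Rightarrow> nat \<Rightarrow> nat set" where
  "Lset D n = {l. 1 \<le> l \<and> int l \<le> \<lfloor>ln (real n)\<rfloor> \<and> (ln (real n)) ^ 3 \<le> real n * (bw l)\<^sup>2 * Wker D (bw l)}"

definition Gam :: "(real \<times> real) set \<Rightarrow> (nat \<Rightarrow> nat) \<Rightarrow> nat \<Rightarrow> (nat \<times> real) set" where
  "Gam D m n = (\<lambda>l. (m l, bw l)) ` Lset D n"

definition vhat :: "(real \<times> real) set \<Rightarrow> nat \<times> real \<Rightarrow> nat \<Rightarrow> (nat \<Rightarrow> real \<times> real) \<Rightarrow> real" where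
  "vhat D \<gamma> n X = 1 / (real n)\<^sup>2 * (\<Sum>i = 1..n. (lp_weight D \<gamma> (X i - t0))\<^sup>2)"

definition cc :: "(real \<times> real) set \<Rightarrow> nat \<times> real \<Rightarrow> nat \<Rightarrow> real" where
  "cc D \<gamma> n = sqrt (real (Dm (fst \<gamma>))) / (real n * (snd \<gamma>)\<^sup>2 * lam D \<gamma>)"

definition eps :: "(real \<times> real) set \<Rightarrow> real \<Rightarrow> nat \<times> real \<Rightarrow> nat \<Rightarrow> real" where
  "eps D \<delta> \<gamma> n = (\<delta> - 1) * real (Dm (fst \<gamma>)) * Wker D (snd \<gamma>) / (real n * (snd \<gamma>)\<^sup>2 * (lam D \<gamma>)\<^sup>2)"

definition Lam :: "(real \<times> real) set \<Rightarrow> nat \<times> real \<Rightarrow> real" where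
  "Lam D \<gamma> = 2 * \<bar>ln (lam D \<gamma>)\<bar>"

definition rr :: "(real \<times> real) set \<Rightarrow> nat \<times> real \<Rightarrow> nat \<Rightarrow> real \<Rightarrow> real \<Rightarrow> real" where
  "rr D \<gamma> n v x = sqrt (2 * v * x) + cc D \<gamma> n * x"

definition pen :: "(real \<times> real) set \<Rightarrow> real \<Rightarrow> nat \<times> real \<Rightarrow> real" where
  "pen D \<delta> \<gamma> = 2 * \<delta> * \<bar>ln (snd \<gamma>)\<bar> + Lam D \<gamma>"

definition Uhat :: "(real \<times> real) set \<Rightarrow> real \<Rightarrow> nat \<times> real \<Rightarrow> nat \<Rightarrow> (nat \<Rightarrow> real \<times> real) \<Rightarrow> real" where
  "Uhat D \<delta> \<gamma> n X = rr D \<gamma> n (vhat D \<gamma> n X + eps D \<delta> \<gamma> n) (pen D \<delta> \<gamma>)"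

definition gjoin :: "nat \<times> real \<Rightarrow> nat \<times> real \<Rightarrow> nat \<times> real" where
  "gjoin \<gamma> \<gamma>' = (if snd \<gamma> \<le> snd \<gamma>' then \<gamma>' else \<gamma>)"

definition Ahat :: "(real \<times> real) set \<Rightarrow> real \<Rightarrow> (nat \<Rightarrow> nat) \<Rightarrow> nat \<times> real \<Rightarrow> nat
    \<Rightarrow> (nat \<Rightarrow> real \<times> real) \<Rightarrow> real" where
  "Ahat D \<delta> m \<gamma> n X = (MAX \<gamma>'\<in>Gam D m n.
     max (\<bar>fhat D (gjoin \<gamma> \<gamma>') n X - fhat D \<gamma>' n X\<bar> - Uhat D \<delta> (gjoin \<gamma> \<gamma>') n X - Uhat D \<delta> \<gamma>' n X) 0)"

text \<open>The arg min need not be unique: a selection rule is any function choosing, for every sample, one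
  of the minimisers. It is unconstrained at sample sizes for which \<open>Gam\<close> is
  empty. No measurability is asked of it; where it fails, \<open>risk\<close> is a lower integral.\<close>

definition is_selection :: "(real \<times> real) set \<Rightarrow> real \<Rightarrow> (nat \<Rightarrow> nat)
    \<Rightarrow> (nat \<Rightarrow> (nat \<Rightarrow> real \<times> real) \<Rightarrow> nat \<times> real) \<Rightarrow> bool" where
  "is_selection D \<delta> m ghat \<longleftrightarrow> (\<forall>n X. Gam D m n \<noteq> {} \<longrightarrow>
     is_arg_min (\<lambda>\<gamma>. Ahat D \<delta> m \<gamma> n X + Uhat D \<delta> \<gamma> n X) (\<lambda>\<gamma>. \<gamma> \<in> Gam D m n) (ghat n X))"

definition fhat_sel :: "(real \<times> real) set \<Rightarrow> (nat \<Rightarrow> (nat \<Rightarrow> real \<times> real) \<Rightarrow> nat \<times> real)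
    \<Rightarrow> nat \<Rightarrow> (nat \<Rightarrow> real \<times> real) \<Rightarrow> real" where
  "fhat_sel D ghat n X = fhat D (ghat n X) n X"

end

theory Submission
  imports Defs "HOL-Real_Asymp.Real_Asymp"
begin

text \<open>With degree \<open>0\<close> all matrices are \<open>1 \<times> 1\<close>: the sup-norm ball of radius \<open>h\<close> meets the cusp in
\<open>A h = {u \<in> cusp k. fst u \<le> h}\<close>, whose area is \<open>vol k h = h powr (k + 1) / (k + 1)\<close>, and the
estimator with bandwidth \<open>h\<close> is \<open>N / (n * vol k h)\<close>, where \<open>N\<close> counts the sample points in
\<open>A h\<close>. Put \<open>m = n * vol k h\<close>, let \<open>a\<close> be the mean of the binomial variable \<open>N\<close>, and let \<open>x\<close> be
the penalty, which is linear in \<open>- ln h\<close>. The threshold is then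
\<open>(sqrt (2 * (N + (\<delta> - 1) * m) * x) + x) / m\<close>.

For the upper bound, the Chernoff inequality shows that \<open>\<bar>N - a\<bar>\<close> exceeds \<open>m\<close> times the threshold with
probability at most a constant times \<open>exp (- x)\<close> (\<open>deviation_tail\<close>). In the lower tail the
empirical variance may be far below the true one; there the extra term \<open>(\<delta> - 1) * m\<close> forces
\<open>a\<close> to be so large, given \<open>m \<ge> (ln n)^3\<close>, that the error term \<open>x^2 / (2 * a)\<close> in the exponent
stays bounded. With the fourth moment of \<open>N - a\<close> this bounds the mean square of the excess over the
threshold (\<open>excess_second_moment\<close>). Deterministically, the error of the selected estimator is at
most \<open>5\<close> times the bias, \<open>5\<close> times the excess and \<open>3\<close> times the threshold, at any
bandwidth of the grid (\<open>Lepski_oracle\<close>). At the bandwidth of order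
\<open>(ln n / n) powr (1 / (2 * s + k + 1))\<close> bias and threshold balance, and both are of the order of
the rate; the sum of the excesses over the grid is of smaller order (\<open>adaptive_risk_bound\<close>).
Choosing the least minimiser makes the estimator measurable, so the rate is admissible.

For the optimality, note that the uniform density belongs to every class. Raising it near the origin
by a small multiple of the rate at \<open>s0\<close> gives an element of the class \<open>(s0, L0)\<close> for which the
likelihood ratio of the sample against the uniform density has second moment at most
\<open>n powr (2 * \<epsilon>)\<close>, with \<open>\<epsilon>\<close> as small as desired (\<open>two_point_cusp\<close>). If \<open>\<psi>\<close> is admissible and
negligible against the rate at \<open>(s0, L0)\<close>, then at the raised density the risk is negligible against
the raise, so at the uniform density it is at least a constant times \<open>n powr (- \<epsilon>)\<close> times the rate at
\<open>s0\<close> (\<open>fast_rate_penalty\<close>). For \<open>s > s0\<close> this exceeds the rate at \<open>s\<close> by a power of \<open>n\<close>, while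
the gain at \<open>(s0, L0)\<close> is at most a multiple of \<open>n powr \<epsilon>\<close> (\<open>rratio_product_tendsto_top\<close>). Hence all
points of gain lie on one line \<open>s = s0\<close>, and the loss dominates on the set \<open>s > s0\<close>. That set
is relatively open, and it is empty only for \<open>s0 = 1\<close>, when the points of gain lie on the frontier.\<close>

section \<open>Deviations of the number of sample points in a set\<close>

lemma exp_minus_linear_le:
  fixes t :: real
  assumes "0 \<le> t" "t < 1"
  shows "exp t - 1 - t \<le> t\<^sup>2 / (2 * (1 - t))"
proof -
  let ?g = "\<lambda>t::real. t\<^sup>2 / 2 - (1 - t) * (exp t - 1 - t)"
  have "?g 0 \<le> ?g t"
  proof (rule DERIV_nonneg_imp_nondecreasing[OF assms(1)])
    fix x :: real assume x: "0 \<le> x" "x \<le> t"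
    have "(?g has_real_derivative (x * exp x - x)) (at x)"
      by (auto intro!: derivative_eq_intros simp: algebra_simps)
    moreover have "0 \<le> x * exp x - x"
      using mult_left_mono[of 1 "exp x" x] x by simp
    ultimately show "\<exists>y. (?g has_real_derivative y) (at x) \<and> 0 \<le> y" by blast
  qed
  then show ?thesis using assms by (simp add: field_simps)
qed

lemma exp_minus_le_quadratic:
  fixes t :: real
  assumes "0 \<le> t"
  shows "exp (- t) \<le> 1 - t + t\<^sup>2 / 2"
proof -
  let ?g = "\<lambda>t::real. 1 - t + t\<^sup>2 / 2 - exp (- t)"
  have "?g 0 \<le> ?g t"
  proof (rule DERIV_nonneg_imp_nondecreasing[OF assms])
    fix x :: real
    have "(?g has_real_derivative (- 1 + x + exp (- x))) (at x)"
      by (auto intro!: derivative_eq_intros simp: algebra_simps)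
    moreover have "0 \<le> - 1 + x + exp (- x)"
      using exp_ge_add_one_self[of "- x"] by simp
    ultimately show "\<exists>y. (?g has_real_derivative y) (at x) \<and> 0 \<le> y" by blast
  qed
  then show ?thesis by simp
qed

lemma power4_le_exp:
  fixes y :: real
  shows "y ^ 4 \<le> 24 * (exp y + exp (- y))"
proof -
  have *: "y ^ 4 \<le> 24 * exp y" if "0 \<le> y" for y :: real
  proof -
    obtain u where "exp y = (\<Sum>n<5. y ^ n / fact n) + exp u / fact 5 * y ^ 5"
      using Maclaurin_exp_le[of y 5] by auto
    then have "(\<Sum>n<5. y ^ n / fact n) \<le> exp y"
      using that by simp
    moreover have "y ^ 4 / 24 \<le> (\<Sum>n<5. y ^ n / fact n)"
      using that by (simp add: eval_nat_numeral fact_numeral)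
    ultimately show ?thesis by simp
  qed
  show ?thesis
  proof (cases "0 \<le> y")
    case True then show ?thesis using *[of y] by (simp add: algebra_simps add_increasing2)
  next
    case False then show ?thesis using *[of "- y"] by (simp add: algebra_simps add_increasing)
  qed
qed

text \<open>The number of the points \<open>X 1, \<dots>, X n\<close> that lie in \<open>A\<close>, as a real number.\<close>

definition cnt :: "'a set \<Rightarrow> nat \<Rightarrow> (nat \<Rightarrow> 'a) \<Rightarrow> real" where
  "cnt A n X = (\<Sum>i = 1..n. indicator A (X i))"

lemma cnt_nonneg: "0 \<le> cnt A n X"
  by (simp add: cnt_def sum_nonneg)

lemma measurable_cnt:
  assumes "A \<in> sets M"
  shows "cnt A n \<in> borel_measurable (PiM {1..n} (\<lambda>_. M))"
  unfolding cnt_def using assms by measurable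

lemma nn_integral_cnt:
  assumes "prob_space M" and A: "A \<in> sets M"
  shows "(\<integral>\<^sup>+X. ennreal (cnt A n X) \<partial>PiM {1..n} (\<lambda>_. M)) = ennreal (real n * measure M A)"
proof -
  interpret M: prob_space M by fact
  interpret product_prob_space "\<lambda>_::nat. M" by unfold_locales
  have "(\<integral>\<^sup>+X. ennreal (cnt A n X) \<partial>PiM {1..n} (\<lambda>_. M))
      = (\<integral>\<^sup>+X. (\<Sum>i = 1..n. indicator A (X i)) \<partial>PiM {1..n} (\<lambda>_. M))"
    unfolding cnt_def by (intro nn_integral_cong) (simp add: sum_nonneg ennreal_indicator flip: sum_ennreal)
  also have "\<dots> = (\<Sum>i = 1..n. \<integral>\<^sup>+X. indicator A (X i) \<partial>PiM {1..n} (\<lambda>_. M))"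
    by (intro nn_integral_sum) (use A in measurable)
  also have "\<dots> = (\<Sum>i = 1..n. emeasure M A)"
  proof (intro sum.cong refl)
    fix i assume i: "i \<in> {1..n}"
    have "(\<integral>\<^sup>+X. indicator A (X i) \<partial>PiM {1..n} (\<lambda>_. M))
        = (\<integral>\<^sup>+x. indicator A x \<partial>distr (PiM {1..n} (\<lambda>_. M)) M (\<lambda>X. X i))"
      by (subst nn_integral_distr) (use i A in measurable)
    also have "distr (PiM {1..n} (\<lambda>_. M)) M (\<lambda>X. X i) = M"
      using i by (intro distr_PiM_component) (use assms(1) in auto)
    finally show "(\<integral>\<^sup>+X. indicator A (X i) \<partial>PiM {1..n} (\<lambda>_. M)) = emeasure M A"
      using A by simp
  qed
  finally show ?thesis
    by (simp add: M.emeasure_eq_measure ennreal_mult ennreal_of_nat_eq_real_of_nat)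
qed

lemma nn_integral_exp_cnt_centred:
  fixes n :: nat
  assumes "prob_space M" and A: "A \<in> sets M"
  defines "a \<equiv> real n * measure M A"
  shows "(\<integral>\<^sup>+X. ennreal (exp (t * (cnt A n X - a))) \<partial>PiM {1..n} (\<lambda>_. M))
       \<le> ennreal (exp (a * (exp t - 1 - t)))"
proof -
  interpret prob_space M by fact
  interpret product_sigma_finite "\<lambda>_::nat. M" by unfold_locales
  let ?p = "measure M A"
  have one: "(\<integral>\<^sup>+x. ennreal (exp (t * (indicator A x - ?p))) \<partial>M) \<le> ennreal (exp (?p * (exp t - 1 - t)))"
  proof -
    have "(\<integral>\<^sup>+x. ennreal (exp (t * (indicator A x - ?p))) \<partial>M)
        = (\<integral>\<^sup>+x. ennreal (exp (t * (1 - ?p))) * indicator A x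
              + ennreal (exp (t * (0 - ?p))) * indicator (space M - A) x \<partial>M)"
      by (intro nn_integral_cong) (auto simp: indicator_def)
    also have "\<dots> = ennreal (exp (t * (1 - ?p))) * emeasure M A
        + ennreal (exp (t * (0 - ?p))) * emeasure M (space M - A)"
      using A by (subst nn_integral_add) (auto simp: nn_integral_cmult_indicator)
    also have "\<dots> = ennreal (exp (t * (1 - ?p)) * ?p + exp (t * (0 - ?p)) * (1 - ?p))"
      using A by (simp add: emeasure_eq_measure prob_compl ennreal_mult)
    also have "exp (t * (1 - ?p)) * ?p + exp (t * (0 - ?p)) * (1 - ?p)
        = exp (- t * ?p) * (1 + ?p * (exp t - 1))"
      by (simp add: algebra_simps exp_diff exp_minus divide_simps)
    also have "\<dots> \<le> exp (- t * ?p) * exp (?p * (exp t - 1))"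
      by (intro mult_left_mono exp_ge_add_one_self) auto
    also have "\<dots> = exp (?p * (exp t - 1 - t))"
      by (simp add: mult_exp_exp algebra_simps)
    finally show ?thesis by (simp add: ennreal_leI)
  qed
  have "(\<integral>\<^sup>+X. ennreal (exp (t * (cnt A n X - a))) \<partial>PiM {1..n} (\<lambda>_. M))
      = (\<integral>\<^sup>+X. (\<Prod>i = 1..n. ennreal (exp (t * (indicator A (X i) - ?p)))) \<partial>PiM {1..n} (\<lambda>_. M))"
    by (intro nn_integral_cong)
      (simp add: cnt_def a_def prod_ennreal sum_distrib_left right_diff_distrib sum_subtractf flip: exp_sum)
  also have "\<dots> = (\<Prod>i = 1..n. \<integral>\<^sup>+x. ennreal (exp (t * (indicator A x - ?p))) \<partial>M)"
    by (intro product_nn_integral_prod) (use A in measurable)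
  also have "\<dots> \<le> (\<Prod>i = 1..n. ennreal (exp (?p * (exp t - 1 - t))))"
    by (rule prod_mono_ennreal) (use one in simp)
  also have "\<dots> = ennreal (exp (a * (exp t - 1 - t)))"
    by (simp add: a_def ennreal_power exp_of_nat_mult[symmetric] mult.assoc)
  finally show ?thesis .
qed

text \<open>The Chernoff bound, for an event on which \<open>t\<close> times the deviation of the count from its mean is at
least \<open>b\<close>. The sign of
\<open>t\<close> is free, so both tails are covered.\<close>

lemma exp_moment_event:
  assumes "prob_space M" and A: "A \<in> sets M"
    and ev: "\<And>X. Q X \<Longrightarrow> b \<le> t * (cnt A n X - real n * measure M A)"
    and Q: "Measurable.pred (PiM {1..n} (\<lambda>_. M)) Q"
  shows "emeasure (PiM {1..n} (\<lambda>_. M)) {X\<in>space (PiM {1..n} (\<lambda>_. M)). Q X}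
       \<le> ennreal (exp (real n * measure M A * (exp t - 1 - t) - b))"
proof -
  let ?P = "PiM {1..n} (\<lambda>_. M)" and ?a = "real n * measure M A"
  note [measurable] = Q measurable_cnt[OF A]
  have "emeasure ?P {X\<in>space ?P. Q X} = (\<integral>\<^sup>+X. indicator {X\<in>space ?P. Q X} X \<partial>?P)"
    by (intro nn_integral_indicator[symmetric]) measurable
  also have "\<dots> \<le> (\<integral>\<^sup>+X. ennreal (exp (- b)) * ennreal (exp (t * (cnt A n X - ?a))) \<partial>?P)"
  proof (intro nn_integral_mono)
    fix X
    show "indicator {X\<in>space ?P. Q X} X \<le> ennreal (exp (- b)) * ennreal (exp (t * (cnt A n X - ?a)))"
      using ev[of X] by (auto simp: indicator_def ennreal_mult[symmetric] mult_exp_exp)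
  qed
  also have "\<dots> = ennreal (exp (- b)) * (\<integral>\<^sup>+X. ennreal (exp (t * (cnt A n X - ?a))) \<partial>?P)"
    by (rule nn_integral_cmult) measurable
  also have "\<dots> \<le> ennreal (exp (- b)) * ennreal (exp (?a * (exp t - 1 - t)))"
    by (intro mult_left_mono nn_integral_exp_cnt_centred assms) auto
  also have "\<dots> = ennreal (exp (?a * (exp t - 1 - t) - b))"
    by (simp add: ennreal_mult[symmetric] mult_exp_exp)
  finally show ?thesis .
qed

text \<open>A two-sided Bernstein bound in which the variance is replaced by the observed count plus
\<open>e * m\<close>. The hypothesis \<open>x ^ 3 \<le> R * m\<close> serves the lower tail only.\<close>

lemma deviation_tail:
  fixes e m x R :: real and n :: nat
  assumes "prob_space M" and A: "A \<in> sets M"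
    and "0 < m" "0 < e" "0 \<le> x" "x ^ 3 \<le> R * m"
  defines "a \<equiv> real n * measure M A"
  shows "emeasure (PiM {1..n} (\<lambda>_. M)) {X\<in>space (PiM {1..n} (\<lambda>_. M)).
            sqrt (2 * (cnt A n X + e * m) * x) + x < \<bar>cnt A n X - a\<bar>}
       \<le> ennreal ((1 + exp (sqrt (R / (8 * e)))) * exp (- x))"
proof -
  let ?P = "PiM {1..n} (\<lambda>_. M)"
  note [measurable] = measurable_cnt[OF A]
  have a0: "0 \<le> a" by (simp add: a_def)
  note chernoff = exp_moment_event[OF assms(1) A, where n = n, folded a_def]
  define Q1 where "Q1 = (\<lambda>X. a + sqrt (2 * a * x) + x < cnt A n X)"
  define Q2 where "Q2 = (\<lambda>X. sqrt (2 * (cnt A n X + e * m) * x) + x < a - cnt A n X)"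
  have Q1m: "Measurable.pred ?P Q1" unfolding Q1_def by measurable
  have Q2m: "Measurable.pred ?P Q2" unfolding Q2_def by measurable
  have sub: "Q1 X \<or> Q2 X" if "sqrt (2 * (cnt A n X + e * m) * x) + x < \<bar>cnt A n X - a\<bar>" for X
  proof (cases "cnt A n X \<le> a")
    case True
    then show ?thesis using that by (simp add: Q2_def)
  next
    case False
    then have "a \<le> cnt A n X + e * m" using assms(3,4) by (simp add: add_increasing2)
    then have "sqrt (2 * a * x) \<le> sqrt (2 * (cnt A n X + e * m) * x)"
      using assms(5) by (intro real_sqrt_le_mono mult_right_mono) auto
    then have "Q1 X" using that False unfolding Q1_def by linarith
    then show ?thesis ..
  qed
  have up: "emeasure ?P {X\<in>space ?P. Q1 X} \<le> ennreal (exp (- x))"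
  proof (cases "a = 0")
    case True
    have "emeasure ?P {X\<in>space ?P. Q1 X} \<le> ennreal (exp (a * (exp 1 - 1 - 1) - x))"
      by (rule chernoff[OF _ Q1m]) (use True in \<open>simp add: Q1_def\<close>)
    then show ?thesis using True by simp
  next
    case False
    then have a: "0 < a" using a0 by simp
    \<comment> \<open>The exponent \<open>t\<close> below is the one for which the bound
      \<open>a * t\<^sup>2 / (2 * (1 - t)) - t * (a * r + x)\<close> is exactly \<open>- x\<close>.\<close>
    define r where "r = sqrt (2 * x / a)"
    have r0: "0 \<le> r" using assms(5) a by (simp add: r_def)
    have r2: "a * r\<^sup>2 = 2 * x" using assms(5) a by (simp add: r_def)
    have ar: "sqrt (2 * a * x) = a * r"
      using r0 a r2 by (intro real_sqrt_unique) (auto simp: power2_eq_square algebra_simps)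
    define t where "t = r / (1 + r)"
    have t: "0 \<le> t" "t < 1" "1 - t = 1 / (1 + r)" using r0 by (auto simp: t_def field_simps)
    have "emeasure ?P {X\<in>space ?P. Q1 X} \<le> ennreal (exp (a * (exp t - 1 - t) - t * (a * r + x)))"
    proof (rule chernoff[OF _ Q1m])
      fix X assume "Q1 X"
      then show "t * (a * r + x) \<le> t * (cnt A n X - a)"
        using t(1) unfolding Q1_def ar by (intro mult_left_mono) auto
    qed
    also have "a * (exp t - 1 - t) - t * (a * r + x) \<le> a * (t\<^sup>2 / (2 * (1 - t))) - t * (a * r + x)"
      by (intro diff_right_mono mult_left_mono exp_minus_linear_le t) (use a in simp)
    also have "a * (t\<^sup>2 / (2 * (1 - t))) = (a * r\<^sup>2) / (2 * (1 + r))"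
      using r0 unfolding t(3) by (simp add: t_def power2_eq_square)
    also have "t * (a * r + x) = (a * r\<^sup>2 + r * x) / (1 + r)"
      by (simp add: t_def power2_eq_square algebra_simps)
    also have "(a * r\<^sup>2) / (2 * (1 + r)) - (a * r\<^sup>2 + r * x) / (1 + r) = - x"
    proof -
      have d: "1 + r \<noteq> 0" using r0 by auto
      have "2 * x / (2 * (1 + r)) = x / (1 + r)" by (rule mult_divide_mult_cancel_left) simp
      moreover have "(2 * x + r * x) / (1 + r) = x / (1 + r) + x"
      proof -
        have "2 * x + r * x = x + x * (1 + r)" by (simp add: algebra_simps)
        moreover have "x * (1 + r) / (1 + r) = x" using d by simp
        ultimately show ?thesis by (simp only: add_divide_distrib)
      qed
      ultimately show ?thesis unfolding r2 by simp
    qed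
    finally show ?thesis by (simp add: ennreal_leI)
  qed
  have low: "emeasure ?P {X\<in>space ?P. Q2 X} \<le> ennreal (exp (sqrt (R / (8 * e))) * exp (- x))"
  proof (cases "x < a \<and> sqrt (2 * e * m * x) < a")
    case False
    \<comment> \<open>The term \<open>e * m\<close> makes the event impossible when the mean is small.\<close>
    have "\<not> Q2 X" for X
    proof
      assume Q: "Q2 X"
      have c: "0 \<le> cnt A n X" by (rule cnt_nonneg)
      have "sqrt (2 * e * m * x) \<le> sqrt (2 * (cnt A n X + e * m) * x)"
        using assms(3-5) c by (intro real_sqrt_le_mono) (auto simp: algebra_simps)
      moreover have "0 \<le> sqrt (2 * (cnt A n X + e * m) * x)"
        using assms(3-5) c by auto
      moreover have "0 \<le> sqrt (2 * e * m * x)" using assms(3-5) by auto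
      ultimately show False using Q False c assms(5) unfolding Q2_def by linarith
    qed
    then show ?thesis by simp
  next
    case True
    then have a: "0 < a" "x < a" using assms(5) by auto
    \<comment> \<open>Solving \<open>a - N > sqrt (2 * N * x) + x\<close> for the count \<open>N\<close> gives \<open>N < a - u\<close>.\<close>
    define u where "u = sqrt (2 * a * x - x\<^sup>2)"
    have xa: "x\<^sup>2 \<le> a * x" using a assms(5) by (simp add: power2_eq_square mult_right_mono)
    moreover have "0 \<le> a * x" using a assms(5) by simp
    ultimately have u2: "u\<^sup>2 = 2 * a * x - x\<^sup>2" "0 \<le> u" by (auto simp: u_def)
    have key: "cnt A n X \<le> a - u" if Q: "Q2 X" for X
    proof -
      let ?v = "a - cnt A n X"
      have c: "0 \<le> cnt A n X" by (rule cnt_nonneg)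
      have "sqrt (2 * cnt A n X * x) \<le> sqrt (2 * (cnt A n X + e * m) * x)"
        using assms(3-5) by (intro real_sqrt_le_mono mult_right_mono) auto
      then have v: "sqrt (2 * cnt A n X * x) < ?v - x" using Q unfolding Q2_def by linarith
      moreover have s0: "0 \<le> sqrt (2 * cnt A n X * x)" using c assms(5) by simp
      ultimately have "(sqrt (2 * cnt A n X * x))\<^sup>2 < (?v - x)\<^sup>2"
        by (intro power_strict_mono) auto
      then have "2 * cnt A n X * x < (?v - x)\<^sup>2" using c assms(5) by simp
      moreover have "2 * cnt A n X * x = 2 * a * x - 2 * ?v * x" by (simp add: algebra_simps)
      ultimately have "u\<^sup>2 < ?v\<^sup>2" using u2(1) unfolding power2_diff[of ?v x] by linarith
      moreover have "0 \<le> ?v" using v s0 assms(5) by linarith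
      ultimately have "u < ?v" by (rule power2_less_imp_less)
      then show ?thesis by simp
    qed
    have "emeasure ?P {X\<in>space ?P. Q2 X} \<le> ennreal (exp (a * (exp (- u / a) - 1 - (- u / a)) - u\<^sup>2 / a))"
    proof (rule chernoff[OF _ Q2m])
      fix X assume "Q2 X"
      have "u / a * cnt A n X \<le> u / a * (a - u)"
        using key[OF \<open>Q2 X\<close>] a u2(2) by (intro mult_left_mono) auto
      moreover have "u / a * (a - u) = u - u\<^sup>2 / a"
        using a by (simp add: right_diff_distrib power2_eq_square)
      moreover have "- u / a * (cnt A n X - a) = u - u / a * cnt A n X"
        using a by (simp add: right_diff_distrib)
      ultimately show "u\<^sup>2 / a \<le> - u / a * (cnt A n X - a)" by linarith
    qed
    also have "a * (exp (- u / a) - 1 - (- u / a)) - u\<^sup>2 / a \<le> a * ((u / a)\<^sup>2 / 2) - u\<^sup>2 / a"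
      using exp_minus_le_quadratic[of "u / a"] a u2(2) by (intro diff_right_mono mult_left_mono) auto
    also have "\<dots> = x\<^sup>2 / (2 * a) - x"
      using a by (simp add: power_divide u2(1)) (simp add: field_simps power2_eq_square)
    \<comment> \<open>Here \<open>a\<^sup>2 \<ge> 2 * e * m * x\<close>, whence \<open>x ^ 4 \<le> R * m * x \<le> a\<^sup>2 * R / (2 * e)\<close>.\<close>
    also have "x\<^sup>2 / (2 * a) \<le> sqrt (R / (8 * e))"
    proof -
      have R: "0 \<le> R" using order_trans[OF _ assms(6), of 0] assms(3,5) by (simp add: zero_le_mult_iff)
      have "sqrt (2 * e * m * x) ^ 2 \<le> a ^ 2" using True assms(3-5) by (intro power_mono) auto
      then have a2: "2 * e * m * x \<le> a\<^sup>2" using assms(3-5) by simp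
      have "(x\<^sup>2)\<^sup>2 = x * x ^ 3" by (simp add: power2_eq_square power3_eq_cube)
      also have "\<dots> \<le> x * (R * m)" using assms(5,6) by (intro mult_left_mono)
      also have "\<dots> = (2 * e * m * x) * (R / (2 * e))" using assms(4) by simp
      also have "\<dots> \<le> a\<^sup>2 * (R / (2 * e))" using a2 R assms(4) by (intro mult_right_mono) auto
      also have "\<dots> = (2 * a * sqrt (R / (8 * e)))\<^sup>2"
        using R assms(4) by (simp add: power_mult_distrib)
      finally have "x\<^sup>2 \<le> 2 * a * sqrt (R / (8 * e))"
        by (rule power2_le_imp_le) (use a R assms(4) in auto)
      then show ?thesis using a by (simp add: field_simps)
    qed
    finally show ?thesis by (simp add: ennreal_leI exp_diff exp_minus divide_simps ennreal_mult[symmetric])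
  qed
  have "emeasure ?P {X\<in>space ?P. sqrt (2 * (cnt A n X + e * m) * x) + x < \<bar>cnt A n X - a\<bar>}
      \<le> emeasure ?P ({X\<in>space ?P. Q1 X} \<union> {X\<in>space ?P. Q2 X})"
    by (intro emeasure_mono) (use sub Q1m Q2m in auto)
  also have "\<dots> \<le> emeasure ?P {X\<in>space ?P. Q1 X} + emeasure ?P {X\<in>space ?P. Q2 X}"
    by (intro emeasure_subadditive) (use Q1m Q2m in auto)
  also have "\<dots> \<le> ennreal (exp (- x)) + ennreal (exp (sqrt (R / (8 * e))) * exp (- x))"
    by (intro add_mono up low)
  also have "\<dots> = ennreal ((1 + exp (sqrt (R / (8 * e)))) * exp (- x))"
    by (simp add: ennreal_plus[symmetric] algebra_simps del: ennreal_plus)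
  finally show ?thesis .
qed

lemma fourth_moment_cnt:
  fixes m F :: real and n :: nat
  assumes "prob_space M" and A: "A \<in> sets M" and "1 \<le> m"
  defines "a \<equiv> real n * measure M A"
  assumes "a \<le> F * m"
  shows "(\<integral>\<^sup>+X. ennreal ((cnt A n X - a) ^ 4) \<partial>PiM {1..n} (\<lambda>_. M)) \<le> ennreal (48 * exp F * m\<^sup>2)"
proof -
  let ?P = "PiM {1..n} (\<lambda>_. M)"
  note [measurable] = measurable_cnt[OF A]
  \<comment> \<open>On the scale \<open>sqrt m\<close> the exponential moments are bounded by \<open>exp F\<close>.\<close>
  define t where "t = 1 / sqrt m"
  have t: "0 \<le> t" "t \<le> 1" "t\<^sup>2 = 1 / m" using assms(3) by (auto simp: t_def power_divide)
  have a0: "0 \<le> a" by (simp add: a_def)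
  have mgf: "(\<integral>\<^sup>+X. ennreal (exp (z * (cnt A n X - a))) \<partial>?P) \<le> ennreal (exp F)"
    if z: "exp z - 1 - z \<le> t\<^sup>2" for z
  proof -
    have "(\<integral>\<^sup>+X. ennreal (exp (z * (cnt A n X - a))) \<partial>?P) \<le> ennreal (exp (a * (exp z - 1 - z)))"
      unfolding a_def by (rule nn_integral_exp_cnt_centred) fact+
    also have "a * (exp z - 1 - z) \<le> a * t\<^sup>2" using z a0 by (intro mult_left_mono)
    also have "a * t\<^sup>2 \<le> F" using assms(3,5) by (simp add: t field_simps)
    finally show ?thesis by (simp add: ennreal_leI)
  qed
  have z1: "exp t - 1 - t \<le> t\<^sup>2" using exp_bound[OF t(1,2)] by simp
  have z2: "exp (- t) - 1 - (- t) \<le> t\<^sup>2" using exp_minus_le_quadratic[OF t(1)] zero_le_power2[of t] by linarith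
  have pw: "(cnt A n X - a) ^ 4 \<le> 24 * m\<^sup>2 * (exp (t * (cnt A n X - a)) + exp (- t * (cnt A n X - a)))" for X
  proof -
    let ?y = "t * (cnt A n X - a)"
    have "t ^ 4 = (t\<^sup>2)\<^sup>2" using power_mult[of t 2 2] by simp
    then have "t ^ 4 = 1 / m\<^sup>2" unfolding t(3) by (simp add: power_divide)
    then have "(cnt A n X - a) ^ 4 = m\<^sup>2 * ?y ^ 4" using assms(3) by (simp add: power_mult_distrib)
    also have "\<dots> \<le> m\<^sup>2 * (24 * (exp ?y + exp (- ?y)))"
      by (intro mult_left_mono power4_le_exp) auto
    finally show ?thesis by (simp add: algebra_simps)
  qed
  have "(\<integral>\<^sup>+X. ennreal ((cnt A n X - a) ^ 4) \<partial>?P)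
      \<le> (\<integral>\<^sup>+X. ennreal (24 * m\<^sup>2) * (ennreal (exp (t * (cnt A n X - a))) + ennreal (exp (- t * (cnt A n X - a)))) \<partial>?P)"
    by (intro nn_integral_mono) (use pw in \<open>simp add: ennreal_plus[symmetric] ennreal_mult[symmetric] ennreal_leI del: ennreal_plus\<close>)
  also have "\<dots> = ennreal (24 * m\<^sup>2) * ((\<integral>\<^sup>+X. ennreal (exp (t * (cnt A n X - a))) \<partial>?P)
      + (\<integral>\<^sup>+X. ennreal (exp (- t * (cnt A n X - a))) \<partial>?P))"
    by (subst nn_integral_cmult, measurable, subst nn_integral_add, measurable)
  also have "\<dots> \<le> ennreal (24 * m\<^sup>2) * (ennreal (exp F) + ennreal (exp F))"
    by (intro mult_left_mono add_mono mgf z1 z2) auto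
  also have "\<dots> = ennreal (48 * exp F * m\<^sup>2)"
    by (simp add: ennreal_plus[symmetric] ennreal_mult[symmetric] algebra_simps del: ennreal_plus)
  finally show ?thesis .
qed

lemma excess_second_moment:
  fixes e m x R F :: real and n :: nat
  assumes "prob_space M" and A: "A \<in> sets M"
    and "1 \<le> m" "0 < e" "0 \<le> x" "x ^ 3 \<le> R * m"
  defines "a \<equiv> real n * measure M A"
  assumes "a \<le> F * m"
  shows "(\<integral>\<^sup>+X. ennreal ((max (\<bar>cnt A n X - a\<bar> - (sqrt (2 * (cnt A n X + e * m) * x) + x)) 0)\<^sup>2) \<partial>PiM {1..n} (\<lambda>_. M))
       \<le> ennreal ((48 * exp F + 1 + exp (sqrt (R / (8 * e)))) / 2 * (m * exp (- x / 2)))"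
proof -
  let ?P = "PiM {1..n} (\<lambda>_. M)"
  note [measurable] = measurable_cnt[OF A]
  let ?U = "\<lambda>X. sqrt (2 * (cnt A n X + e * m) * x) + x"
  define E where "E = {X\<in>space ?P. ?U X < \<bar>cnt A n X - a\<bar>}"
  have [measurable]: "E \<in> sets ?P" unfolding E_def by measurable
  \<comment> \<open>On the event \<open>E\<close> use \<open>y\<^sup>2 \<le> c / 2 * y ^ 4 + 1 / (2 * c)\<close>; this choice of \<open>c\<close> balances the two
    expectations.\<close>
  define c where "c = exp (- x / 2) / m"
  have c: "0 < c" using assms(3) by (simp add: c_def)
  have pw: "ennreal ((max (\<bar>cnt A n X - a\<bar> - ?U X) 0)\<^sup>2)
      \<le> ennreal (c / 2) * ennreal ((cnt A n X - a) ^ 4) + ennreal (1 / (2 * c)) * indicator E X"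
    if "X \<in> space ?P" for X
  proof (cases "X \<in> E")
    case True
    let ?y = "\<bar>cnt A n X - a\<bar>"
    have U0: "0 \<le> ?U X" using cnt_nonneg[of A n X] assms(3-5) by auto
    have "(max (?y - ?U X) 0)\<^sup>2 \<le> ?y\<^sup>2" using U0 by (intro power_mono) auto
    also have "?y\<^sup>2 \<le> c / 2 * (?y\<^sup>2)\<^sup>2 + 1 / (2 * c)"
    proof -
      have "0 \<le> (c * ?y\<^sup>2 - 1)\<^sup>2" by simp
      then have "2 * c * ?y\<^sup>2 \<le> c\<^sup>2 * (?y\<^sup>2)\<^sup>2 + 1" by (simp add: power2_eq_square algebra_simps)
      then show ?thesis using c by (simp add: field_simps power2_eq_square)
    qed
    also have "(?y\<^sup>2)\<^sup>2 = (cnt A n X - a) ^ 4" by (simp flip: power_mult)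
    finally show ?thesis using True c
      by (simp add: ennreal_plus[symmetric] ennreal_mult[symmetric] ennreal_leI del: ennreal_plus)
  next
    case False
    then show ?thesis using that by (simp add: E_def)
  qed
  have "(\<integral>\<^sup>+X. ennreal ((max (\<bar>cnt A n X - a\<bar> - ?U X) 0)\<^sup>2) \<partial>?P)
      \<le> (\<integral>\<^sup>+X. ennreal (c / 2) * ennreal ((cnt A n X - a) ^ 4) + ennreal (1 / (2 * c)) * indicator E X \<partial>?P)"
    by (intro nn_integral_mono pw)
  also have "\<dots> = ennreal (c / 2) * (\<integral>\<^sup>+X. ennreal ((cnt A n X - a) ^ 4) \<partial>?P) + ennreal (1 / (2 * c)) * emeasure ?P E"
    proof -
    have [measurable]: "(\<lambda>X. ennreal ((cnt A n X - a) ^ 4)) \<in> borel_measurable ?P" by measurable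
    show ?thesis
      by (subst nn_integral_add, measurable, subst nn_integral_cmult, measurable,
          subst nn_integral_cmult_indicator, measurable)
  qed
  also have "\<dots> \<le> ennreal (c / 2) * ennreal (48 * exp F * m\<^sup>2)
      + ennreal (1 / (2 * c)) * ennreal ((1 + exp (sqrt (R / (8 * e)))) * exp (- x))"
    unfolding a_def E_def
    by (intro add_mono mult_left_mono fourth_moment_cnt deviation_tail) (use assms in \<open>auto simp: a_def\<close>)
  also have "\<dots> = ennreal (c / 2 * (48 * exp F * m\<^sup>2) + 1 / (2 * c) * ((1 + exp (sqrt (R / (8 * e)))) * exp (- x)))"
    using c by (simp add: ennreal_plus[symmetric] ennreal_mult[symmetric] add_nonneg_nonneg del: ennreal_plus)
  also have "c / 2 * (48 * exp F * m\<^sup>2) + 1 / (2 * c) * ((1 + exp (sqrt (R / (8 * e)))) * exp (- x))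
      = (48 * exp F + 1 + exp (sqrt (R / (8 * e)))) / 2 * (m * exp (- x / 2))"
  proof -
    have c1: "c * m\<^sup>2 = m * exp (- x / 2)" using assms(3) by (simp add: c_def power2_eq_square)
    have c2: "exp (- x) / c = m * exp (- x / 2)"
      using assms(3) by (simp add: c_def mult_exp_exp field_simps flip: exp_minus exp_add)
    have c3: "c / 2 * (48 * exp F * m\<^sup>2) + 1 / (2 * c) * ((1 + E0) * exp (- x))
        = 24 * exp F * (c * m\<^sup>2) + (1 + E0) / 2 * (exp (- x) / c)" for E0 :: real
      by simp
    show ?thesis unfolding c3 c1 c2 by (simp add: algebra_simps add_divide_distrib)
  qed
  finally show ?thesis .
qed

section \<open>Local constant estimators on the cusp\<close>

text \<open>The part of the cusp within sup-norm distance \<open>h\<close> of the origin.\<close>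

definition cusp_cut :: "real \<Rightarrow> real \<Rightarrow> (real \<times> real) set" where
  "cusp_cut k h = cusp k \<inter> {u. fst u \<le> h}"

text \<open>The area of \<open>cusp_cut k h\<close> for \<open>0 < h \<le> 1\<close>.\<close>

definition vol :: "real \<Rightarrow> real \<Rightarrow> real" where
  "vol k h = h powr (k + 1) / (k + 1)"

lemma cusp_measurable [measurable]: "cusp k \<in> sets borel"
proof -
  have "cusp k = {u \<in> space (borel \<Otimes>\<^sub>M borel). 0 \<le> fst u \<and> fst u \<le> 1 \<and> 0 \<le> snd u \<and> snd u \<le> fst u powr k}"
    by (auto simp: cusp_def space_pair_measure)
  also have "\<dots> \<in> sets (borel \<Otimes>\<^sub>M borel)" by measurable
  finally show ?thesis by (simp only: borel_prod)
qed

lemma cusp_cut_measurable [measurable]: "cusp_cut k h \<in> sets borel"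
proof -
  have "{u \<in> space (borel \<Otimes>\<^sub>M borel). fst u \<le> h} \<in> sets (borel \<Otimes>\<^sub>M (borel :: real measure))" by measurable
  then have "{u :: real \<times> real. fst u \<le> h} \<in> sets borel" by (simp only: borel_prod space_pair_measure space_borel) simp
  then show ?thesis unfolding cusp_cut_def by (intro sets.Int cusp_measurable)
qed

lemma vol_pos: "0 < h \<Longrightarrow> 1 < k \<Longrightarrow> 0 < vol k h"
  by (simp add: vol_def)

lemma emeasure_cusp_cut:
  assumes k: "1 < k" and h: "0 < h" "h \<le> 1"
  shows "emeasure lborel (cusp_cut k h) = ennreal (vol k h)"
proof -
  have "emeasure lborel (cusp_cut k h) = emeasure (lborel \<Otimes>\<^sub>M lborel) (cusp_cut k h)"
    by (simp add: lborel_prod)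
  also have "\<dots> = (\<integral>\<^sup>+x. emeasure lborel (Pair x -` cusp_cut k h) \<partial>lborel)"
    by (intro lborel.emeasure_pair_measure_alt) (simp only: lborel_prod sets_lborel cusp_cut_measurable)
  also have "\<dots> = (\<integral>\<^sup>+x. ennreal (x powr k) * indicator {0..h} x \<partial>lborel)"
  proof (intro nn_integral_cong)
    fix x :: real
    have "Pair x -` cusp_cut k h = (if 0 \<le> x \<and> x \<le> h then {0..x powr k} else {})"
      using h by (auto simp: cusp_cut_def cusp_def)
    then show "emeasure lborel (Pair x -` cusp_cut k h) = ennreal (x powr k) * indicator {0..h} x"
      by simp
  qed
  also have "\<dots> = (\<integral>\<^sup>+x. ennreal (indicator {0..h} x * x powr k) \<partial>lborel)"
    by (intro nn_integral_cong) (auto simp: indicator_def)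
  also have "\<dots> = ennreal (vol k h)"
    unfolding vol_def using k h
    by (intro nn_integral_has_integral_lebesgue has_integral_powr_from_0) auto
  finally show ?thesis .
qed

lemma infnorm_cusp:
  assumes "1 < k" "u \<in> cusp k"
  shows "infnorm u = fst u"
proof -
  have "infnorm u = max \<bar>fst u\<bar> \<bar>snd u\<bar>"
    unfolding infnorm_Max Basis_prod_def
    by (cases u) (auto simp: image_Un image_image inner_Pair Max_Un)
  moreover have "fst u powr k \<le> fst u"
    using assms powr_mono'[of 1 k "fst u"] by (cases "fst u = 0") (auto simp: cusp_def)
  ultimately show ?thesis using assms by (auto simp: cusp_def)
qed

text \<open>On the cusp \<open>y \<le> x powr k \<le> x\<close>, so only the first coordinate matters for the sup norm.\<close>

lemma wker_cusp:
  assumes "1 < k" "0 < h" "h \<le> 1"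
  shows "wker (cusp k) h u = indicator (cusp_cut k h) u / h\<^sup>2"
proof (cases "u \<in> cusp k")
  case True
  then obtain x y where u: "u = (x, y)" "0 \<le> x" "x \<le> 1" "0 \<le> y" "y \<le> x powr k" by (auto simp: cusp_def)
  have "x powr k \<le> x"
    using assms u powr_mono'[of 1 k x] by (cases "x = 0") auto
  then have "u /\<^sub>R h \<in> Delta \<longleftrightarrow> x \<le> h"
    using u assms by (auto simp: Delta_def field_simps)
  then show ?thesis using True u by (simp add: wker_def cusp_cut_def indicator_def flip: zero_prod_def)
next
  case False
  then show ?thesis by (simp add: wker_def cusp_cut_def flip: zero_prod_def)
qed

lemma Wker_cusp:
  assumes "1 < k" "0 < h" "h \<le> 1"
  shows "Wker (cusp k) h = vol k h / h\<^sup>2"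
proof -
  have "measure lborel (cusp_cut k h) = vol k h"
    using emeasure_cusp_cut[OF assms] vol_pos[of h k] assms by (simp add: measure_def)
  then show ?thesis
    by (simp add: Wker_def wker_cusp[OF assms])
qed

lemma Dm_0: "Dm 0 = 1" by (simp add: Dm_def numeral_2_eq_2)

lemma Phi_degree_0: "Phi (0, h) u = Matrix.vec 1 (\<lambda>_. 1)"
  by (rule eq_vecI) (auto simp: Phi_def Dm_0 mindices_def mono_fun_def)

lemma Bmat_degree_0: "Bmat D (0, h) = Matrix.mat 1 1 (\<lambda>_. Wker D h)"
  by (rule eq_matI) (auto simp: Bmat_def Dm_0 Wker_def Phi_degree_0)

text \<open>For degree \<open>0\<close> the Gram matrix is \<open>1 \<times> 1\<close>, and its eigenvalue, Cholesky factor and inverse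
are explicit.\<close>

lemma lam_degree_0: "lam D (0, h) = Wker D h"
proof -
  have "{e. eigenvalue (Bmat D (0, h)) e} = {Wker D h}"
  proof safe
    fix e assume "eigenvalue (Bmat D (0, h)) e"
    then obtain v where v: "v \<in> carrier_vec 1" "v \<noteq> 0\<^sub>v 1"
      and eq: "Bmat D (0, h) *\<^sub>v v = e \<cdot>\<^sub>v v"
      unfolding eigenvalue_def eigenvector_def Bmat_degree_0 by auto
    have "(Bmat D (0, h) *\<^sub>v v) $ 0 = Wker D h * v $ 0"
      using v(1) by (simp add: Bmat_degree_0 scalar_prod_def)
    then have "Wker D h * v $ 0 = e * v $ 0" using v(1) unfolding eq by auto
    moreover have "v $ 0 \<noteq> 0"
    proof
      assume "v $ 0 = 0"
      then have "v = 0\<^sub>v 1" using v(1) by (intro eq_vecI) auto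
      then show False using v(2) by simp
    qed
    ultimately show "e = Wker D h" by auto
  next
    have "eigenvector (Bmat D (0, h)) (Matrix.vec 1 (\<lambda>_. 1)) (Wker D h)"
      unfolding eigenvector_def Bmat_degree_0
      by (auto simp: vec_eq_iff scalar_prod_def)
    then show "eigenvalue (Bmat D (0, h)) (Wker D h)" unfolding eigenvalue_def by blast
  qed
  then show ?thesis by (simp add: lam_def)
qed

lemma cholesky_degree_0:
  assumes "0 < Wker D h"
  shows "cholesky (Bmat D (0, h)) = Matrix.mat 1 1 (\<lambda>_. sqrt (Wker D h))"
  unfolding cholesky_def Bmat_degree_0
proof (rule the_equality, goal_cases)
  case 1
  then show ?case using assms
    by (auto simp: intro!: eq_matI simp: scalar_prod_def)
next
  case (2 G)
  then have G: "G \<in> carrier_mat 1 1" "0 < G $$ (0, 0)"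
    and eq: "G * transpose_mat G = Matrix.mat 1 1 (\<lambda>_. Wker D h)" by auto
  have "(G * transpose_mat G) $$ (0, 0) = G $$ (0, 0) * G $$ (0, 0)"
    using G by (simp add: scalar_prod_def)
  then have "G $$ (0, 0) * G $$ (0, 0) = Wker D h" unfolding eq by simp
  then have "G $$ (0, 0) = sqrt (Wker D h)" using G(2) by (metis abs_of_pos real_sqrt_abs2)
  then show ?case using G by (intro eq_matI) auto
qed

lemma Hvec_degree_0:
  assumes "0 < Wker D h"
  shows "Hvec D (0, h) u = Matrix.vec 1 (\<lambda>_. 1 / sqrt (Wker D h))"
proof -
  let ?w = "sqrt (Wker D h)"
  let ?A = "Matrix.mat 1 1 (\<lambda>_. ?w)" and ?B = "Matrix.mat 1 1 (\<lambda>_. 1 / ?w)"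
  have w: "0 < ?w" using assms by simp
  have A: "?A \<in> carrier_mat 1 1" by simp
  have "?A * ?B = 1\<^sub>m 1" "?B * ?A = 1\<^sub>m 1"
    using assms by (auto intro!: eq_matI simp: scalar_prod_def)
  then have "?A \<in> Units (ring_mat TYPE(real) 1 ())"
    unfolding Units_def by (auto simp: ring_mat_simps intro!: bexI[of _ ?B])
  then obtain C where C: "mat_inverse ?A = Some C" using mat_inverse(1)[OF A] by fastforce
  from mat_inverse(2)[OF A C] have C1: "?A * C = 1\<^sub>m 1" "C \<in> carrier_mat 1 1" by auto
  have "(?A * C) $$ (0, 0) = ?w * C $$ (0, 0)" using C1(2) by (simp add: scalar_prod_def)
  then have "?w * C $$ (0, 0) = 1" unfolding C1(1) by simp
  then have "C $$ (0, 0) = 1 / ?w" using w by (simp add: field_simps)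
  then have "C = ?B" using C1(2) by (intro eq_matI) auto
  then show ?thesis
    unfolding Hvec_def cholesky_degree_0[OF assms] C Phi_degree_0
    by (intro eq_vecI) (auto simp: scalar_prod_def)
qed

lemma lp_weight_cusp:
  assumes "1 < k" "0 < h" "h \<le> 1"
  shows "lp_weight (cusp k) (0, h) u = indicator (cusp_cut k h) u / vol k h"
proof -
  have W: "0 < Wker (cusp k) h" using vol_pos[of h k] assms by (simp add: Wker_cusp)
  have "lp_weight (cusp k) (0, h) u = 1 / Wker (cusp k) h * wker (cusp k) h u"
    using W by (simp add: lp_weight_def Hvec_degree_0[OF W] scalar_prod_def)
  then show ?thesis using assms by (simp add: wker_cusp Wker_cusp)
qed

section \<open>Densities on the cusp\<close>

text \<open>The law of one observation with density \<open>f\<close>.\<close>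

abbreviation cusp_law :: "real \<Rightarrow> (real \<times> real \<Rightarrow> real) \<Rightarrow> (real \<times> real) measure" where
  "cusp_law k f \<equiv> density lborel (\<lambda>x. ennreal (f x) * indicator (cusp k) x)"

lemma zero_in_cusp: "(0, 0) \<in> cusp k"
  by (simp add: cusp_def)

lemma density_measurable:
  assumes "is_density (cusp k) f"
  shows "(\<lambda>x. ennreal (f x) * indicator (cusp k) x) \<in> borel_measurable borel"
proof -
  have "(\<lambda>x. ennreal (f x)) \<in> borel_measurable (restrict_space borel (cusp k))"
    using assms by (intro measurable_compose[OF _ measurable_ennreal]) (simp add: is_density_def)
  then show ?thesis
    by (subst (asm) borel_measurable_restrict_space_iff_ennreal) (auto simp: cusp_measurable)
qed

lemma prob_space_cusp_law:
  assumes "is_density (cusp k) f"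
  shows "prob_space (cusp_law k f)"
proof
  show "emeasure (cusp_law k f) (space (cusp_law k f)) = 1"
    using assms density_measurable[OF assms] by (simp add: emeasure_density is_density_def)
qed

lemma emeasure_cusp_law:
  assumes "is_density (cusp k) f" "A \<in> sets borel"
  shows "emeasure (cusp_law k f) A = (\<integral>\<^sup>+x. ennreal (f x) * indicator (cusp k \<inter> A) x \<partial>lborel)"
  using density_measurable[OF assms(1)] assms(2)
  by (simp add: emeasure_density indicator_inter_arith mult.assoc)

lemma Poly_0: "Poly 0 = {q. \<exists>c. q = (\<lambda>_. c)}"
proof -
  have *: "{\<alpha>::nat \<times> nat. fst \<alpha> + snd \<alpha> \<le> 0} = {(0, 0)}" by auto
  show ?thesis unfolding Poly_def * by (auto simp: mono_fun_def intro: exI[of _ "\<lambda>_. c" for c])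
qed

text \<open>For \<open>s \<le> 1\<close> the approximating polynomial is a constant, and the condition at \<open>u = 0\<close> forces it
to be \<open>f (0, 0)\<close>.\<close>

lemma Sigma_class_cusp_iff:
  assumes k: "1 < k" and s: "0 < s" "s \<le> 1"
  shows "f \<in> Sigma_class (cusp k) s L \<longleftrightarrow>
    is_density (cusp k) f \<and> (\<forall>u\<in>cusp k. \<bar>f u - f (0, 0)\<bar> \<le> L * fst u powr s)"
proof -
  have "\<lceil>s\<rceil> = 1" using s by (simp add: ceiling_eq_iff)
  then have deg: "nat (\<lceil>s\<rceil> - 1) = 0" by simp
  have V: "Vnbh (cusp k) 1 = cusp k"
    using infnorm_cusp[OF k] by (auto simp: Vnbh_def cusp_def simp flip: zero_prod_def)
  have "(\<exists>q\<in>Poly 0. \<forall>u\<in>cusp k. \<bar>f u - q u\<bar> \<le> L * infnorm u powr s)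
      \<longleftrightarrow> (\<exists>c. \<forall>u\<in>cusp k. \<bar>f u - c\<bar> \<le> L * fst u powr s)"
    using infnorm_cusp[OF k] by (auto simp: Poly_0)
  also have "\<dots> \<longleftrightarrow> (\<forall>u\<in>cusp k. \<bar>f u - f (0, 0)\<bar> \<le> L * fst u powr s)"
  proof
    assume "\<exists>c. \<forall>u\<in>cusp k. \<bar>f u - c\<bar> \<le> L * fst u powr s"
    then obtain c where c: "\<forall>u\<in>cusp k. \<bar>f u - c\<bar> \<le> L * fst u powr s" by blast
    have "f (0, 0) = c" using c[rule_format, OF zero_in_cusp] s by simp
    then show "\<forall>u\<in>cusp k. \<bar>f u - f (0, 0)\<bar> \<le> L * fst u powr s" using c by simp
  qed blast
  finally show ?thesis
    unfolding Sigma_class_def deg V by (simp flip: zero_prod_def)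
qed

lemma sample_law_eq: "sample_law (cusp k) n f = PiM {1..n} (\<lambda>_. cusp_law k f)"
  by (simp add: sample_law_def)

lemma ennsqrt_le_iff:
  assumes "0 \<le> x"
  shows "ennsqrt I \<le> ennreal x \<longleftrightarrow> I \<le> ennreal (x\<^sup>2)"
proof (cases I)
  case (real r)
  then have "ennsqrt I \<le> ennreal x \<longleftrightarrow> sqrt r \<le> x" using assms by (simp add: ennsqrt_def)
  also have "\<dots> \<longleftrightarrow> r \<le> x\<^sup>2" using real_sqrt_le_iff[of r "x\<^sup>2"] assms by simp
  finally show ?thesis using real assms by simp
next
  case top
  then show ?thesis by (simp add: ennsqrt_def top_unique)
qed

lemma risk_le_iff:
  assumes "0 \<le> x"
  shows "risk D n T f \<le> ennreal x \<longleftrightarrow> (\<integral>\<^sup>+X. ennreal ((T X - f (0, 0))\<^sup>2) \<partial>sample_law D n f) \<le> ennreal (x\<^sup>2)"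
  unfolding risk_def by (rule ennsqrt_le_iff[OF assms])


section \<open>The two-point lower bound\<close>

lemma PiM_density_eq:
  fixes r :: "'a \<Rightarrow> real" and n :: nat
  assumes "prob_space M" and r [measurable]: "r \<in> borel_measurable M" and r0: "\<And>x. 0 \<le> r x"
    and "prob_space (density M (\<lambda>x. ennreal (r x)))"
  shows "PiM {1..n} (\<lambda>_. density M (\<lambda>x. ennreal (r x)))
       = density (PiM {1..n} (\<lambda>_. M)) (\<lambda>X. ennreal (\<Prod>i = 1..n. r (X i)))"
proof -
  interpret M: prob_space M by fact
  interpret M1: prob_space "density M (\<lambda>x. ennreal (r x))" by fact
  interpret P: product_sigma_finite "\<lambda>_::nat. M" by unfold_locales
  interpret P1: product_sigma_finite "\<lambda>_::nat. density M (\<lambda>x. ennreal (r x))" by unfold_locales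
  let ?I = "{1..n}"
  have meas [measurable]: "(\<lambda>X. ennreal (\<Prod>i\<in>?I. r (X i))) \<in> borel_measurable (PiM ?I (\<lambda>_. M))" by measurable
  have "density (PiM ?I (\<lambda>_. M)) (\<lambda>X. ennreal (\<Prod>i\<in>?I. r (X i))) = PiM ?I (\<lambda>_. density M (\<lambda>x. ennreal (r x)))"
  proof (rule P1.PiM_eqI)
    show "sets (density (PiM ?I (\<lambda>_. M)) (\<lambda>X. ennreal (\<Prod>i\<in>?I. r (X i)))) = sets (PiM ?I (\<lambda>_. density M (\<lambda>x. ennreal (r x))))"
      by (simp cong: sets_PiM_cong)
    fix A assume "\<And>i. i \<in> ?I \<Longrightarrow> A i \<in> sets (density M (\<lambda>x. ennreal (r x)))"
    then have A: "\<And>i. i \<in> ?I \<Longrightarrow> A i \<in> sets M" by simp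
    have "emeasure (density (PiM ?I (\<lambda>_. M)) (\<lambda>X. ennreal (\<Prod>i\<in>?I. r (X i)))) (Pi\<^sub>E ?I A)
        = (\<integral>\<^sup>+X. ennreal (\<Prod>i\<in>?I. r (X i)) * indicator (Pi\<^sub>E ?I A) X \<partial>PiM ?I (\<lambda>_. M))"
      using A by (intro emeasure_density meas) (auto intro!: sets_PiM_I_finite)
    also have "\<dots> = (\<integral>\<^sup>+X. (\<Prod>i\<in>?I. ennreal (r (X i)) * indicator (A i) (X i)) \<partial>PiM ?I (\<lambda>_. M))"
    proof (intro nn_integral_cong)
      fix X assume X: "X \<in> space (PiM ?I (\<lambda>_. M))"
      have "(indicator (Pi\<^sub>E ?I A) X :: ennreal) = (\<Prod>i\<in>?I. indicator (A i) (X i))"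
        using X by (auto simp: indicator_def space_PiM PiE_iff intro!: prod_zero[symmetric])
      then show "ennreal (\<Prod>i\<in>?I. r (X i)) * indicator (Pi\<^sub>E ?I A) X = (\<Prod>i\<in>?I. ennreal (r (X i)) * indicator (A i) (X i))"
        using r0 by (simp add: prod.distrib prod_ennreal)
    qed
    also have "\<dots> = (\<Prod>i\<in>?I. \<integral>\<^sup>+x. ennreal (r x) * indicator (A i) x \<partial>M)"
      using A by (intro P.product_nn_integral_prod) auto
    also have "\<dots> = (\<Prod>i\<in>?I. emeasure (density M (\<lambda>x. ennreal (r x))) (A i))"
      using A by (intro prod.cong refl) (simp add: emeasure_density)
    finally show "emeasure (density (PiM ?I (\<lambda>_. M)) (\<lambda>X. ennreal (\<Prod>i\<in>?I. r (X i)))) (Pi\<^sub>E ?I A)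
      = (\<Prod>i\<in>?I. emeasure (density M (\<lambda>x. ennreal (r x))) (A i))" .
  qed simp
  then show ?thesis ..
qed

text \<open>The pointwise form of the two-point argument; \<open>q\<close> stands for the likelihood ratio and \<open>y\<close> for the
value of the estimator. Either \<open>y\<close> is far from \<open>\<theta>1\<close>, or it is far from \<open>\<theta>0\<close> and \<open>q\<close> is bounded by
\<open>B + q\<^sup>2 / (4 * B)\<close>.\<close>

lemma two_point_inequality:
  fixes y \<theta>0 \<theta>1 B q :: real
  assumes "1 \<le> B" "0 \<le> q"
  shows "(\<theta>1 - \<theta>0)\<^sup>2 / 4 * q \<le> (y - \<theta>1)\<^sup>2 * q + B * (y - \<theta>0)\<^sup>2 + (\<theta>1 - \<theta>0)\<^sup>2 / (16 * B) * q\<^sup>2"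
proof (cases "(\<theta>1 - \<theta>0)\<^sup>2 / 4 \<le> (y - \<theta>1)\<^sup>2")
  case True
  have "0 \<le> B * (y - \<theta>0)\<^sup>2 + (\<theta>1 - \<theta>0)\<^sup>2 / (16 * B) * q\<^sup>2" using assms by simp
  then show ?thesis using mult_right_mono[OF True assms(2)] by linarith
next
  case False
  let ?g = "(\<theta>1 - \<theta>0)\<^sup>2"
  have far: "?g / 4 \<le> (y - \<theta>0)\<^sup>2"
  proof -
    have "\<bar>y - \<theta>1\<bar> < \<bar>\<theta>1 - \<theta>0\<bar> / 2"
      by (rule power2_less_imp_less) (use False in \<open>auto simp: power_divide\<close>)
    then have "\<bar>\<theta>1 - \<theta>0\<bar> / 2 \<le> \<bar>y - \<theta>0\<bar>" by (simp add: abs_if split: if_splits)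
    then have "(\<bar>\<theta>1 - \<theta>0\<bar> / 2)\<^sup>2 \<le> \<bar>y - \<theta>0\<bar>\<^sup>2" by (intro power_mono) auto
    then show ?thesis by (simp add: power_divide)
  qed
  have "0 \<le> ?g / 4 / B * (B - q / 2)\<^sup>2" using assms by simp
  also have "\<dots> = B * (?g / 4) + ?g / (16 * B) * q\<^sup>2 - ?g / 4 * q"
    using assms by (simp add: power2_eq_square field_simps)
  finally have "?g / 4 * q \<le> B * (?g / 4) + ?g / (16 * B) * q\<^sup>2" by simp
  moreover have "B * (?g / 4) \<le> B * (y - \<theta>0)\<^sup>2" using far assms by (intro mult_left_mono) auto
  moreover have "0 \<le> (y - \<theta>1)\<^sup>2 * q" using assms by simp
  ultimately show ?thesis by linarith
qed

text \<open>If the likelihood ratio \<open>r\<close> of one observation has second moment at most \<open>b\<close>, then that of \<open>n\<close>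
observations has second moment at most \<open>b ^ n\<close>. The square risks at the two parameters cannot both be
small, even if the one at \<open>\<theta>0\<close> is inflated by this factor.\<close>

lemma two_point_lower_bound:
  fixes r :: "'a \<Rightarrow> real" and n :: nat and B \<theta>0 \<theta>1 :: real
  assumes M: "prob_space M" and r [measurable]: "r \<in> borel_measurable M" and r0: "\<And>x. 0 \<le> r x"
    and M1: "prob_space (density M (\<lambda>x. ennreal (r x)))"
    and chi: "(\<integral>\<^sup>+x. ennreal ((r x)\<^sup>2) \<partial>M) \<le> ennreal b" and b: "1 \<le> b"
    and T [measurable]: "T \<in> borel_measurable (PiM {1..n} (\<lambda>_. M))"
  shows "ennreal (3 / 16 * (\<theta>1 - \<theta>0)\<^sup>2)
     \<le> ennreal (b ^ n) * (\<integral>\<^sup>+X. ennreal ((T X - \<theta>0)\<^sup>2) \<partial>PiM {1..n} (\<lambda>_. M))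
        + (\<integral>\<^sup>+X. ennreal ((T X - \<theta>1)\<^sup>2) \<partial>PiM {1..n} (\<lambda>_. density M (\<lambda>x. ennreal (r x))))"
proof -
  interpret M: prob_space M by fact
  interpret P: product_sigma_finite "\<lambda>_::nat. M" by unfold_locales
  let ?P = "PiM {1..n} (\<lambda>_. M)" and ?P1 = "PiM {1..n} (\<lambda>_. density M (\<lambda>x. ennreal (r x)))"
  let ?g = "(\<theta>1 - \<theta>0)\<^sup>2"
  define q where "q = (\<lambda>X. \<Prod>i = 1..n. r (X i))"
  have qm [measurable]: "q \<in> borel_measurable ?P" unfolding q_def by measurable
  have q0: "0 \<le> q X" for X unfolding q_def by (intro prod_nonneg r0)
  have P1: "?P1 = density ?P (\<lambda>X. ennreal (q X))"
    unfolding q_def by (rule PiM_density_eq) fact+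
  have prob1: "prob_space ?P1" by (intro prob_space_PiM M1)
  let ?B = "b ^ n"
  have B: "1 \<le> ?B" using b by simp
  have q1: "(\<integral>\<^sup>+X. ennreal (q X) \<partial>?P) = 1"
  proof -
    have "emeasure ?P1 (space ?P1) = 1" by (rule prob_space.emeasure_space_1[OF prob1])
    moreover have "emeasure ?P1 (space ?P1) = (\<integral>\<^sup>+X. ennreal (q X) * indicator (space ?P) X \<partial>?P)"
      unfolding P1 space_density by (rule emeasure_density) measurable
    moreover have "\<dots> = (\<integral>\<^sup>+X. ennreal (q X) \<partial>?P)"
      by (intro nn_integral_cong) simp
    ultimately show ?thesis by simp
  qed
  have q2: "(\<integral>\<^sup>+X. ennreal ((q X)\<^sup>2) \<partial>?P) \<le> ennreal ?B"
  proof -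
    have "(\<integral>\<^sup>+X. ennreal ((q X)\<^sup>2) \<partial>?P) = (\<integral>\<^sup>+X. (\<Prod>i = 1..n. ennreal ((r (X i))\<^sup>2)) \<partial>?P)"
      by (intro nn_integral_cong) (simp add: q_def prod_power_distrib prod_ennreal)
    also have "\<dots> = (\<Prod>i = 1..n. \<integral>\<^sup>+x. ennreal ((r x)\<^sup>2) \<partial>M)"
      by (intro P.product_nn_integral_prod) auto
    also have "\<dots> \<le> (\<Prod>i = 1..n. ennreal b)" by (rule prod_mono_ennreal) (rule chi)
    also have "\<dots> = ennreal ?B" using b by (simp add: ennreal_power)
    finally show ?thesis .
  qed
  let ?I0 = "\<integral>\<^sup>+X. ennreal ((T X - \<theta>0)\<^sup>2) \<partial>?P" and ?I1 = "\<integral>\<^sup>+X. ennreal ((T X - \<theta>1)\<^sup>2) \<partial>?P1"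
  have T1: "?I1 = (\<integral>\<^sup>+X. ennreal (q X) * ennreal ((T X - \<theta>1)\<^sup>2) \<partial>?P)"
    unfolding P1 by (rule nn_integral_density) measurable
  have "ennreal (?g / 4) = (\<integral>\<^sup>+X. ennreal (?g / 4) * ennreal (q X) \<partial>?P)"
    by (subst nn_integral_cmult, measurable, simp only: q1 mult_1_right)
  also have "\<dots> \<le> (\<integral>\<^sup>+X. ennreal (q X) * ennreal ((T X - \<theta>1)\<^sup>2) + ennreal ?B * ennreal ((T X - \<theta>0)\<^sup>2)
      + ennreal (?g / (16 * ?B)) * ennreal ((q X)\<^sup>2) \<partial>?P)"
  proof (intro nn_integral_mono)
    fix X
    show "ennreal (?g / 4) * ennreal (q X) \<le> ennreal (q X) * ennreal ((T X - \<theta>1)\<^sup>2)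
        + ennreal ?B * ennreal ((T X - \<theta>0)\<^sup>2) + ennreal (?g / (16 * ?B)) * ennreal ((q X)\<^sup>2)"
      using two_point_inequality[OF B q0[of X], of \<theta>1 \<theta>0 "T X"] B q0[of X]
      by (simp add: ennreal_mult[symmetric] ennreal_plus[symmetric] ennreal_leI mult.commute del: ennreal_plus)
  qed
  also have "\<dots> = ?I1 + ennreal ?B * ?I0 + ennreal (?g / (16 * ?B)) * (\<integral>\<^sup>+X. ennreal ((q X)\<^sup>2) \<partial>?P)"
    unfolding T1 by (simp add: nn_integral_add nn_integral_cmult del: One_nat_def)
  also have "\<dots> \<le> ?I1 + ennreal ?B * ?I0 + ennreal (?g / (16 * ?B)) * ennreal ?B"
    by (intro add_left_mono mult_left_mono q2) auto
  also have "ennreal (?g / (16 * ?B)) * ennreal ?B = ennreal (?g / 16)"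
    using B b by (simp add: ennreal_mult[symmetric])
  finally have *: "ennreal (?g / 4) \<le> ?I1 + ennreal ?B * ?I0 + ennreal (?g / 16)" .
  have "ennreal (?g / 4) = ennreal (3 / 16 * ?g) + ennreal (?g / 16)"
    by (simp add: ennreal_plus[symmetric] del: ennreal_plus)
  then show ?thesis using * by (simp add: add.commute ennreal_add_left_cancel_le)
qed

section \<open>Two densities that are hard to separate\<close>

lemma vol_1: "vol k 1 = 1 / (k + 1)"
  by (simp add: vol_def)

lemma cusp_cut_1: "cusp_cut k 1 = cusp k"
  by (auto simp: cusp_cut_def cusp_def)

lemma emeasure_cusp: "1 < k \<Longrightarrow> emeasure lborel (cusp k) = ennreal (1 / (k + 1))"
  using emeasure_cusp_cut[of k 1] by (simp add: cusp_cut_1 vol_1)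

text \<open>The uniform density on the cusp.\<close>

definition uniform_dens :: "real \<Rightarrow> real \<times> real \<Rightarrow> real" where
  "uniform_dens k = (\<lambda>_. k + 1)"

lemma uniform_dens_Sigma:
  assumes "1 < k" "0 < s" "s \<le> 1" "0 < L"
  shows "uniform_dens k \<in> Sigma_class (cusp k) s L"
proof -
  have "(\<integral>\<^sup>+x. ennreal (k + 1) * indicator (cusp k) x \<partial>lborel) = ennreal (k + 1) * ennreal (1 / (k + 1))"
    using emeasure_cusp[OF assms(1)] by (simp add: nn_integral_cmult_indicator cusp_measurable)
  also have "\<dots> = 1" using assms(1) by (simp add: ennreal_mult[symmetric] del: ennreal_plus)
  finally have "is_density (cusp k) (uniform_dens k)"
    using assms by (simp add: is_density_def uniform_dens_def)
  then show ?thesis using assms by (simp add: Sigma_class_cusp_iff uniform_dens_def)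
qed

text \<open>The likelihood ratio, against the uniform density, of a density that is raised by a constant at the
points of the cusp with abscissa at most \<open>a\<close> and lowered by a constant elsewhere. These points have
mass \<open>a powr (k + 1)\<close> under the uniform law, so the ratio has mean \<open>1\<close>. The jump is no obstacle: the
Hoelder condition compares with the value at the origin only.\<close>

definition bump_ratio :: "real \<Rightarrow> real \<Rightarrow> real \<Rightarrow> real \<times> real \<Rightarrow> real" where
  "bump_ratio k a \<beta> = (\<lambda>x. 1 + \<beta> * (indicator (cusp_cut k a) x - a powr (k + 1)))"

text \<open>Here \<open>f1\<close> exceeds the uniform density at the origin by at least \<open>L / 2 * a powr s\<close>. The factor in
front of the square risk at the uniform density bounds the second moment of the likelihood ratio of
the sample.\<close>

lemma two_point_cusp:
  fixes n :: nat
  assumes k: "1 < k" and s: "0 < s" "s \<le> 1" and L: "0 < L"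
    and a: "0 < a" "a \<le> 1" "a powr (k + 1) \<le> 1 / 2" "L * a powr s \<le> k + 1"
  shows "\<exists>f1\<in>Sigma_class (cusp k) s L. \<forall>T\<in>borel_measurable (\<Pi>\<^sub>M i\<in>{1..n}. borel).
     ennreal (3 / 64 * L\<^sup>2 * a powr (2 * s))
      \<le> ennreal (exp (real n * (L\<^sup>2 * a powr (2 * s + k + 1)))) *
          (\<integral>\<^sup>+X. ennreal ((T X - uniform_dens k (0, 0))\<^sup>2) \<partial>sample_law (cusp k) n (uniform_dens k))
        + (\<integral>\<^sup>+X. ennreal ((T X - f1 (0, 0))\<^sup>2) \<partial>sample_law (cusp k) n f1)"
proof -
  define p where "p = a powr (k + 1)"
  \<comment> \<open>The jump of the density is \<open>(k + 1) * \<beta> = L * a powr s\<close>, the largest that the class allows.\<close>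
  define \<beta> where "\<beta> = L * a powr s / (k + 1)"
  have p: "0 < p" "p \<le> 1 / 2" using a by (auto simp: p_def)
  have b: "0 < \<beta>" "\<beta> \<le> 1" using k L a by (auto simp: \<beta>_def)
  have sq: "(a powr s)\<^sup>2 = a powr (2 * s)"
    by (simp add: power2_eq_square flip: powr_add)
  let ?r = "bump_ratio k a \<beta>"
  define f1 where "f1 = (\<lambda>x. (k + 1) * ?r x)"
  let ?M = "cusp_law k (uniform_dens k)"
  have dens0: "is_density (cusp k) (uniform_dens k)"
    using uniform_dens_Sigma[OF k s L] by (simp add: Sigma_class_def)
  have prob0: "prob_space ?M" by (rule prob_space_cusp_law[OF dens0])
  interpret M: prob_space ?M by fact
  have [measurable]: "cusp_cut k a \<in> sets borel" "cusp k \<in> sets borel"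
    by (rule cusp_cut_measurable cusp_measurable)+
  have rm [measurable]: "?r \<in> borel_measurable borel" unfolding bump_ratio_def by measurable
  have r0: "0 \<le> ?r x" for x
  proof -
    have "\<beta> * p \<le> 1 * 1" using p b by (intro mult_mono) auto
    moreover have "\<beta> * indicator (cusp_cut k a) x \<ge> 0" using b by simp
    ultimately show ?thesis unfolding bump_ratio_def p_def[symmetric] right_diff_distrib by linarith
  qed
  have MA: "measure ?M (cusp_cut k a) = p"
  proof -
    have "emeasure ?M (cusp_cut k a) = (\<integral>\<^sup>+x. ennreal (k + 1) * indicator (cusp k \<inter> cusp_cut k a) x \<partial>lborel)"
      unfolding emeasure_cusp_law[OF dens0 cusp_cut_measurable] by (simp add: uniform_dens_def)
    also have "cusp k \<inter> cusp_cut k a = cusp_cut k a" by (auto simp: cusp_cut_def)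
    also have "(\<integral>\<^sup>+x. ennreal (k + 1) * indicator (cusp_cut k a) x \<partial>lborel) = ennreal (k + 1) * ennreal (vol k a)"
      using emeasure_cusp_cut[OF k a(1,2)] by (simp add: nn_integral_cmult_indicator)
    also have "\<dots> = ennreal p" using k by (simp add: ennreal_mult'[symmetric] vol_def p_def del: ennreal_plus)
    finally show ?thesis using p by (simp add: measure_def)
  qed
  have mean: "(\<integral>\<^sup>+x. ennreal (c + d * indicator (cusp_cut k a) x) \<partial>?M) = ennreal (c + d * p)"
    if "0 \<le> c" "0 \<le> c + d" for c d :: real
  proof -
    have i: "integrable ?M (\<lambda>x. d * indicator (cusp_cut k a) x)"
      by (intro integrable_mult_right) (simp add: M.emeasure_eq_measure)
    have "integral\<^sup>L ?M (\<lambda>x. c + d * indicator (cusp_cut k a) x)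
        = integral\<^sup>L ?M (\<lambda>x. c) + integral\<^sup>L ?M (\<lambda>x. d * indicator (cusp_cut k a) x)"
      by (intro Bochner_Integration.integral_add i M.integrable_const)
    also have "\<dots> = c + d * p"
      using M.prob_space by (simp add: MA)
    finally have "integral\<^sup>L ?M (\<lambda>x. c + d * indicator (cusp_cut k a) x) = c + d * p" .
    moreover have "integrable ?M (\<lambda>x. c + d * indicator (cusp_cut k a) x)"
      by (intro Bochner_Integration.integrable_add i M.integrable_const)
    ultimately show ?thesis
      using that by (subst nn_integral_eq_integral) (auto simp: indicator_def)
  qed
  have law1: "cusp_law k f1 = density ?M (\<lambda>x. ennreal (?r x))"
  proof -
    have "density ?M (\<lambda>x. ennreal (?r x)) = density lborel (\<lambda>x. ennreal (uniform_dens k x) * indicator (cusp k) x * ennreal (?r x))"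
      by (rule density_density_eq) (auto simp: uniform_dens_def)
    also have "\<dots> = cusp_law k f1"
      using k r0 by (intro arg_cong2[where f = density] refl)
        (auto simp: fun_eq_iff f1_def uniform_dens_def ennreal_mult indicator_def)
    finally show ?thesis ..
  qed
  have r_one: "(\<integral>\<^sup>+x. ennreal (?r x) \<partial>?M) = 1"
    using mean[of "1 - \<beta> * p" \<beta>] p b mult_mono[of \<beta> 1 p 1]
    unfolding bump_ratio_def p_def[symmetric] by (simp add: algebra_simps)
  have em1: "emeasure (cusp_law k f1) UNIV = 1"
    unfolding law1 using r_one by (simp add: emeasure_density)
  have dens1: "is_density (cusp k) f1"
    unfolding is_density_def
  proof (intro conjI ballI)
    show "f1 \<in> borel_measurable (restrict_space borel (cusp k))"
      unfolding f1_def by (intro measurable_restrict_space1) measurable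
    show "0 \<le> f1 x" for x using k r0[of x] by (simp add: f1_def)
    have [measurable]: "f1 \<in> borel_measurable borel" unfolding f1_def by measurable
    show "(\<integral>\<^sup>+x\<in>cusp k. ennreal (f1 x) \<partial>lborel) = 1"
      using em1 by (simp add: emeasure_density)
  qed
  have Sig: "f1 \<in> Sigma_class (cusp k) s L"
    unfolding Sigma_class_cusp_iff[OF k s]
  proof (intro conjI dens1 ballI)
    fix u assume u: "u \<in> cusp k"
    have z: "(0, 0) \<in> cusp_cut k a" using a by (simp add: cusp_cut_def cusp_def)
    show "\<bar>f1 u - f1 (0, 0)\<bar> \<le> L * fst u powr s"
    proof (cases "u \<in> cusp_cut k a")
      case True
      then show ?thesis using z L by (simp add: f1_def bump_ratio_def)
    next
      case False
      have "f1 u - f1 (0, 0) = - ((k + 1) * \<beta>)"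
        using False z by (simp add: f1_def bump_ratio_def algebra_simps)
      then have "\<bar>f1 u - f1 (0, 0)\<bar> = (k + 1) * \<beta>"
        using k b by simp
      also have "\<dots> = L * a powr s" using k by (simp add: \<beta>_def)
      also have "\<dots> \<le> L * fst u powr s"
        using False u a L s by (intro mult_left_mono powr_mono2) (auto simp: cusp_cut_def)
      finally show ?thesis .
    qed
  qed
  have chi: "(\<integral>\<^sup>+x. ennreal ((?r x)\<^sup>2) \<partial>?M) \<le> ennreal (1 + \<beta>\<^sup>2 * p)"
  proof -
    let ?c = "(1 - \<beta> * p)\<^sup>2" and ?d = "(1 - \<beta> * p + \<beta>)\<^sup>2 - (1 - \<beta> * p)\<^sup>2"
    have "(\<integral>\<^sup>+x. ennreal ((?r x)\<^sup>2) \<partial>?M) = (\<integral>\<^sup>+x. ennreal (?c + ?d * indicator (cusp_cut k a) x) \<partial>?M)"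
      unfolding bump_ratio_def p_def[symmetric]
      by (intro nn_integral_cong) (auto simp: indicator_def algebra_simps)
    also have "\<dots> = ennreal (?c + ?d * p)" by (rule mean) auto
    also have "?c + ?d * p = 1 + \<beta>\<^sup>2 * p * (1 - p)"
      by (simp add: power2_eq_square algebra_simps)
    also have "\<dots> \<le> 1 + \<beta>\<^sup>2 * p"
      using p b by (simp add: mult_left_le)
    finally show ?thesis by (simp add: ennreal_leI)
  qed
  have gap: "L / 2 * a powr s \<le> f1 (0, 0) - uniform_dens k (0, 0)"
  proof -
    have "(0, 0) \<in> cusp_cut k a" using a by (simp add: cusp_cut_def cusp_def)
    then have "f1 (0, 0) - uniform_dens k (0, 0) = (k + 1) * \<beta> * (1 - p)"
      by (simp add: f1_def bump_ratio_def p_def uniform_dens_def algebra_simps)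
    also have "\<dots> = L * a powr s * (1 - p)" using k by (simp add: \<beta>_def)
    also have "\<dots> \<ge> L * a powr s * (1 / 2)" using p L by (intro mult_left_mono) auto
    finally show ?thesis by simp
  qed
  have pow: "(1 + \<beta>\<^sup>2 * p) ^ n \<le> exp (real n * (L\<^sup>2 * a powr (2 * s + k + 1)))"
  proof -
    have "(1 + \<beta>\<^sup>2 * p) ^ n \<le> exp (\<beta>\<^sup>2 * p) ^ n"
      using p by (intro power_mono exp_ge_add_one_self) (auto simp: add_nonneg_nonneg)
    also have "\<dots> = exp (real n * (\<beta>\<^sup>2 * p))" by (simp add: exp_of_nat_mult)
    also have "\<beta>\<^sup>2 * p \<le> L\<^sup>2 * (a powr s)\<^sup>2 * p"
    proof -
      have "\<beta> \<le> L * a powr s" using divide_left_mono[of 1 "k + 1" "L * a powr s"] k L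
        by (simp add: \<beta>_def)
      then have "\<beta>\<^sup>2 \<le> (L * a powr s)\<^sup>2" using b by (intro power_mono) auto
      then show ?thesis using p by (simp add: power_mult_distrib mult_right_mono)
    qed
    also have "L\<^sup>2 * (a powr s)\<^sup>2 * p = L\<^sup>2 * a powr (2 * s + k + 1)"
      unfolding sq p_def by (simp add: add.assoc flip: powr_add)
    finally show ?thesis by (simp add: mult_left_mono)
  qed
  show ?thesis
  proof (intro bexI[OF _ Sig] ballI)
    fix T :: "(nat \<Rightarrow> real \<times> real) \<Rightarrow> real"
    assume "T \<in> borel_measurable (\<Pi>\<^sub>M i\<in>{1..n}. borel)"
    then have T: "T \<in> borel_measurable (\<Pi>\<^sub>M i\<in>{1..n}. ?M)"
      by (simp cong: measurable_cong_sets sets_PiM_cong)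
    have "(L / 2 * a powr s)\<^sup>2 \<le> (f1 (0, 0) - uniform_dens k (0, 0))\<^sup>2"
      using gap L by (intro power_mono) auto
    moreover have "(L / 2 * a powr s)\<^sup>2 = L\<^sup>2 * a powr (2 * s) / 4"
      by (simp add: power_mult_distrib power_divide sq)
    ultimately have "ennreal (3 / 64 * L\<^sup>2 * a powr (2 * s)) \<le> ennreal (3 / 16 * (f1 (0, 0) - uniform_dens k (0, 0))\<^sup>2)"
      by (intro ennreal_leI) simp
    also have "\<dots> \<le> ennreal ((1 + \<beta>\<^sup>2 * p) ^ n) * (\<integral>\<^sup>+X. ennreal ((T X - uniform_dens k (0, 0))\<^sup>2) \<partial>PiM {1..n} (\<lambda>_. ?M))
        + (\<integral>\<^sup>+X. ennreal ((T X - f1 (0, 0))\<^sup>2) \<partial>PiM {1..n} (\<lambda>_. density ?M (\<lambda>x. ennreal (?r x))))"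
    proof (rule two_point_lower_bound[OF prob0 _ r0 _ chi _ T])
      show "prob_space (density ?M (\<lambda>x. ennreal (?r x)))"
        using prob_space_cusp_law[OF dens1] by (simp only: law1)
    qed (use p rm in auto)
    also have "\<dots> \<le> ennreal (exp (real n * (L\<^sup>2 * a powr (2 * s + k + 1)))) *
          (\<integral>\<^sup>+X. ennreal ((T X - uniform_dens k (0, 0))\<^sup>2) \<partial>PiM {1..n} (\<lambda>_. ?M))
        + (\<integral>\<^sup>+X. ennreal ((T X - f1 (0, 0))\<^sup>2) \<partial>PiM {1..n} (\<lambda>_. density ?M (\<lambda>x. ennreal (?r x))))"
      by (intro add_right_mono mult_right_mono ennreal_leI pow) auto
    finally show "ennreal (3 / 64 * L\<^sup>2 * a powr (2 * s))
      \<le> ennreal (exp (real n * (L\<^sup>2 * a powr (2 * s + k + 1)))) *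
          (\<integral>\<^sup>+X. ennreal ((T X - uniform_dens k (0, 0))\<^sup>2) \<partial>sample_law (cusp k) n (uniform_dens k))
        + (\<integral>\<^sup>+X. ennreal ((T X - f1 (0, 0))\<^sup>2) \<partial>sample_law (cusp k) n f1)"
      unfolding sample_law_eq law1 .
  qed
qed

section \<open>Optimality of the rate\<close>

text \<open>The rate at smoothness \<open>s\<close>; it does not depend on the radius \<open>L\<close>.\<close>

definition rate :: "real \<Rightarrow> real \<Rightarrow> nat \<Rightarrow> real" where
  "rate k s n = (ln (real n) / real n) powr (s / (2 * s + k + 1))"

lemma ennreal_divide_less_imp_le:
  assumes "u / ennreal v < ennreal C" "0 \<le> v"
  shows "u \<le> ennreal (C * v)"
proof -
  have u: "u \<noteq> \<infinity>" using assms by (auto simp: ennreal_top_divide infinity_ennreal_def)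
  then obtain r where r: "u = ennreal r" "0 \<le> r" by (cases u) auto
  have C: "0 < C" using assms(1) by (cases "0 < C") (auto simp: ennreal_neg)
  show ?thesis
  proof (cases "v = 0")
    case True
    then have "r = 0" using assms r by (cases "r = 0") (auto simp: ennreal_divide_zero)
    then show ?thesis using r True by simp
  next
    case False
    then have "ennreal (r / v) < ennreal C" using assms r by (simp add: divide_ennreal)
    then have "r / v < C" using r assms by (simp add: ennreal_less_iff)
    then have "r \<le> C * v" using False assms(2) by (simp add: field_simps)
    then show ?thesis using r by (simp add: ennreal_leI)
  qed
qed

lemma lesssimD:
  assumes "lesssim u (\<lambda>n. ennreal (v n))" "\<And>n. 0 \<le> v n"
  shows "\<exists>C>0. \<forall>\<^sub>F n in sequentially. u n \<le> ennreal (C * v n)"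
proof -
  obtain r where r: "limsup (\<lambda>n. u n / ennreal (v n)) = ennreal r" "0 \<le> r"
    using assms(1) unfolding lesssim_def by (cases "limsup (\<lambda>n. u n / ennreal (v n))") auto
  have "limsup (\<lambda>n. u n / ennreal (v n)) < ennreal (r + 1)" unfolding r(1) using r(2) by (simp add: ennreal_less_iff del: ennreal_plus)
  then have "\<forall>\<^sub>F n in sequentially. u n / ennreal (v n) < ennreal (r + 1)" by (rule Limsup_lessD)
  then have "\<forall>\<^sub>F n in sequentially. u n \<le> ennreal ((r + 1) * v n)"
    by eventually_elim (rule ennreal_divide_less_imp_le[OF _ assms(2)])
  then show ?thesis using r(2) by (intro exI[of _ "r + 1"]) auto
qed

lemma ll_setD:
  assumes "\<theta> \<in> ll_set K \<psi> \<phi>" "\<And>n. 0 \<le> \<psi> \<theta> n" "\<And>n. 0 \<le> \<phi> \<theta> n" "0 < \<eta>"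
  shows "\<forall>\<^sub>F n in sequentially. \<psi> \<theta> n \<le> \<eta> * \<phi> \<theta> n"
proof -
  have "(rratio \<psi> \<phi> \<theta>) \<longlonglongrightarrow> 0" using assms(1) by (simp add: ll_set_def)
  then have "\<forall>\<^sub>F n in sequentially. rratio \<psi> \<phi> \<theta> n < ennreal \<eta>"
    using assms(4) by (intro order_tendstoD(2)) auto
  then show ?thesis
  proof eventually_elim
    case (elim n)
    then have "ennreal (\<psi> \<theta> n) \<le> ennreal (\<eta> * \<phi> \<theta> n)"
      unfolding rratio_def by (rule ennreal_divide_less_imp_le) (rule assms)
    then show ?case using assms(3)[of n] assms(4) by (simp add: ennreal_le_iff)
  qed
qed

text \<open>The parameter set, and the rate as a collection indexed by it.\<close>

abbreviation (input) Kset :: "(real \<times> real) set" where "Kset \<equiv> {0<..1} \<times> {0<..}"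
abbreviation (input) ARC_rate :: "real \<Rightarrow> real \<times> real \<Rightarrow> nat \<Rightarrow> real" where
  "ARC_rate k \<equiv> \<lambda>(s, L) n. (ln (real n) / real n) powr (s / (2 * s + k + 1))"

text \<open>An estimator that beats the rate at \<open>(s0, L0)\<close> pays at the uniform density, which belongs to all
classes: no \<open>\<psi> (s, L)\<close> is below the rate at \<open>s0\<close> by more than an arbitrarily small power of \<open>n\<close>. The
case \<open>(s, L) = (s0, L0)\<close> is included; it limits the gain.\<close>

lemma fast_rate_penalty:
  assumes k: "1 < k" and adm: "admissible (cusp k) Kset \<psi>"
    and ll: "(s0, L0) \<in> ll_set Kset \<psi> (ARC_rate k)" and th: "(s, L) \<in> Kset" and e: "0 < \<epsilon>"
  shows "\<exists>c>0. \<forall>\<^sub>F n in sequentially. c * rate k s0 n \<le> real n powr \<epsilon> * \<psi> (s, L) n"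
proof -
  have th0: "(s0, L0) \<in> Kset" using ll by (simp add: ll_set_def)
  have s0: "0 < s0" "s0 \<le> 1" "0 < L0" and s: "0 < s" "s \<le> 1" "0 < L" using th th0 by auto
  have pos: "0 \<le> \<psi> (s', L') n" if "(s', L') \<in> Kset" for s' L' n
    using adm that unfolding admissible_def is_collection_def by blast
  obtain T where T: "is_estimator T"
    and adm: "\<And>s' L'. (s', L') \<in> Kset \<Longrightarrow> lesssim (\<lambda>n. SUP f\<in>Sigma_class (cusp k) s' L'. risk (cusp k) n (T n) f) (\<lambda>n. ennreal (\<psi> (s', L') n))"
    using adm unfolding admissible_def by blast
  obtain C0 where C0: "0 < C0" "\<forall>\<^sub>F n in sequentially. (SUP f\<in>Sigma_class (cusp k) s0 L0. risk (cusp k) n (T n) f) \<le> ennreal (C0 * \<psi> (s0, L0) n)"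
    using lesssimD[OF adm[OF th0] pos[OF th0]] by blast
  obtain C where C: "0 < C" "\<forall>\<^sub>F n in sequentially. (SUP f\<in>Sigma_class (cusp k) s L. risk (cusp k) n (T n) f) \<le> ennreal (C * \<psi> (s, L) n)"
    using lesssimD[OF adm[OF th] pos[OF th]] by blast
  define E where "E = 2 * s0 + k + 1"
  have E: "0 < E" using s0 k by (simp add: E_def)
  \<comment> \<open>This makes the inflation factor of \<open>two_point_cusp\<close> equal to \<open>(n powr \<epsilon>)\<^sup>2\<close>.\<close>
  define \<kappa> where "\<kappa> = 2 * \<epsilon> / L0\<^sup>2"
  have \<kappa>: "0 < \<kappa>" using e s0 by (simp add: \<kappa>_def)
  define a where "a = (\<lambda>n. (\<kappa> * (ln (real n) / real n)) powr (1 / E))"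
  define c2 where "c2 = 3 / 64 * L0\<^sup>2 * \<kappa> powr (2 * s0 / E)"
  have c2: "0 < c2" using s0 \<kappa> by (simp add: c2_def)
  \<comment> \<open>Small enough for the risk at the raised density to use up at most half of the left-hand side.\<close>
  define \<eta> where "\<eta> = sqrt (c2 / 2) / C0"
  have \<eta>: "0 < \<eta>" using c2 C0 by (simp add: \<eta>_def)
  have a0: "0 \<le> a n" for n by (simp add: a_def)
  have base: "0 \<le> \<kappa> * (ln (real n) / real n)" for n
    using \<kappa> by (cases "n = 0") auto
  have lim0: "(\<lambda>n. \<kappa> * (ln (real n) / real n)) \<longlonglongrightarrow> 0" by real_asymp
  have lim_a: "a \<longlonglongrightarrow> 0"
    unfolding a_def by (rule tendsto_zero_powrI[OF lim0 tendsto_const]) (use E base in auto)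
  have l1: "(\<lambda>n. a n powr (k + 1)) \<longlonglongrightarrow> 0"
    by (rule tendsto_zero_powrI[OF lim_a tendsto_const]) (use k a0 in auto)
  have l2: "(\<lambda>n. L0 * a n powr s0) \<longlonglongrightarrow> L0 * 0"
    by (intro tendsto_mult tendsto_const tendsto_zero_powrI[OF lim_a]) (use s0 a0 in auto)
  have "\<forall>\<^sub>F n in sequentially. a n < 1" by (rule order_tendstoD(2)[OF lim_a]) simp
  moreover have "\<forall>\<^sub>F n in sequentially. a n powr (k + 1) < 1 / 2" by (rule order_tendstoD(2)[OF l1]) simp
  moreover have "\<forall>\<^sub>F n in sequentially. L0 * a n powr s0 < k + 1" by (rule order_tendstoD(2)[OF l2]) (use k in simp)
  moreover have "\<forall>\<^sub>F n in sequentially. \<psi> (s0, L0) n \<le> \<eta> * rate k s0 n"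
    using ll_setD[OF ll pos[OF th0] _ \<eta>] by (simp add: rate_def)
  moreover have "\<forall>\<^sub>F n::nat in sequentially. 2 \<le> n" by (rule eventually_ge_at_top)
  ultimately have "\<forall>\<^sub>F n in sequentially. sqrt (c2 / 2) / C * rate k s0 n \<le> real n powr \<epsilon> * \<psi> (s, L) n"
    using C0(2) C(2)
  proof eventually_elim
    case (elim n)
    have n: "0 < ln (real n)" "0 < real n" using elim(5) by auto
    have an: "0 < a n" using n \<kappa> by (simp add: a_def)
    have rp: "0 < rate k s0 n" using n by (simp add: rate_def)
    let ?I0 = "\<integral>\<^sup>+X. ennreal ((T n X - uniform_dens k (0, 0))\<^sup>2) \<partial>sample_law (cusp k) n (uniform_dens k)"
    from two_point_cusp[OF k s0(1,2,3) an, of n] elim(1-3)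
    obtain f1 where f1: "f1 \<in> Sigma_class (cusp k) s0 L0"
      and ineq: "\<And>T. T\<in>borel_measurable (\<Pi>\<^sub>M i\<in>{1..n}. borel) \<Longrightarrow> ennreal (3 / 64 * L0\<^sup>2 * a n powr (2 * s0))
      \<le> ennreal (exp (real n * (L0\<^sup>2 * a n powr (2 * s0 + k + 1)))) *
          (\<integral>\<^sup>+X. ennreal ((T X - uniform_dens k (0, 0))\<^sup>2) \<partial>sample_law (cusp k) n (uniform_dens k))
        + (\<integral>\<^sup>+X. ennreal ((T X - f1 (0, 0))\<^sup>2) \<partial>sample_law (cusp k) n f1)" by (auto simp: less_imp_le)
    have ineq: "ennreal (3 / 64 * L0\<^sup>2 * a n powr (2 * s0))
      \<le> ennreal (exp (real n * (L0\<^sup>2 * a n powr (2 * s0 + k + 1)))) * ?I0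
        + (\<integral>\<^sup>+X. ennreal ((T n X - f1 (0, 0))\<^sup>2) \<partial>sample_law (cusp k) n f1)"
      by (rule ineq) (use T in \<open>simp add: is_estimator_def\<close>)
    have "a n powr (2 * s0 + k + 1) = \<kappa> * (ln (real n) / real n)"
      using n \<kappa> E by (simp add: a_def powr_powr E_def[symmetric])
    then have "real n * (L0\<^sup>2 * a n powr (2 * s0 + k + 1)) = 2 * \<epsilon> * ln (real n)"
      using n s0 by (simp add: \<kappa>_def)
    then have ex: "exp (real n * (L0\<^sup>2 * a n powr (2 * s0 + k + 1))) = (real n powr \<epsilon>)\<^sup>2"
      using n by (simp add: powr_def exp_of_nat_mult[symmetric] power2_eq_square mult_exp_exp)
    have "a n powr (2 * s0) = (\<kappa> * (ln (real n) / real n)) powr (2 * s0 / E)"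
      by (simp add: a_def powr_powr)
    also have "\<dots> = \<kappa> powr (2 * s0 / E) * (ln (real n) / real n) powr (2 * s0 / E)"
      by (rule powr_mult)
    also have "(ln (real n) / real n) powr (2 * s0 / E) = (rate k s0 n)\<^sup>2"
      by (simp add: rate_def E_def[symmetric] power2_eq_square powr_add[symmetric])
    finally have lhs: "3 / 64 * L0\<^sup>2 * a n powr (2 * s0) = c2 * (rate k s0 n)\<^sup>2" by (simp add: c2_def)
    have u: "uniform_dens k \<in> Sigma_class (cusp k) s L" by (rule uniform_dens_Sigma) fact+
    have "risk (cusp k) n (T n) (uniform_dens k) \<le> ennreal (C * \<psi> (s, L) n)"
      by (rule order_trans[OF SUP_upper[OF u] elim(7)])
    then have I0: "?I0 \<le> ennreal ((C * \<psi> (s, L) n)\<^sup>2)"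
      using C(1) pos[OF th] by (subst (asm) risk_le_iff) auto
    have "risk (cusp k) n (T n) f1 \<le> ennreal (C0 * \<psi> (s0, L0) n)"
      by (rule order_trans[OF SUP_upper[OF f1] elim(6)])
    then have I1: "(\<integral>\<^sup>+X. ennreal ((T n X - f1 (0, 0))\<^sup>2) \<partial>sample_law (cusp k) n f1) \<le> ennreal ((C0 * \<psi> (s0, L0) n)\<^sup>2)"
      using C0(1) pos[OF th0] by (subst (asm) risk_le_iff) auto
    have "ennreal (c2 * (rate k s0 n)\<^sup>2) \<le> ennreal ((real n powr \<epsilon>)\<^sup>2) * ennreal ((C * \<psi> (s, L) n)\<^sup>2) + ennreal ((C0 * \<psi> (s0, L0) n)\<^sup>2)"
      using ineq unfolding lhs ex by (rule order_trans) (intro add_mono mult_left_mono I0 I1, simp)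
    also have "\<dots> = ennreal ((real n powr \<epsilon>)\<^sup>2 * (C * \<psi> (s, L) n)\<^sup>2 + (C0 * \<psi> (s0, L0) n)\<^sup>2)"
      by (simp add: ennreal_mult[symmetric] ennreal_plus[symmetric] del: ennreal_plus)
    finally have main: "c2 * (rate k s0 n)\<^sup>2 \<le> (real n powr \<epsilon>)\<^sup>2 * (C * \<psi> (s, L) n)\<^sup>2 + (C0 * \<psi> (s0, L0) n)\<^sup>2"
      by (subst (asm) ennreal_le_iff) auto
    have "C0 * \<psi> (s0, L0) n \<le> C0 * (\<eta> * rate k s0 n)" using elim(4) C0(1) by (intro mult_left_mono) auto
    also have "\<dots> = sqrt (c2 / 2) * rate k s0 n" using C0(1) by (simp add: \<eta>_def)
    finally have "(C0 * \<psi> (s0, L0) n)\<^sup>2 \<le> (sqrt (c2 / 2) * rate k s0 n)\<^sup>2"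
      using C0(1) pos[OF th0] by (intro power_mono) auto
    also have "\<dots> = c2 / 2 * (rate k s0 n)\<^sup>2" using c2 by (simp add: power_mult_distrib)
    finally have "c2 / 2 * (rate k s0 n)\<^sup>2 \<le> (real n powr \<epsilon>)\<^sup>2 * (C * \<psi> (s, L) n)\<^sup>2" using main by simp
    then have "(sqrt (c2 / 2) * rate k s0 n)\<^sup>2 \<le> (real n powr \<epsilon> * (C * \<psi> (s, L) n))\<^sup>2"
      using c2 by (simp add: power_mult_distrib)
    then have "sqrt (c2 / 2) * rate k s0 n \<le> real n powr \<epsilon> * (C * \<psi> (s, L) n)"
      by (rule power2_le_imp_le) (use C(1) pos[OF th] in auto)
    then show ?case using C(1) by (simp add: field_simps)
  qed
  then show ?thesis using c2 C(1) by (intro exI[of _ "sqrt (c2 / 2) / C"]) auto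
qed

lemma rate_exponent_strict_mono:
  fixes k s s0 :: real
  assumes "1 < k" "0 < s0" "s0 < s"
  shows "s0 / (2 * s0 + k + 1) < s / (2 * s + k + 1)"
  proof -
  have "k * s0 < k * s" using assms by simp
  then have "s0 * (2 * s + k + 1) < s * (2 * s0 + k + 1)" using assms(3) by (simp add: algebra_simps)
  then show ?thesis using assms by (simp add: divide_less_eq less_divide_eq)
qed

lemma rratio_product_tendsto_top:
  assumes k: "1 < k" and adm: "admissible (cusp k) Kset \<psi>"
    and ll: "(s0, L0) \<in> ll_set Kset \<psi> (ARC_rate k)" and th: "(s, L) \<in> Kset" and ss: "s0 < s"
  shows "(\<lambda>n. rratio \<psi> (ARC_rate k) (s, L) n * rratio \<psi> (ARC_rate k) (s0, L0) n) \<longlonglongrightarrow> \<infinity>"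
proof -
  have th0: "(s0, L0) \<in> Kset" using ll by (simp add: ll_set_def)
  define d where "d = s / (2 * s + k + 1) - s0 / (2 * s0 + k + 1)"
  have d: "0 < d" using rate_exponent_strict_mono[OF k _ ss] th0 by (simp add: d_def)
  have pos: "0 \<le> \<psi> (s', L') n" if "(s', L') \<in> Kset" for s' L' n
    using adm that unfolding admissible_def is_collection_def by blast
  \<comment> \<open>Two losses of \<open>n powr (d / 4)\<close> still leave \<open>n powr (d / 2)\<close>, up to logarithms, of the
    gap \<open>(n / ln n) powr d\<close> between the rates.\<close>
  have d4: "0 < d / 4" using d by simp
  obtain c where c: "0 < c" "\<forall>\<^sub>F n in sequentially. c * rate k s0 n \<le> real n powr (d / 4) * \<psi> (s, L) n"
    using fast_rate_penalty[OF k adm ll th d4] by blast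
  obtain c0 where c0: "0 < c0" "\<forall>\<^sub>F n in sequentially. c0 * rate k s0 n \<le> real n powr (d / 4) * \<psi> (s0, L0) n"
    using fast_rate_penalty[OF k adm ll th0 d4] by blast
  define g where "g = (\<lambda>n::nat. c * c0 * real n powr (- (d / 2)) * (ln (real n) / real n) powr (- d))"
  have cc: "0 < c * c0" using c c0 by simp
  have "filterlim g at_top sequentially"
    unfolding g_def using d cc by real_asymp
  then have lim: "(\<lambda>n. ennreal (g n)) \<longlonglongrightarrow> \<infinity>" by (simp add: ennreal_tendsto_top_eq_at_top)
  have lower: "\<forall>\<^sub>F n in sequentially. ennreal (g n) \<le> rratio \<psi> (ARC_rate k) (s, L) n * rratio \<psi> (ARC_rate k) (s0, L0) n"
    using c(2) c0(2) eventually_ge_at_top[of 2]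
  proof eventually_elim
    case (elim n)
    have n: "0 < ln (real n)" "0 < real n" using elim(3) by auto
    have rp: "0 < rate k s' n" for s' using n by (simp add: rate_def)
    have n2: "real n powr (d / 2) = real n powr (d / 4) * real n powr (d / 4)" by (simp add: powr_add[symmetric])
    have "c * c0 * real n powr (- (d / 2)) * (rate k s0 n / rate k s n)
        = (c * rate k s0 n / real n powr (d / 4)) / rate k s n * ((c0 * rate k s0 n / real n powr (d / 4)) / rate k s0 n)"
      using n rp[of s0] by (simp add: powr_minus n2 divide_simps)
    also have "\<dots> \<le> \<psi> (s, L) n / rate k s n * (\<psi> (s0, L0) n / rate k s0 n)"
      using elim(1,2) rp c(1) c0(1) n pos[OF th, of n] pos[OF th0, of n]
      by (intro mult_mono divide_right_mono) (auto simp: divide_le_eq mult.commute less_imp_le)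
    also have "rate k s0 n / rate k s n = (ln (real n) / real n) powr (- d)"
      by (simp add: rate_def d_def powr_diff[symmetric])
    finally have "ennreal (g n) \<le> ennreal (\<psi> (s, L) n / rate k s n * (\<psi> (s0, L0) n / rate k s0 n))"
      unfolding g_def by (rule ennreal_leI)
    also have "\<dots> = rratio \<psi> (ARC_rate k) (s, L) n * rratio \<psi> (ARC_rate k) (s0, L0) n"
      using rp[of s] rp[of s0] pos[OF th, of n] pos[OF th0, of n]
      by (simp only: rratio_def rate_def[symmetric] divide_ennreal ennreal_mult[symmetric] zero_le_divide_iff case_prod_conv less_imp_le simp_thms)
    finally show ?case .
  qed
  show ?thesis
    by (rule tendsto_sandwich[OF lower _ lim tendsto_const]) (simp add: infinity_ennreal_def)
qed

lemma submanifold_vertical_line: "submanifold 1 {z :: real \<times> real. fst z = c}"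
  unfolding submanifold_def
proof
  fix x :: "real \<times> real" assume "x \<in> {z. fst z = c}"
  let ?g = "\<lambda>z::real \<times> real. z - (c, 0)" and ?g' = "\<lambda>z::real \<times> real. z + (c, 0)"
  let ?S = "{z :: real \<times> real. (1, 0) \<bullet> z = 0}"
  have "C1_on UNIV ?g" "C1_on UNIV ?g'"
    unfolding C1_on_def by (rule exI[of _ "\<lambda>_. id_blinfun"], auto intro!: derivative_eq_intros)+
  moreover have "homeomorphism UNIV UNIV ?g ?g'"
    unfolding homeomorphism_def by (auto intro!: continuous_intros surj_plus_right simp: image_iff intro: exI[of _ "_ + (c, 0)"])
  moreover have "subspace ?S" by (rule subspace_hyperplane)
  moreover have "dim ?S = 1" by (subst dim_hyperplane) (auto simp: zero_prod_def)
  moreover have "?g ` ({z. fst z = c} \<inter> UNIV) = ?S \<inter> UNIV"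
  proof safe
    fix a b :: real assume "(1, 0) \<bullet> (a, b) = 0"
    then have "(a, b) = ?g (c, b)" by simp
    then show "(a, b) \<in> ?g ` ({z. fst z = c} \<inter> UNIV)" by (rule image_eqI) simp
  qed auto
  ultimately show "\<exists>W W' g g' S. open W \<and> x \<in> W \<and> open W' \<and> homeomorphism W W' g g' \<and> C1_on W g \<and> C1_on W' g' \<and>
     subspace S \<and> dim S = 1 \<and> g ` ({z. fst z = c} \<inter> W) = S \<inter> W'"
    by (intro exI[of _ UNIV] exI[of _ ?g] exI[of _ ?g'] exI[of _ ?S] exI conjI) auto
qed

lemma aff_dim_Kset: "aff_dim Kset = 2"
proof -
  have "(1/2, 1) \<in> interior Kset"
    by (rule interiorI[of "{0<..<1} \<times> {0<..}"]) (auto intro!: open_Times)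
  then have "aff_dim Kset = int (DIM(real \<times> real))" by (intro aff_dim_nonempty_interior) auto
  then show ?thesis by simp
qed

lemma frontier_Kset: "0 < L \<Longrightarrow> (1, L) \<in> frontier Kset"
proof -
  assume L: "0 < L"
  have "(1, L) \<notin> interior Kset"
  proof
    assume "(1, L) \<in> interior Kset"
    then have "(1::real) \<in> interior {0<..1}" by (simp add: interior_Times)
    then obtain T where T: "open T" "(1::real) \<in> T" "T \<subseteq> {0<..1}" by (auto simp: interior_def)
    then obtain e where "0 < e" "ball 1 e \<subseteq> T" by (auto simp: open_contains_ball)
    moreover have "1 + e / 2 \<in> ball 1 e" using \<open>0 < e\<close> by (simp add: dist_real_def)
    ultimately show False using T(3) by force
  qed
  then show ?thesis using L closure_subset[of Kset] by (auto simp: frontier_def)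
qed

text \<open>Any two points of gain have the same \<open>s\<close>, since otherwise the product of the two ratios would tend
both to \<open>0\<close> and to \<open>\<infinity>\<close>.\<close>

lemma ARC_optimality:
  assumes k: "1 < k" and adm: "admissible (cusp k) Kset \<psi>"
  defines "ll \<equiv> ll_set Kset \<psi> (ARC_rate k)" and "ggg \<equiv> ggg_set Kset \<psi> (ARC_rate k)"
  shows "\<exists>M. submanifold (nat (aff_dim Kset) - 1) M \<and> ll \<subseteq> M"
    and "\<exists>U. openin (top_of_set Kset) U \<and> U \<subseteq> ggg \<and> (U = {} \<longrightarrow> ll \<noteq> {} \<and> ll \<subseteq> frontier Kset)"
proof -
  have dim: "nat (aff_dim Kset) - 1 = 1" unfolding aff_dim_Kset by simp
  have incomp: False if "(s0, L0) \<in> ll" "(s, L) \<in> ll" "s0 < s" for s0 L0 s L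
  proof -
    have th: "(s, L) \<in> Kset" using that(2) by (simp add: ll_def ll_set_def)
    have "(\<lambda>n. rratio \<psi> (ARC_rate k) (s, L) n * rratio \<psi> (ARC_rate k) (s0, L0) n) \<longlonglongrightarrow> 0 * 0"
      using that(1,2) by (intro tendsto_mult_ennreal) (auto simp: ll_def ll_set_def)
    moreover have "(\<lambda>n. rratio \<psi> (ARC_rate k) (s, L) n * rratio \<psi> (ARC_rate k) (s0, L0) n) \<longlonglongrightarrow> \<infinity>"
      using rratio_product_tendsto_top[OF k adm _ th that(3)] that(1) by (simp add: ll_def)
    ultimately have "0 * 0 = (\<infinity> :: ennreal)" by (rule LIMSEQ_unique)
    then show False by simp
  qed
  show "\<exists>M. submanifold (nat (aff_dim Kset) - 1) M \<and> ll \<subseteq> M"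
  proof (cases "ll = {}")
    case True
    then show ?thesis unfolding dim using submanifold_vertical_line by blast
  next
    case False
    then obtain s0 L0 where t0: "(s0, L0) \<in> ll" by fastforce
    have "ll \<subseteq> {z. fst z = s0}"
    proof safe
      fix s L assume "(s, L) \<in> ll"
      then show "fst (s, L) = s0" using incomp[OF t0, of s L] incomp[of s L s0 L0] t0 by force
    qed
    then show ?thesis unfolding dim using submanifold_vertical_line by blast
  qed
  show "\<exists>U. openin (top_of_set Kset) U \<and> U \<subseteq> ggg \<and> (U = {} \<longrightarrow> ll \<noteq> {} \<and> ll \<subseteq> frontier Kset)"
  proof (cases "ll = {}")
    case True
    have "Kset \<subseteq> ggg" using True by (auto simp: ggg_def ggg_set_def ll_def)
    moreover have "(1, 1) \<in> Kset" by simp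
    ultimately show ?thesis by (intro exI[of _ Kset]) auto
  next
    case False
    then obtain s0 L0 where t0: "(s0, L0) \<in> ll" by fastforce
    then have s0: "0 < s0" "s0 \<le> 1" by (auto simp: ll_def ll_set_def)
    have eq: "s = s0" if "(s, L) \<in> ll" for s L
      using incomp[OF t0 that] incomp[OF that t0] by force
    define U where "U = Kset \<inter> ({s0<..} \<times> UNIV)"
    have "openin (top_of_set Kset) U"
      unfolding U_def by (rule openin_open_Int) (auto intro!: open_Times)
    moreover have "U \<subseteq> ggg"
    proof
      fix \<theta> assume "\<theta> \<in> U"
      then obtain s L where \<theta>: "\<theta> = (s, L)" "(s, L) \<in> Kset" "s0 < s" by (auto simp: U_def)
      have "limsup (\<lambda>n. rratio \<psi> (ARC_rate k) \<theta> n * rratio \<psi> (ARC_rate k) \<theta>' n) = \<infinity>" if "\<theta>' \<in> ll" for \<theta>'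
      proof -
        obtain s' L' where \<theta>': "\<theta>' = (s', L')" by (cases \<theta>')
        have s': "s' = s0" using that unfolding \<theta>' by (rule eq)
        show ?thesis unfolding \<theta>(1) \<theta>' s'
          using rratio_product_tendsto_top[OF k adm _ \<theta>(2,3), of L'] that
          unfolding \<theta>' s' ll_def by (intro lim_imp_Limsup) simp_all
      qed
      then show "\<theta> \<in> ggg" using \<theta> by (auto simp: ggg_def ggg_set_def ll_def)
    qed
    moreover have "ll \<subseteq> frontier Kset" if "U = {}"
    proof -
      have "(1, 1) \<notin> U" using that by simp
      then have "s0 = 1" using s0 by (auto simp: U_def)
      show ?thesis
      proof safe
        fix s L assume sL: "(s, L) \<in> ll"
        then have "0 < L" by (simp add: ll_def ll_set_def)
        then show "(s, L) \<in> frontier Kset" using frontier_Kset eq[OF sL] \<open>s0 = 1\<close> by simp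
      qed
    qed
    ultimately show ?thesis using False by blast
  qed
qed

section \<open>The estimators along the grid of bandwidths\<close>

lemma bw_pos: "0 < bw l" by (simp add: bw_def)
lemma bw_le_1: "bw l \<le> 1" by (simp add: bw_def)

lemma vol_bw: "vol k (bw l) = exp (- ((k + 1) * real l)) / (k + 1)"
  by (simp add: vol_def bw_def powr_def)

lemma fhat_cusp:
  assumes "1 < k"
  shows "fhat (cusp k) (0, bw l) n X = cnt (cusp_cut k (bw l)) n X / (real n * vol k (bw l))"
  using lp_weight_cusp[OF assms bw_pos bw_le_1]
  by (simp add: fhat_def cnt_def sum_divide_distrib[symmetric] flip: zero_prod_def)

text \<open>The penalty at the bandwidth \<open>bw l = exp (- l)\<close>.\<close>

definition penalty :: "real \<Rightarrow> real \<Rightarrow> nat \<Rightarrow> real" where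
  "penalty k \<delta> l = 2 * (\<delta> + k - 1) * real l + 2 * ln (k + 1)"

lemma pen_cusp:
  assumes k: "1 < k" and \<delta>: "1 < \<delta>"
  shows "pen (cusp k) \<delta> (0, bw l) = penalty k \<delta> l"
proof -
  have "exp (- ((k + 1) * real l)) = exp (- ((k - 1) * real l)) * (bw l)\<^sup>2"
    by (simp add: bw_def power2_eq_square mult_exp_exp algebra_simps)
  then have "Wker (cusp k) (bw l) = exp (- ((k - 1) * real l)) / (k + 1)"
    unfolding Wker_cusp[OF k bw_pos bw_le_1] vol_bw using bw_pos[of l] by simp
  then have "ln (lam (cusp k) (0, bw l)) = - ((k - 1) * real l + ln (k + 1))"
    using k by (simp add: lam_degree_0 ln_div)
  moreover have "0 \<le> (k - 1) * real l + ln (k + 1)" using k by (intro add_nonneg_nonneg) auto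
  ultimately have "Lam (cusp k) (0, bw l) = 2 * ((k - 1) * real l + ln (k + 1))" by (simp add: Lam_def)
  moreover have "\<bar>ln (bw l)\<bar> = real l" by (simp add: bw_def)
  ultimately show ?thesis by (simp add: pen_def penalty_def algebra_simps)
qed

lemma Uhat_cusp:
  fixes n l :: nat
  assumes k: "1 < k" and \<delta>: "1 < \<delta>" and n: "0 < n"
  defines "m \<equiv> real n * vol k (bw l)" and "x \<equiv> penalty k \<delta> l"
  shows "Uhat (cusp k) \<delta> (0, bw l) n X
     = (sqrt (2 * (cnt (cusp_cut k (bw l)) n X + (\<delta> - 1) * m) * x) + x) / m"
proof -
  have v: "0 < vol k (bw l)" using vol_pos[OF bw_pos k] .
  then have m: "0 < m" using n by (simp add: m_def)
  have h: "0 < bw l" by (rule bw_pos)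
  have W: "Wker (cusp k) (bw l) = vol k (bw l) / (bw l)\<^sup>2" by (rule Wker_cusp[OF k bw_pos bw_le_1])
  have "vhat (cusp k) (0, bw l) n X = cnt (cusp_cut k (bw l)) n X / m\<^sup>2"
  proof -
    have "(indicator (cusp_cut k (bw l)) u / vol k (bw l))\<^sup>2 = indicator (cusp_cut k (bw l)) u / (vol k (bw l))\<^sup>2" for u :: "real \<times> real"
      by (simp add: indicator_def power_divide)
    then show ?thesis
      using lp_weight_cusp[OF k bw_pos bw_le_1]
      by (simp add: vhat_def cnt_def m_def power_mult_distrib sum_divide_distrib[symmetric] flip: zero_prod_def)
  qed
  moreover have "eps (cusp k) \<delta> (0, bw l) n = (\<delta> - 1) * m / m\<^sup>2"
    using h v n by (simp add: eps_def Dm_0 lam_degree_0 W m_def power2_eq_square)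
  moreover have "cc (cusp k) (0, bw l) n = 1 / m"
    using h v n by (simp add: cc_def Dm_0 lam_degree_0 W m_def)
  ultimately have "Uhat (cusp k) \<delta> (0, bw l) n X
     = sqrt (2 * (cnt (cusp_cut k (bw l)) n X / m\<^sup>2 + (\<delta> - 1) * m / m\<^sup>2) * x) + 1 / m * x"
    by (simp add: Uhat_def rr_def pen_cusp[OF k \<delta>] x_def)
  also have "2 * (cnt (cusp_cut k (bw l)) n X / m\<^sup>2 + (\<delta> - 1) * m / m\<^sup>2) * x
      = (2 * (cnt (cusp_cut k (bw l)) n X + (\<delta> - 1) * m) * x) / m\<^sup>2"
    by (simp add: add_divide_distrib[symmetric])
  also have "sqrt \<dots> = sqrt (2 * (cnt (cusp_cut k (bw l)) n X + (\<delta> - 1) * m) * x) / m"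
    using m by (simp only: real_sqrt_divide real_sqrt_abs abs_of_pos)
  finally show ?thesis by (simp add: add_divide_distrib)
qed

section \<open>The oracle inequality\<close>

text \<open>Larger indices mean smaller bandwidths, so \<open>min l l'\<close> is the index of the larger of two
bandwidths. If every estimator with a bandwidth not exceeding that of \<open>l\<close> is within \<open>b + z\<close> plus its
threshold of \<open>\<theta>\<close>, then the selected one, of index \<open>lh\<close>, does nearly as well as that of \<open>l\<close>.\<close>

lemma Lepski_oracle:
  fixes \<Lambda> :: "nat set" and g U :: "nat \<Rightarrow> real" and b z \<theta> :: real
  defines "A \<equiv> (\<lambda>l. MAX l'\<in>\<Lambda>. max (\<bar>g (min l l') - g l'\<bar> - U (min l l') - U l') 0)"
  assumes fin: "finite \<Lambda>" and l: "l \<in> \<Lambda>" and lh: "lh \<in> \<Lambda>"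
    and opt: "A lh + U lh \<le> A l + U l"
    and U: "\<And>l'. l' \<in> \<Lambda> \<Longrightarrow> 0 \<le> U l'" and b: "0 \<le> b" "0 \<le> z"
    and dev: "\<And>l'. l' \<in> \<Lambda> \<Longrightarrow> l \<le> l' \<Longrightarrow> \<bar>g l' - \<theta>\<bar> \<le> b + z + U l'"
  shows "\<bar>g lh - \<theta>\<bar> \<le> 5 * b + 5 * z + 3 * U l"
proof -
  have upper: "max (\<bar>g (min j j') - g j'\<bar> - U (min j j') - U j') 0 \<le> A j" if "j' \<in> \<Lambda>" for j j'
    unfolding A_def by (intro Max_ge) (use fin that in auto)
  have A0: "0 \<le> A j" for j using upper[OF l, of j] by linarith
  have Al: "A l \<le> 2 * b + 2 * z"
    unfolding A_def
  proof (intro Max.boundedI)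
    fix y assume "y \<in> (\<lambda>l'. max (\<bar>g (min l l') - g l'\<bar> - U (min l l') - U l') 0) ` \<Lambda>"
    then obtain l' where l': "l' \<in> \<Lambda>" and y: "y = max (\<bar>g (min l l') - g l'\<bar> - U (min l l') - U l') 0" by blast
    show "y \<le> 2 * b + 2 * z"
    proof (cases "l' \<le> l")
      case True
      then show ?thesis using y b U[OF l'] by (simp add: min_absorb2)
    next
      case False
      then have "\<bar>g l - \<theta>\<bar> \<le> b + z + U l" "\<bar>g l' - \<theta>\<bar> \<le> b + z + U l'" using dev[OF l] dev[OF l'] by auto
      then have "\<bar>g l - g l'\<bar> - U l - U l' \<le> 2 * b + 2 * z" by linarith
      then show ?thesis using y b False by (simp add: min_absorb1)
    qed
  qed (use fin l in auto)
  have gl: "\<bar>g l - \<theta>\<bar> \<le> b + z + U l" using dev[OF l] by simp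
  \<comment> \<open>One of \<open>min l lh = l\<close>, \<open>min l lh = lh\<close> holds, so one of the two comparisons bounds \<open>g lh - g l\<close>.\<close>
  have "\<bar>g lh - g l\<bar> \<le> (A l + U l) + (A l + U l)"
  proof (cases "l \<le> lh")
    case True
    have "\<bar>g l - g lh\<bar> - U l - U lh \<le> A l" using upper[OF lh, of l] True by (simp add: min_absorb1)
    then have "\<bar>g l - g lh\<bar> \<le> (A l + U l) + (A l + U l)" using opt A0[of lh] by linarith
    then show ?thesis by (simp add: abs_minus_commute)
  next
    case False
    have "\<bar>g lh - g l\<bar> - U lh - U l \<le> A lh" using upper[OF l, of lh] False by (simp add: min_absorb1)
    then have "\<bar>g lh - g l\<bar> \<le> (A l + U l) + (A l + U l)" using opt A0[of l] by linarith
    then show ?thesis .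
  qed
  then show ?thesis using gl Al by linarith
qed

lemma gjoin_bw: "gjoin (0, bw l) (0, bw l') = (0, bw (min l l'))"
  by (auto simp: gjoin_def bw_def min_def)

lemma finite_Lset: "finite (Lset D n)"
  by (rule finite_subset[of _ "{..nat \<lfloor>ln (real n)\<rfloor>}"]) (auto simp: Lset_def)

lemma selection_cusp:
  assumes "is_selection D \<delta> (\<lambda>_. 0) ghat" "Lset D n \<noteq> {}"
  shows "\<exists>lh\<in>Lset D n. ghat n X = (0, bw lh) \<and>
    (\<forall>l\<in>Lset D n. Ahat D \<delta> (\<lambda>_. 0) (0, bw lh) n X + Uhat D \<delta> (0, bw lh) n X
       \<le> Ahat D \<delta> (\<lambda>_. 0) (0, bw l) n X + Uhat D \<delta> (0, bw l) n X)"
proof -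
  have "Gam D (\<lambda>_. 0) n \<noteq> {}" using assms(2) by (simp add: Gam_def)
  then have *: "is_arg_min (\<lambda>\<gamma>. Ahat D \<delta> (\<lambda>_. 0) \<gamma> n X + Uhat D \<delta> \<gamma> n X) (\<lambda>\<gamma>. \<gamma> \<in> Gam D (\<lambda>_. 0) n) (ghat n X)"
    using assms(1) unfolding is_selection_def by blast
  then have "ghat n X \<in> Gam D (\<lambda>_. 0) n" by (simp add: is_arg_min_def)
  then obtain lh where lh: "lh \<in> Lset D n" "ghat n X = (0, bw lh)" by (auto simp: Gam_def)
  have "Ahat D \<delta> (\<lambda>_. 0) (0, bw lh) n X + Uhat D \<delta> (0, bw lh) n X
       \<le> Ahat D \<delta> (\<lambda>_. 0) (0, bw l) n X + Uhat D \<delta> (0, bw l) n X" if "l \<in> Lset D n" for l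
    using * that unfolding is_arg_min_linorder lh(2) by (auto simp: Gam_def)
  then show ?thesis using lh by blast
qed

lemma Ahat_Lset:
  "Ahat D \<delta> (\<lambda>_. 0) (0, bw l) n X = (MAX l'\<in>Lset D n.
     max (\<bar>fhat D (0, bw (min l l')) n X - fhat D (0, bw l') n X\<bar>
        - Uhat D \<delta> (0, bw (min l l')) n X - Uhat D \<delta> (0, bw l') n X) 0)"
  unfolding Ahat_def Gam_def image_image gjoin_bw ..

section \<open>Bias\<close>

lemma bias_bound:
  assumes k: "1 < k" and s: "0 < s" "s \<le> 1" and L: "0 < L" and f: "f \<in> Sigma_class (cusp k) s L"
    and h: "0 < h" "h \<le> 1"
  shows "\<bar>measure (cusp_law k f) (cusp_cut k h) - f (0, 0) * vol k h\<bar> \<le> L * h powr s * vol k h"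
proof -
  have dens: "is_density (cusp k) f" and hol: "\<And>u. u \<in> cusp k \<Longrightarrow> \<bar>f u - f (0, 0)\<bar> \<le> L * fst u powr s"
    using f unfolding Sigma_class_cusp_iff[OF k s] by auto
  interpret prob_space "cusp_law k f" by (rule prob_space_cusp_law[OF dens])
  have f0: "0 \<le> f (0, 0)" using dens zero_in_cusp by (auto simp: is_density_def)
  have v: "0 < vol k h" by (rule vol_pos[OF h(1) k])
  have near: "\<bar>f u - f (0, 0)\<bar> \<le> L * h powr s" if "u \<in> cusp_cut k h" for u
  proof -
    have "L * fst u powr s \<le> L * h powr s"
      using that L s by (intro mult_left_mono powr_mono2) (auto simp: cusp_cut_def cusp_def)
    then show ?thesis using hol[of u] that by (simp add: cusp_cut_def)
  qed
  have em: "ennreal (measure (cusp_law k f) (cusp_cut k h)) = (\<integral>\<^sup>+x. ennreal (f x) * indicator (cusp_cut k h) x \<partial>lborel)"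
  proof -
    have "cusp k \<inter> cusp_cut k h = cusp_cut k h" by (auto simp: cusp_cut_def)
    then show ?thesis using emeasure_cusp_law[OF dens cusp_cut_measurable, of k h]
      by (simp add: emeasure_eq_measure)
  qed
  have const: "(\<integral>\<^sup>+x. ennreal c * indicator (cusp_cut k h) x \<partial>lborel) = ennreal (c * vol k h)" if "0 \<le> c" for c
    using that v emeasure_cusp_cut[OF k h] cusp_cut_measurable[of k h] by (simp add: nn_integral_cmult_indicator ennreal_mult)
  have "ennreal (measure (cusp_law k f) (cusp_cut k h)) \<le> (\<integral>\<^sup>+x. ennreal (f (0, 0) + L * h powr s) * indicator (cusp_cut k h) x \<partial>lborel)"
    unfolding em using near by (intro nn_integral_mono) (fastforce simp: indicator_def abs_le_iff intro!: ennreal_leI)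
  also have "\<dots> = ennreal ((f (0, 0) + L * h powr s) * vol k h)"
    by (rule const) (use f0 L in simp)
  finally have up: "measure (cusp_law k f) (cusp_cut k h) \<le> (f (0, 0) + L * h powr s) * vol k h"
    using f0 L v by (subst (asm) ennreal_le_iff) auto
  have low: "(f (0, 0) - L * h powr s) * vol k h \<le> measure (cusp_law k f) (cusp_cut k h)"
  proof (cases "0 \<le> f (0, 0) - L * h powr s")
    case True
    have "ennreal ((f (0, 0) - L * h powr s) * vol k h) = (\<integral>\<^sup>+x. ennreal (f (0, 0) - L * h powr s) * indicator (cusp_cut k h) x \<partial>lborel)"
      by (rule const[symmetric]) (use True in simp)
    also have "\<dots> \<le> ennreal (measure (cusp_law k f) (cusp_cut k h))"
      unfolding em using near by (intro nn_integral_mono) (fastforce simp: indicator_def abs_le_iff intro!: ennreal_leI)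
    finally show ?thesis by (subst (asm) ennreal_le_iff) auto
  next
    case False
    then have "(f (0, 0) - L * h powr s) * vol k h \<le> 0" using v by (simp add: mult_nonpos_nonneg)
    then show ?thesis using measure_nonneg[of "cusp_law k f" "cusp_cut k h"] by linarith
  qed
  show ?thesis using up low by (simp add: abs_le_iff algebra_simps)
qed

lemma value_at_0_bound:
  assumes k: "1 < k" and s: "0 < s" "s \<le> 1" and L: "0 < L" and f: "f \<in> Sigma_class (cusp k) s L"
  shows "0 \<le> f (0, 0)" "f (0, 0) \<le> k + 1 + L"
proof -
  have dens: "is_density (cusp k) f" using f by (simp add: Sigma_class_def)
  interpret prob_space "cusp_law k f" by (rule prob_space_cusp_law[OF dens])
  show "0 \<le> f (0, 0)" using dens zero_in_cusp by (auto simp: is_density_def)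
  have "measure (cusp_law k f) (cusp_cut k 1) \<le> 1" by (rule prob_le_1)
  moreover have "\<bar>measure (cusp_law k f) (cusp_cut k 1) - f (0, 0) * (1 / (k + 1))\<bar> \<le> L * (1 / (k + 1))"
    using bias_bound[OF k s L f, of 1] by (simp add: vol_def)
  ultimately have "f (0, 0) * (1 / (k + 1)) - L * (1 / (k + 1)) \<le> 1" by linarith
  then have "(f (0, 0) - L) / (k + 1) \<le> 1" by (simp add: diff_divide_distrib)
  then show "f (0, 0) \<le> k + 1 + L" using k by (simp add: divide_le_eq)
qed

section \<open>Moments of the excess and of the threshold\<close>

text \<open>A constant such that the penalty is at most \<open>pen_const k \<delta> * ln n\<close> on the grid.\<close>

definition pen_const :: "real \<Rightarrow> real \<Rightarrow> real" where
  "pen_const k \<delta> = 2 * (\<delta> + k - 1) + 2 * ln (k + 1)"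

lemma Lset_cuspD:
  fixes l n :: nat
  assumes k: "1 < k" and \<delta>: "1 < \<delta>" and l: "l \<in> Lset (cusp k) n"
  defines "m \<equiv> real n * vol k (bw l)" and "x \<equiv> penalty k \<delta> l" and "c \<equiv> pen_const k \<delta>"
  shows "0 < n" "1 \<le> l" "real l \<le> ln (real n)" "1 \<le> ln (real n)" "1 \<le> m" "ln (real n) \<le> m"
    "k * real l \<le> x / 2" "0 \<le> x" "x \<le> c * ln (real n)" "x ^ 3 \<le> c ^ 3 * m" "0 \<le> c"
proof -
  from l have l1: "1 \<le> l" and fl: "int l \<le> \<lfloor>ln (real n)\<rfloor>"
    and "(ln (real n)) ^ 3 \<le> real n * (bw l)\<^sup>2 * Wker (cusp k) (bw l)" by (auto simp: Lset_def)
  then have cube: "(ln (real n)) ^ 3 \<le> m"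
    using bw_pos[of l] by (simp add: Wker_cusp[OF k bw_pos bw_le_1] m_def)
  show "1 \<le> l" by fact
  show ll: "real l \<le> ln (real n)" using fl by linarith
  then show ln1: "1 \<le> ln (real n)" using l1 by linarith
  then show "0 < n" by (cases "n = 0") auto
  have "1 * ln (real n) \<le> (ln (real n))\<^sup>2 * ln (real n)"
    using ln1 by (intro mult_right_mono) auto
  then have "ln (real n) \<le> (ln (real n)) ^ 3" by (simp add: power2_eq_square power3_eq_cube)
  then show "ln (real n) \<le> m" using cube by linarith
  then show "1 \<le> m" using ln1 by linarith
  have lk: "0 \<le> ln (k + 1)" using k by simp
  have "k * real l \<le> (\<delta> + k - 1) * real l" using \<delta> by (intro mult_right_mono) auto
  moreover have "x / 2 = (\<delta> + k - 1) * real l + ln (k + 1)" by (simp add: x_def penalty_def add_divide_distrib)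
  ultimately show "k * real l \<le> x / 2" using lk by linarith
  have c0: "0 \<le> 2 * (\<delta> + k - 1)" using \<delta> k by simp
  show x0: "0 \<le> x" using c0 lk by (simp add: x_def penalty_def)
  show cc: "0 \<le> c" using c0 lk by (simp add: c_def pen_const_def)
  have "2 * (\<delta> + k - 1) * real l + 2 * ln (k + 1) * 1 \<le> 2 * (\<delta> + k - 1) * ln (real n) + 2 * ln (k + 1) * ln (real n)"
    using c0 lk ll ln1 by (intro add_mono mult_left_mono) auto
  then show xc: "x \<le> c * ln (real n)" by (simp add: x_def penalty_def c_def pen_const_def distrib_right)
  then have "x ^ 3 \<le> (c * ln (real n)) ^ 3" using x0 by (intro power_mono) auto
  also have "\<dots> \<le> c ^ 3 * m" using cube cc by (simp add: power_mult_distrib mult_left_mono)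
  finally show "x ^ 3 \<le> c ^ 3 * m" .
qed

text \<open>The excess of the stochastic error over the threshold, at the bandwidth \<open>bw l\<close>.\<close>

definition excess :: "real \<Rightarrow> real \<Rightarrow> (real \<times> real \<Rightarrow> real) \<Rightarrow> nat \<Rightarrow> nat \<Rightarrow> (nat \<Rightarrow> real \<times> real) \<Rightarrow> real" where
  "excess k \<delta> f l n X =
     max (\<bar>fhat (cusp k) (0, bw l) n X - measure (cusp_law k f) (cusp_cut k (bw l)) / vol k (bw l)\<bar>
            - Uhat (cusp k) \<delta> (0, bw l) n X) 0"

text \<open>The constant in the bound on the second moment of the excess. The number \<open>k + 1 + 2 * L\<close> in it
bounds the average over \<open>cusp_cut k h\<close> of any density in the class of radius \<open>L\<close>.\<close>

definition excess_const :: "real \<Rightarrow> real \<Rightarrow> real \<Rightarrow> real" where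
  "excess_const k \<delta> L =
     (48 * exp (k + 1 + 2 * L) + 1 + exp (sqrt (pen_const k \<delta> ^ 3 / (8 * (\<delta> - 1))))) / 2 * (k + 1)"

lemma mass_bound:
  assumes k: "1 < k" and s: "0 < s" "s \<le> 1" and L: "0 < L" and f: "f \<in> Sigma_class (cusp k) s L"
    and h: "0 < h" "h \<le> 1"
  shows "measure (cusp_law k f) (cusp_cut k h) \<le> (k + 1 + 2 * L) * vol k h"
proof -
  have v: "0 < vol k h" by (rule vol_pos[OF h(1) k])
  have "h powr s \<le> 1" using h s by (intro powr_le1) auto
  then have "L * h powr s \<le> L * 1" using L by (intro mult_left_mono) auto
  then have "(f (0, 0) + L * h powr s) * vol k h \<le> (k + 1 + 2 * L) * vol k h"
    using v value_at_0_bound(2)[OF k s L f] by (intro mult_right_mono) auto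
  then show ?thesis using bias_bound[OF k s L f h] by (simp add: abs_le_iff algebra_simps)
qed

text \<open>The second moment is of order \<open>exp (- x / 2) / m\<close> with \<open>x\<close> the penalty. Since \<open>x / 2 \<ge> k * l\<close>
and \<open>m\<close> is of order \<open>n * exp (- (k + 1) * l)\<close>, this is of order \<open>exp l / n\<close>, and \<open>m \<ge> 1\<close> gives
\<open>exp l \<le> n powr (1 / (k + 1))\<close>.\<close>

lemma excess_moment:
  fixes n l :: nat
  assumes k: "1 < k" and \<delta>: "1 < \<delta>" and s: "0 < s" "s \<le> 1" and L: "0 < L"
    and f: "f \<in> Sigma_class (cusp k) s L" and l: "l \<in> Lset (cusp k) n"
  shows "(\<integral>\<^sup>+X. ennreal ((excess k \<delta> f l n X)\<^sup>2) \<partial>sample_law (cusp k) n f)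
     \<le> ennreal (excess_const k \<delta> L * real n powr (1 / (k + 1) - 1))"
proof -
  define m where "m = real n * vol k (bw l)"
  define x where "x = penalty k \<delta> l"
  define p where "p = measure (cusp_law k f) (cusp_cut k (bw l))"
  let ?A = "cusp_cut k (bw l)" and ?F = "k + 1 + 2 * L"
  note lf = Lset_cuspD[OF k \<delta> l, folded m_def x_def]
  have dens: "is_density (cusp k) f" using f by (simp add: Sigma_class_def)
  have prob: "prob_space (cusp_law k f)" by (rule prob_space_cusp_law[OF dens])
  have v: "0 < vol k (bw l)" by (rule vol_pos[OF bw_pos k])
  have n: "0 < real n" using lf(1) by simp
  define R where "R = pen_const k \<delta> ^ 3"
  define C1 where "C1 = (48 * exp ?F + 1 + exp (sqrt (R / (8 * (\<delta> - 1))))) / 2"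
  have C1: "0 \<le> C1" by (simp add: C1_def add_nonneg_nonneg)
  let ?U = "\<lambda>X. sqrt (2 * (cnt ?A n X + (\<delta> - 1) * m) * x) + x"
  have aF: "real n * p \<le> ?F * m"
    using mult_left_mono[OF mass_bound[OF k s L f bw_pos bw_le_1], of "real n" l]
    by (simp add: p_def m_def algebra_simps)
  have mom: "(\<integral>\<^sup>+X. ennreal ((max (\<bar>cnt ?A n X - real n * p\<bar> - ?U X) 0)\<^sup>2) \<partial>PiM {1..n} (\<lambda>_. cusp_law k f))
      \<le> ennreal (C1 * (m * exp (- x / 2)))"
    unfolding p_def C1_def
    by (rule excess_second_moment[OF prob])
      (use aF lf \<delta> cusp_cut_measurable in \<open>auto simp: p_def R_def\<close>)
  have ex: "excess k \<delta> f l n X = max (\<bar>cnt ?A n X - real n * p\<bar> - ?U X) 0 / m" for X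
  proof -
    have pv: "p / vol k (bw l) = real n * p / m" using n v by (simp add: m_def)
    have "excess k \<delta> f l n X = max (\<bar>cnt ?A n X / m - real n * p / m\<bar> - ?U X / m) 0"
      unfolding excess_def fhat_cusp[OF k] Uhat_cusp[OF k \<delta> lf(1)] p_def[symmetric] pv
      by (simp add: m_def x_def)
    also have "\<bar>cnt ?A n X / m - real n * p / m\<bar> = \<bar>cnt ?A n X - real n * p\<bar> / m"
      using lf(5) by (simp add: diff_divide_distrib[symmetric])
    finally show ?thesis using lf(5) by (simp add: diff_divide_distrib[symmetric] max_def divide_le_0_iff)
  qed
  have "(\<integral>\<^sup>+X. ennreal ((excess k \<delta> f l n X)\<^sup>2) \<partial>sample_law (cusp k) n f)
      = (\<integral>\<^sup>+X. ennreal (1 / m\<^sup>2) * ennreal ((max (\<bar>cnt ?A n X - real n * p\<bar> - ?U X) 0)\<^sup>2) \<partial>PiM {1..n} (\<lambda>_. cusp_law k f))"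
    unfolding sample_law_eq by (intro nn_integral_cong) (simp add: ex power_divide ennreal_mult[symmetric])
  also have "\<dots> = ennreal (1 / m\<^sup>2) * (\<integral>\<^sup>+X. ennreal ((max (\<bar>cnt ?A n X - real n * p\<bar> - ?U X) 0)\<^sup>2) \<partial>PiM {1..n} (\<lambda>_. cusp_law k f))"
  proof (rule nn_integral_cmult)
    have [measurable]: "cnt ?A n \<in> borel_measurable (PiM {1..n} (\<lambda>_. cusp_law k f))"
      by (rule measurable_cnt) (simp add: cusp_cut_measurable)
    show "(\<lambda>X. ennreal ((max (\<bar>cnt ?A n X - real n * p\<bar> - ?U X) 0)\<^sup>2)) \<in> borel_measurable (PiM {1..n} (\<lambda>_. cusp_law k f))"
      by measurable
  qed
  also have "\<dots> \<le> ennreal (1 / m\<^sup>2) * ennreal (C1 * (m * exp (- x / 2)))"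
    by (intro mult_left_mono mom) auto
  also have "\<dots> = ennreal (C1 * (exp (- x / 2) / m))"
    using lf(5) C1 by (simp add: ennreal_mult[symmetric] power2_eq_square)
  also have "C1 * (exp (- x / 2) / m) \<le> C1 * ((k + 1) * real n powr (1 / (k + 1) - 1))"
  proof (intro mult_left_mono C1)
    have mm: "m = real n * exp (- ((k + 1) * real l)) / (k + 1)" by (simp add: m_def vol_bw)
    have "(k + 1) * 1 \<le> (k + 1) * m" using lf(5) k by (intro mult_left_mono) auto
    then have "1 \<le> real n * exp (- ((k + 1) * real l))" using k by (simp add: mm)
    then have "ln 1 \<le> ln (real n * exp (- ((k + 1) * real l)))" by (intro ln_mono) auto
    also have "\<dots> = ln (real n) - (k + 1) * real l" using n by (simp add: ln_mult)
    finally have lle: "real l \<le> ln (real n) / (k + 1)" using k by (simp add: field_simps)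
    have "exp (- x / 2) / m \<le> exp (- (k * real l)) / m"
      using lf(5,7) by (intro divide_right_mono) auto
    also have "\<dots> = (k + 1) * exp (real l) / real n"
    proof -
      have "exp (- (k * real l)) = exp (real l) * exp (- ((k + 1) * real l))"
        by (simp add: mult_exp_exp algebra_simps)
      then show ?thesis using n k by (simp add: mm)
    qed
    also have "\<dots> \<le> (k + 1) * exp (ln (real n) / (k + 1)) / real n"
      using lle n k by (intro divide_right_mono mult_left_mono) auto
    also have "\<dots> = (k + 1) * real n powr (1 / (k + 1) - 1)"
      using n by (simp add: powr_diff) (simp add: powr_def)
    finally show "exp (- x / 2) / m \<le> (k + 1) * real n powr (1 / (k + 1) - 1)" .
  qed
  finally show ?thesis
    by (simp add: excess_const_def C1_def R_def ennreal_leI mult.assoc)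
qed

lemma Uhat_second_moment:
  fixes n l :: nat
  assumes k: "1 < k" and \<delta>: "1 < \<delta>" and s: "0 < s" "s \<le> 1" and L: "0 < L"
    and f: "f \<in> Sigma_class (cusp k) s L" and l: "l \<in> Lset (cusp k) n"
  defines "c \<equiv> pen_const k \<delta>"
  shows "(\<integral>\<^sup>+X. ennreal ((Uhat (cusp k) \<delta> (0, bw l) n X)\<^sup>2) \<partial>sample_law (cusp k) n f)
     \<le> ennreal ((4 * (k + 1 + 2 * L + \<delta>) + 2 * c) * c * (ln (real n) / (real n * vol k (bw l))))"
proof -
  define m where "m = real n * vol k (bw l)"
  define x where "x = penalty k \<delta> l"
  define p where "p = measure (cusp_law k f) (cusp_cut k (bw l))"
  let ?A = "cusp_cut k (bw l)" and ?F = "k + 1 + 2 * L"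
  let ?P = "PiM {1..n} (\<lambda>_. cusp_law k f)"
  note lf = Lset_cuspD[OF k \<delta> l, folded m_def x_def c_def]
  have dens: "is_density (cusp k) f" using f by (simp add: Sigma_class_def)
  have prob: "prob_space (cusp_law k f)" by (rule prob_space_cusp_law[OF dens])
  have [measurable]: "cnt ?A n \<in> borel_measurable ?P"
    by (rule measurable_cnt) (simp add: cusp_cut_measurable)
  have aF: "real n * p \<le> ?F * m"
    using mult_left_mono[OF mass_bound[OF k s L f bw_pos bw_le_1], of "real n" l]
    by (simp add: p_def m_def algebra_simps)
  have p0: "0 \<le> real n * p" by (simp add: p_def)
  let ?d = "(4 * (\<delta> - 1) * m * x + 2 * x\<^sup>2) / m\<^sup>2"
  have d0: "0 \<le> ?d" using lf \<delta> by (intro divide_nonneg_nonneg add_nonneg_nonneg mult_nonneg_nonneg) auto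
  have pw: "(Uhat (cusp k) \<delta> (0, bw l) n X)\<^sup>2 \<le> 4 * x / m\<^sup>2 * cnt ?A n X + ?d" for X
  proof -
    let ?q = "2 * (cnt ?A n X + (\<delta> - 1) * m) * x"
    have q: "0 \<le> ?q" using lf \<delta> cnt_nonneg[of ?A n X] by (intro mult_nonneg_nonneg add_nonneg_nonneg) auto
    have "(sqrt ?q + x)\<^sup>2 \<le> 2 * (sqrt ?q)\<^sup>2 + 2 * x\<^sup>2"
      using sum_squares_bound[of "sqrt ?q" x] by (simp add: power2_sum)
    also have "\<dots> = 4 * x * cnt ?A n X + (4 * (\<delta> - 1) * m * x + 2 * x\<^sup>2)"
      using q by (simp add: algebra_simps)
    finally have "(sqrt ?q + x)\<^sup>2 / m\<^sup>2 \<le> (4 * x * cnt ?A n X + (4 * (\<delta> - 1) * m * x + 2 * x\<^sup>2)) / m\<^sup>2"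
      by (intro divide_right_mono) auto
    then show ?thesis
      unfolding Uhat_cusp[OF k \<delta> lf(1)] m_def[symmetric] x_def[symmetric] power_divide
      by (simp only: add_divide_distrib times_divide_eq_left)
  qed
  have "(\<integral>\<^sup>+X. ennreal ((Uhat (cusp k) \<delta> (0, bw l) n X)\<^sup>2) \<partial>sample_law (cusp k) n f)
      \<le> (\<integral>\<^sup>+X. ennreal (4 * x / m\<^sup>2) * ennreal (cnt ?A n X) + ennreal ?d \<partial>?P)"
    unfolding sample_law_eq
  proof (intro nn_integral_mono)
    fix X
    have "ennreal ((Uhat (cusp k) \<delta> (0, bw l) n X)\<^sup>2) \<le> ennreal (4 * x / m\<^sup>2 * cnt ?A n X + ?d)"
      by (intro ennreal_leI pw)
    also have "\<dots> = ennreal (4 * x / m\<^sup>2) * ennreal (cnt ?A n X) + ennreal ?d"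
      using lf(8) d0 cnt_nonneg[of ?A n X] by (simp add: ennreal_plus[symmetric] ennreal_mult[symmetric] del: ennreal_plus)
    finally show "ennreal ((Uhat (cusp k) \<delta> (0, bw l) n X)\<^sup>2) \<le> ennreal (4 * x / m\<^sup>2) * ennreal (cnt ?A n X) + ennreal ?d" .
  qed
  also have "\<dots> = ennreal (4 * x / m\<^sup>2) * (\<integral>\<^sup>+X. ennreal (cnt ?A n X) \<partial>?P) + ennreal ?d"
  proof -
    have "(\<integral>\<^sup>+X. ennreal ?d \<partial>?P) = ennreal ?d"
      using prob_space.emeasure_space_1[OF prob_space_PiM[of "{1..n}" "\<lambda>_. cusp_law k f"]] prob by simp
    then show ?thesis
      by (subst nn_integral_add, measurable, subst nn_integral_cmult, measurable)
  qed
  also have "(\<integral>\<^sup>+X. ennreal (cnt ?A n X) \<partial>?P) = ennreal (real n * p)"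
    unfolding p_def by (rule nn_integral_cnt[OF prob]) (simp add: cusp_cut_measurable)
  also have "ennreal (4 * x / m\<^sup>2) * ennreal (real n * p) + ennreal ?d = ennreal (4 * x / m\<^sup>2 * (real n * p) + ?d)"
    using lf(8) d0 p0 by (simp add: ennreal_plus[symmetric] ennreal_mult[symmetric] del: ennreal_plus)
  also have "4 * x / m\<^sup>2 * (real n * p) + ?d \<le> (4 * (?F + \<delta>) + 2 * c) * c * (ln (real n) / m)"
  proof -
    have "4 * x / m\<^sup>2 * (real n * p) \<le> 4 * x / m\<^sup>2 * (?F * m)" using aF lf(8) by (intro mult_left_mono) auto
    also have "\<dots> = 4 * ?F * (x / m)" using lf(5) by (simp add: power2_eq_square)
    finally have t1: "4 * x / m\<^sup>2 * (real n * p) \<le> 4 * ?F * (x / m)" .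
    have xcm: "x \<le> c * m" using lf(9) mult_left_mono[OF lf(6) lf(11)] by linarith
    have "?d = 4 * (\<delta> - 1) * (x / m) + 2 * (x / m) * (x / m)"
      using lf(5) by (simp add: add_divide_distrib power2_eq_square)
    also have "\<dots> \<le> 4 * \<delta> * (x / m) + 2 * c * (x / m)"
      using lf(5,8) xcm by (intro add_mono mult_right_mono) (auto simp: divide_le_eq)
    finally have "4 * x / m\<^sup>2 * (real n * p) + ?d \<le> (4 * (?F + \<delta>) + 2 * c) * (x / m)"
      using t1 by (simp add: algebra_simps)
    also have "\<dots> \<le> (4 * (?F + \<delta>) + 2 * c) * (c * ln (real n) / m)"
      using lf(5,9,11) k L \<delta> by (intro mult_left_mono divide_right_mono) auto
    finally show ?thesis by simp
  qed
  finally show ?thesis by (simp add: ennreal_leI m_def)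
qed

section \<open>The risk of the adaptive estimator\<close>

lemma fhat_sel_pointwise:
  fixes n l :: nat
  assumes k: "1 < k" and \<delta>: "1 < \<delta>" and s: "0 < s" "s \<le> 1" and L: "0 < L"
    and f: "f \<in> Sigma_class (cusp k) s L" and l: "l \<in> Lset (cusp k) n"
    and sel: "is_selection (cusp k) \<delta> (\<lambda>_. 0) ghat"
  shows "(fhat_sel (cusp k) ghat n X - f (0, 0))\<^sup>2
     \<le> 75 * (L * bw l powr s)\<^sup>2 + 75 * (\<Sum>j\<in>Lset (cusp k) n. (excess k \<delta> f j n X)\<^sup>2)
       + 27 * (Uhat (cusp k) \<delta> (0, bw l) n X)\<^sup>2"
proof -
  let ?\<Lambda> = "Lset (cusp k) n"
  let ?g = "\<lambda>j. fhat (cusp k) (0, bw j) n X" and ?U = "\<lambda>j. Uhat (cusp k) \<delta> (0, bw j) n X"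
  let ?S = "\<Sum>j\<in>?\<Lambda>. (excess k \<delta> f j n X)\<^sup>2"
  have S0: "0 \<le> ?S" by (intro sum_nonneg) auto
  obtain lh where lh: "lh \<in> ?\<Lambda>" "ghat n X = (0, bw lh)"
    and opt: "Ahat (cusp k) \<delta> (\<lambda>_. 0) (0, bw lh) n X + ?U lh \<le> Ahat (cusp k) \<delta> (\<lambda>_. 0) (0, bw l) n X + ?U l"
    using selection_cusp[OF sel, of n X] l by blast
  \<comment> \<open>The excesses enter through their Euclidean norm, which dominates each of them.\<close>
  have "\<bar>?g lh - f (0, 0)\<bar> \<le> 5 * (L * bw l powr s) + 5 * sqrt ?S + 3 * ?U l"
  proof (rule Lepski_oracle[where \<Lambda> = ?\<Lambda> and g = ?g and U = ?U])
    show "finite ?\<Lambda>" by (rule finite_Lset)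
    show "(MAX l'\<in>?\<Lambda>. max (\<bar>?g (min lh l') - ?g l'\<bar> - ?U (min lh l') - ?U l') 0) + ?U lh
        \<le> (MAX l'\<in>?\<Lambda>. max (\<bar>?g (min l l') - ?g l'\<bar> - ?U (min l l') - ?U l') 0) + ?U l"
      using opt unfolding Ahat_Lset .
    fix j assume j: "j \<in> ?\<Lambda>"
    note lf = Lset_cuspD[OF k \<delta> j]
    show "0 \<le> ?U j"
      unfolding Uhat_cusp[OF k \<delta> lf(1)]
      using lf(8) \<delta> cnt_nonneg[of "cusp_cut k (bw j)" n X] vol_pos[OF bw_pos[of j] k]
      by (intro divide_nonneg_nonneg add_nonneg_nonneg real_sqrt_ge_zero mult_nonneg_nonneg) auto
    assume lj: "l \<le> j"
    let ?v = "vol k (bw j)" and ?p = "measure (cusp_law k f) (cusp_cut k (bw j))"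
    have v: "0 < ?v" by (rule vol_pos[OF bw_pos k])
    have "bw j powr s \<le> bw l powr s" using lj s by (intro powr_mono2) (auto simp: bw_def)
    then have "L * bw j powr s \<le> L * bw l powr s" using L by (intro mult_left_mono) auto
    moreover have "\<bar>?p / ?v - f (0, 0)\<bar> \<le> L * bw j powr s"
    proof -
      have "?p / ?v - f (0, 0) = (?p - f (0, 0) * ?v) / ?v" using v by (simp add: field_simps)
      then have "\<bar>?p / ?v - f (0, 0)\<bar> = \<bar>?p - f (0, 0) * ?v\<bar> / ?v" using v by simp
      also have "\<dots> \<le> (L * bw j powr s * ?v) / ?v"
        using bias_bound[OF k s L f bw_pos bw_le_1, of j] v by (intro divide_right_mono) auto
      finally show ?thesis using v by simp
    qed
    moreover have "\<bar>?g j - ?p / ?v\<bar> - ?U j \<le> excess k \<delta> f j n X" by (simp add: excess_def)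
    moreover have "excess k \<delta> f j n X \<le> sqrt ?S"
      by (rule real_le_rsqrt) (use j finite_Lset in \<open>auto intro: member_le_sum\<close>)
    ultimately show "\<bar>?g j - f (0, 0)\<bar> \<le> L * bw l powr s + sqrt ?S + ?U j" by linarith
  qed (use l lh L S0 in auto)
  then have "\<bar>?g lh - f (0, 0)\<bar>\<^sup>2 \<le> (5 * (L * bw l powr s) + 5 * sqrt ?S + 3 * ?U l)\<^sup>2"
    by (intro power_mono) auto
  also have "\<dots> \<le> 75 * (L * bw l powr s)\<^sup>2 + 75 * (sqrt ?S)\<^sup>2 + 27 * (?U l)\<^sup>2"
  proof -
    have "(a + b + c)\<^sup>2 \<le> 3 * a\<^sup>2 + 3 * b\<^sup>2 + 3 * c\<^sup>2" for a b c :: real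
    proof -
      have "0 \<le> (a - b)\<^sup>2 + (a - c)\<^sup>2 + (b - c)\<^sup>2" by simp
      then show ?thesis by (simp add: power2_eq_square algebra_simps)
    qed
    from this[of "5 * (L * bw l powr s)" "5 * sqrt ?S" "3 * ?U l"] show ?thesis
      by (simp add: power_mult_distrib)
  qed
  finally show ?thesis using S0 by (simp add: fhat_sel_def lh(2))
qed

lemma risk_bound_fixed_n:
  fixes n l :: nat
  assumes k: "1 < k" and \<delta>: "1 < \<delta>" and s: "0 < s" "s \<le> 1" and L: "0 < L"
    and f: "f \<in> Sigma_class (cusp k) s L" and l: "l \<in> Lset (cusp k) n"
    and sel: "is_selection (cusp k) \<delta> (\<lambda>_. 0) ghat"
  defines "c \<equiv> pen_const k \<delta>"
  shows "(\<integral>\<^sup>+X. ennreal ((fhat_sel (cusp k) ghat n X - f (0, 0))\<^sup>2) \<partial>sample_law (cusp k) n f)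
     \<le> ennreal (75 * (L * bw l powr s)\<^sup>2
         + 75 * (ln (real n) * (excess_const k \<delta> L * real n powr (1 / (k + 1) - 1)))
         + 27 * ((4 * (k + 1 + 2 * L + \<delta>) + 2 * c) * c * (ln (real n) / (real n * vol k (bw l)))))"
proof -
  let ?\<Lambda> = "Lset (cusp k) n" and ?P = "sample_law (cusp k) n f"
  let ?K = "excess_const k \<delta> L * real n powr (1 / (k + 1) - 1)"
  let ?V = "(4 * (k + 1 + 2 * L + \<delta>) + 2 * c) * c * (ln (real n) / (real n * vol k (bw l)))"
  note lf = Lset_cuspD[OF k \<delta> l]
  have dens: "is_density (cusp k) f" using f by (simp add: Sigma_class_def)
  have prob: "prob_space ?P"
    unfolding sample_law_eq by (intro prob_space_PiM prob_space_cusp_law dens)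
  have cm [measurable]: "cnt (cusp_cut k h) n \<in> borel_measurable ?P" for h
    unfolding sample_law_eq by (rule measurable_cnt) (simp add: cusp_cut_measurable)
  have Um [measurable]: "(\<lambda>X. Uhat (cusp k) \<delta> (0, bw j) n X) \<in> borel_measurable ?P" for j
    unfolding Uhat_cusp[OF k \<delta> lf(1)] by measurable
  have em [measurable]: "(\<lambda>X. excess k \<delta> f j n X) \<in> borel_measurable ?P" for j
    unfolding excess_def fhat_cusp[OF k] by measurable
  have K0: "0 \<le> ?K" using k by (simp add: excess_const_def add_nonneg_nonneg)
  have V0: "0 \<le> ?V" using lf(4,5,11) k L \<delta> by (simp add: c_def)
  have "card ?\<Lambda> \<le> card {1..nat \<lfloor>ln (real n)\<rfloor>}"
    by (intro card_mono) (auto simp: Lset_def)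
  then have card: "real (card ?\<Lambda>) \<le> ln (real n)" using lf(4) by simp linarith
  have sumK: "(\<Sum>j\<in>?\<Lambda>. ennreal ?K) \<le> ennreal (ln (real n) * ?K)"
  proof -
    have "(\<Sum>j\<in>?\<Lambda>. ennreal ?K) = ennreal (real (card ?\<Lambda>) * ?K)"
      using K0 by (simp add: ennreal_mult ennreal_of_nat_eq_real_of_nat)
    also have "\<dots> \<le> ennreal (ln (real n) * ?K)"
      by (intro ennreal_leI mult_right_mono card K0)
    finally show ?thesis .
  qed
  have "(\<integral>\<^sup>+X. ennreal ((fhat_sel (cusp k) ghat n X - f (0, 0))\<^sup>2) \<partial>?P)
      \<le> (\<integral>\<^sup>+X. ennreal (75 * (L * bw l powr s)\<^sup>2) + (ennreal 75 * (\<Sum>j\<in>?\<Lambda>. ennreal ((excess k \<delta> f j n X)\<^sup>2))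
         + ennreal 27 * ennreal ((Uhat (cusp k) \<delta> (0, bw l) n X)\<^sup>2)) \<partial>?P)"
  proof (intro nn_integral_mono)
    fix X
    have "ennreal ((fhat_sel (cusp k) ghat n X - f (0, 0))\<^sup>2)
        \<le> ennreal (75 * (L * bw l powr s)\<^sup>2 + (75 * (\<Sum>j\<in>?\<Lambda>. (excess k \<delta> f j n X)\<^sup>2)
         + 27 * (Uhat (cusp k) \<delta> (0, bw l) n X)\<^sup>2))"
      using fhat_sel_pointwise[OF k \<delta> s L f l sel, of X] by (intro ennreal_leI) simp
    also have "\<dots> = ennreal (75 * (L * bw l powr s)\<^sup>2) + (ennreal 75 * (\<Sum>j\<in>?\<Lambda>. ennreal ((excess k \<delta> f j n X)\<^sup>2))
         + ennreal 27 * ennreal ((Uhat (cusp k) \<delta> (0, bw l) n X)\<^sup>2))"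
    proof -
      have split: "ennreal (a + (75 * b + 27 * c)) = ennreal a + (ennreal 75 * ennreal b + ennreal 27 * ennreal c)"
        if "0 \<le> a" "0 \<le> b" "0 \<le> c" for a b c :: real
        using that by (simp add: ennreal_mult)
      show ?thesis
        by (subst sum_ennreal, simp, rule split) (auto intro: sum_nonneg)
    qed
    finally show "ennreal ((fhat_sel (cusp k) ghat n X - f (0, 0))\<^sup>2)
      \<le> ennreal (75 * (L * bw l powr s)\<^sup>2) + (ennreal 75 * (\<Sum>j\<in>?\<Lambda>. ennreal ((excess k \<delta> f j n X)\<^sup>2))
         + ennreal 27 * ennreal ((Uhat (cusp k) \<delta> (0, bw l) n X)\<^sup>2))" .
  qed
  also have "\<dots> = ennreal (75 * (L * bw l powr s)\<^sup>2) + (ennreal 75 * (\<Sum>j\<in>?\<Lambda>. \<integral>\<^sup>+X. ennreal ((excess k \<delta> f j n X)\<^sup>2) \<partial>?P)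
         + ennreal 27 * (\<integral>\<^sup>+X. ennreal ((Uhat (cusp k) \<delta> (0, bw l) n X)\<^sup>2) \<partial>?P))"
  proof -
    define e where "e = (\<lambda>j X. ennreal ((excess k \<delta> f j n X)\<^sup>2))"
    define u where "u = (\<lambda>X. ennreal ((Uhat (cusp k) \<delta> (0, bw l) n X)\<^sup>2))"
    have [measurable]: "e j \<in> borel_measurable ?P" "u \<in> borel_measurable ?P" for j
      unfolding e_def u_def using em Um by measurable
    have "(\<integral>\<^sup>+X. ennreal a + (ennreal 75 * (\<Sum>j\<in>?\<Lambda>. e j X) + ennreal 27 * u X) \<partial>?P)
        = ennreal a + (ennreal 75 * (\<Sum>j\<in>?\<Lambda>. \<integral>\<^sup>+X. e j X \<partial>?P) + ennreal 27 * (\<integral>\<^sup>+X. u X \<partial>?P))" for a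
      using prob_space.emeasure_space_1[OF prob]
      by (simp add: nn_integral_add nn_integral_cmult nn_integral_sum)
    then show ?thesis unfolding e_def u_def .
  qed
  also have "\<dots> \<le> ennreal (75 * (L * bw l powr s)\<^sup>2) + (ennreal 75 * (\<Sum>j\<in>?\<Lambda>. ennreal ?K) + ennreal 27 * ennreal ?V)"
    unfolding c_def
    by (intro add_left_mono add_mono mult_left_mono sum_mono excess_moment[OF k \<delta> s L f]
        Uhat_second_moment[OF k \<delta> s L f l]) auto
  also have "\<dots> \<le> ennreal (75 * (L * bw l powr s)\<^sup>2) + (ennreal 75 * ennreal (ln (real n) * ?K) + ennreal 27 * ennreal ?V)"
    by (intro add_left_mono add_right_mono mult_left_mono sumK) auto
  also have "ennreal (75 * (L * bw l powr s)\<^sup>2) + (ennreal 75 * ennreal (ln (real n) * ?K) + ennreal 27 * ennreal ?V)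
      = ennreal (75 * (L * bw l powr s)\<^sup>2 + (75 * (ln (real n) * ?K) + 27 * ?V))"
  proof -
    have "0 \<le> ln (real n) * ?K" by (rule mult_nonneg_nonneg[OF _ K0]) (use lf(4) in simp)
    then show ?thesis using V0 by (simp only: ennreal_mult[symmetric] ennreal_plus[symmetric] zero_le_numeral
        mult_nonneg_nonneg add_nonneg_nonneg zero_le_power2)
  qed
  finally show ?thesis by (simp only: add.assoc)
qed

section \<open>The rate\<close>

text \<open>For large \<open>n\<close>, the index of the largest bandwidth \<open>bw l\<close> that does not exceed
\<open>(ln n / n) powr (1 / (2 * s + k + 1))\<close>.\<close>

definition oracle_index :: "real \<Rightarrow> real \<Rightarrow> nat \<Rightarrow> nat" where
  "oracle_index k s n = nat \<lceil>ln (real n / ln (real n)) / (2 * s + k + 1)\<rceil>"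

lemma oracle_index_properties:
  assumes k: "1 < k" and s: "0 < s"
  defines "r \<equiv> \<lambda>n. (ln (real n) / real n) powr (1 / (2 * s + k + 1))"
  shows "\<forall>\<^sub>F n in sequentially. oracle_index k s n \<in> Lset (cusp k) n
    \<and> exp (- 1) * r n \<le> bw (oracle_index k s n) \<and> bw (oracle_index k s n) \<le> r n"
proof -
  define E where "E = 2 * s + k + 1"
  have E: "2 < E" using k s by (simp add: E_def)
  define q where "q = (k + 1) / E"
  have q: "0 < q" "q < 1" using k s by (auto simp: q_def E_def)
  define c where "c = exp (- (k + 1)) / (k + 1)"
  have c: "0 < c" using k by (simp add: c_def)
  have "\<forall>\<^sub>F n in sequentially. 0 < ln (real n / ln (real n)) / E" using E by real_asymp
  moreover have "\<forall>\<^sub>F n in sequentially. 2 \<le> ln (real n)"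
    by real_asymp
  moreover have "\<forall>\<^sub>F n in sequentially. ln (real n) ^ 3 \<le> c * (real n * (ln (real n) / real n) powr q)"
    using c q by real_asymp
  moreover have "\<forall>\<^sub>F n::nat in sequentially. 3 \<le> n" by (rule eventually_ge_at_top)
  ultimately show ?thesis
  proof eventually_elim
    case (elim n)
    have n: "0 < real n" "0 < ln (real n)" using elim(4) by auto
    define l where "l = oracle_index k s n"
    have rp: "0 < r n" using n by (simp add: r_def)
    have lnr: "ln (r n) = - (ln (real n / ln (real n)) / E)"
      using n by (simp add: r_def E_def ln_powr ln_div diff_divide_distrib)
    have ceil: "real l = of_int \<lceil>ln (real n / ln (real n)) / E\<rceil>"
      using elim(1) unfolding l_def oracle_index_def E_def[symmetric] by (subst of_nat_nat) auto
    have l_ge: "- ln (r n) \<le> real l" unfolding ceil lnr by simp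
    have l_le: "real l \<le> - ln (r n) + 1" unfolding ceil lnr using ceiling_correct[of "ln (real n / ln (real n)) / E"] by linarith
    have up: "bw l \<le> r n"
    proof -
      have "exp (- real l) \<le> exp (ln (r n))" using l_ge by simp
      then show ?thesis using rp by (simp add: bw_def)
    qed
    have low: "exp (- 1) * r n \<le> bw l"
    proof -
      have "exp (ln (r n) - 1) \<le> exp (- real l)" using l_le by simp
      then show ?thesis using rp by (simp add: bw_def exp_diff exp_minus field_simps)
    qed
    have "l \<in> Lset (cusp k) n"
    proof -
      have "0 < real l" using l_ge elim(1) unfolding lnr by linarith
      moreover have "real l \<le> ln (real n)"
      proof -
        have "ln (real n / ln (real n)) / E \<le> ln (real n) / 2"
          using n elim(2) E by (intro frac_le) (auto simp: ln_div)
        then show ?thesis using l_le elim(2) unfolding lnr by linarith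
      qed
      then have "int l \<le> \<lfloor>ln (real n)\<rfloor>" by (simp add: le_floor_iff)
      moreover have "ln (real n) ^ 3 \<le> real n * (bw l)\<^sup>2 * Wker (cusp k) (bw l)"
      proof -
        have "r n powr (k + 1) = (ln (real n) / real n) powr q"
          by (simp add: r_def powr_powr q_def E_def[symmetric])
        then have "c * (real n * (ln (real n) / real n) powr q) = real n * ((exp (- 1) * r n) powr (k + 1) / (k + 1))"
          by (simp add: c_def powr_mult exp_powr_real)
        also have "\<dots> \<le> real n * (bw l powr (k + 1) / (k + 1))"
          using low k n rp by (intro mult_left_mono divide_right_mono powr_mono2) auto
        also have "\<dots> = real n * (bw l)\<^sup>2 * Wker (cusp k) (bw l)"
          using bw_pos[of l] by (simp add: Wker_cusp[OF k bw_pos bw_le_1] vol_def)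
        finally show ?thesis using elim(3) by linarith
      qed
      ultimately show ?thesis by (simp add: Lset_def)
    qed
    then show ?case using up low by (simp add: l_def)
  qed
qed

lemma adaptive_risk_bound:
  assumes k: "1 < k" and \<delta>: "1 < \<delta>" and s: "0 < s" "s \<le> 1" and L: "0 < L"
  shows "\<exists>C>0. \<forall>\<^sub>F n in sequentially. (\<forall>ghat f. is_selection (cusp k) \<delta> (\<lambda>_. 0) ghat \<longrightarrow>
     f \<in> Sigma_class (cusp k) s L \<longrightarrow> risk (cusp k) n (fhat_sel (cusp k) ghat n) f \<le> ennreal (C * rate k s n))"
proof -
  define E where "E = 2 * s + k + 1"
  have E: "2 < E" using k s by (simp add: E_def)
  define r where "r = (\<lambda>n. (ln (real n) / real n) powr (1 / E))"
  define c where "c = pen_const k \<delta>"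
  have c0: "0 \<le> c" using k \<delta> by (simp add: c_def pen_const_def add_nonneg_nonneg)
  define C2 where "C2 = (4 * (k + 1 + 2 * L + \<delta>) + 2 * c) * c"
  have C2: "0 \<le> C2" using k L \<delta> c0 by (simp add: C2_def)
  define C3 where "C3 = excess_const k \<delta> L"
  have C3: "0 \<le> C3" using k by (simp add: C3_def excess_const_def add_nonneg_nonneg)
  define D where "D = 75 * L\<^sup>2 + 75 * C3 + 27 * (C2 * ((k + 1) * exp (k + 1)))"
  have D: "0 < D" using L C2 C3 k by (auto simp: D_def intro!: add_pos_nonneg mult_nonneg_nonneg)
  define \<beta> where "\<beta> = 2 * s / E"
  define \<tau> where "\<tau> = 1 / (k + 1) - 1"
  have \<beta>: "0 < \<beta>" "\<beta> < 1" using s k by (auto simp: \<beta>_def E_def)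
  \<comment> \<open>The excesses are of smaller order than the squared rate because \<open>2 * s / (2 * s + k + 1) < k / (k + 1)\<close>.\<close>
  have \<tau>: "\<tau> < - \<beta>"
  proof -
    have "2 * s * (k + 1) < k * (2 * s + k + 1)"
    proof -
      have "2 * s \<le> 2" using s by simp
      also have "2 < k * (k + 1)" using k mult_strict_mono[of 1 k 2 "k + 1"] by simp
      finally show ?thesis by (simp add: algebra_simps)
    qed
    then have "\<beta> < k / (k + 1)" using k s by (simp add: \<beta>_def E_def divide_less_eq less_divide_eq mult.commute)
    moreover have "\<tau> = - (k / (k + 1))" using k by (simp add: \<tau>_def field_simps)
    ultimately show ?thesis by simp
  qed
  have small: "\<forall>\<^sub>F n in sequentially. ln (real n) * real n powr \<tau> \<le> (ln (real n) / real n) powr \<beta>"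
    using \<beta> \<tau> by real_asymp
  have "\<forall>\<^sub>F n in sequentially. (\<forall>ghat f. is_selection (cusp k) \<delta> (\<lambda>_. 0) ghat \<longrightarrow>
     f \<in> Sigma_class (cusp k) s L \<longrightarrow> risk (cusp k) n (fhat_sel (cusp k) ghat n) f \<le> ennreal (sqrt D * rate k s n))"
    using oracle_index_properties[OF k s(1)] small eventually_ge_at_top[of 3]
  proof eventually_elim
    case (elim n)
    define l where "l = oracle_index k s n"
    have n: "0 < real n" "0 < ln (real n)" using elim(3) by auto
    have rp: "0 < r n" using n by (simp add: r_def)
    have l: "l \<in> Lset (cusp k) n" and low: "exp (- 1) * r n \<le> bw l" and up: "bw l \<le> r n"
      using elim(1) by (auto simp: l_def r_def E_def)
    have rate2: "(rate k s n)\<^sup>2 = (ln (real n) / real n) powr \<beta>"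
      by (simp add: rate_def \<beta>_def E_def power2_eq_square flip: powr_add)
    have t1: "(L * bw l powr s)\<^sup>2 \<le> L\<^sup>2 * (rate k s n)\<^sup>2"
    proof -
      have "bw l powr s \<le> r n powr s" using up s bw_pos[of l] by (intro powr_mono2) auto
      also have "\<dots> = rate k s n" by (simp add: r_def powr_powr rate_def E_def)
      finally have "(bw l powr s)\<^sup>2 \<le> (rate k s n)\<^sup>2" by (intro power_mono) auto
      then show ?thesis by (simp add: power_mult_distrib mult_left_mono)
    qed
    have t2: "ln (real n) * (C3 * real n powr \<tau>) \<le> C3 * (rate k s n)\<^sup>2"
      using mult_left_mono[OF elim(2) C3] by (simp add: rate2 algebra_simps)
    have t3: "ln (real n) / (real n * vol k (bw l)) \<le> (k + 1) * exp (k + 1) * (rate k s n)\<^sup>2"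
    proof -
      have "(exp (- 1) * r n) powr (k + 1) / (k + 1) \<le> vol k (bw l)"
        unfolding vol_def using low k rp by (intro divide_right_mono powr_mono2) auto
      then have "ln (real n) / (real n * vol k (bw l)) \<le> ln (real n) / (real n * ((exp (- 1) * r n) powr (k + 1) / (k + 1)))"
        using n rp k by (intro divide_left_mono mult_left_mono mult_pos_pos) (auto intro: vol_pos bw_pos)
      also have "\<dots> = (k + 1) * exp (k + 1) * ((ln (real n) / real n) / r n powr (k + 1))"
      proof -
        have "(exp (- 1) * r n) powr (k + 1) = r n powr (k + 1) / exp (k + 1)"
        proof -
          have "exp (- 1 * (k + 1)) = 1 / exp (k + 1)"
            by (simp only: mult_minus1 exp_minus inverse_eq_divide)
          then show ?thesis unfolding powr_mult exp_powr_real by simp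
        qed
        then show ?thesis by simp
      qed
      also have "(ln (real n) / real n) / r n powr (k + 1) = (ln (real n) / real n) powr (1 - (k + 1) / E)"
        using n by (simp add: r_def powr_powr powr_diff)
      also have "1 - (k + 1) / E = \<beta>" using E by (simp add: \<beta>_def field_simps) (simp add: E_def)
      finally show ?thesis by (simp add: rate2)
    qed
    show ?case
    proof (intro allI impI)
      fix ghat f
      assume sel: "is_selection (cusp k) \<delta> (\<lambda>_. 0) ghat" and f: "f \<in> Sigma_class (cusp k) s L"
      have "(\<integral>\<^sup>+X. ennreal ((fhat_sel (cusp k) ghat n X - f (0, 0))\<^sup>2) \<partial>sample_law (cusp k) n f)
         \<le> ennreal (75 * (L * bw l powr s)\<^sup>2 + 75 * (ln (real n) * (C3 * real n powr \<tau>))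
             + 27 * (C2 * (ln (real n) / (real n * vol k (bw l)))))"
        using risk_bound_fixed_n[OF k \<delta> s L f l sel] by (simp only: C2_def C3_def c_def \<tau>_def)
      also have "\<dots> \<le> ennreal (75 * (L\<^sup>2 * (rate k s n)\<^sup>2) + 75 * (C3 * (rate k s n)\<^sup>2)
             + 27 * (C2 * ((k + 1) * exp (k + 1) * (rate k s n)\<^sup>2)))"
        by (intro ennreal_leI add_mono mult_left_mono t1 t2 t3 C2) auto
      also have "75 * (L\<^sup>2 * (rate k s n)\<^sup>2) + 75 * (C3 * (rate k s n)\<^sup>2)
             + 27 * (C2 * ((k + 1) * exp (k + 1) * (rate k s n)\<^sup>2)) = (sqrt D * rate k s n)\<^sup>2"
        using D by (simp add: D_def power_mult_distrib distrib_right mult.assoc)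
      finally show "risk (cusp k) n (fhat_sel (cusp k) ghat n) f \<le> ennreal (sqrt D * rate k s n)"
        using D by (subst risk_le_iff) (auto simp: rate_def)
    qed
  qed
  then show ?thesis using D by (intro exI[of _ "sqrt D"]) auto
qed

section \<open>A measurable selection\<close>

text \<open>The index of the largest bandwidth among the minimisers of the selection criterion;
it is irrelevant if the grid is empty.\<close>

definition least_minimiser :: "real \<Rightarrow> real \<Rightarrow> nat \<Rightarrow> (nat \<Rightarrow> real \<times> real) \<Rightarrow> nat" where
  "least_minimiser k \<delta> n X = (LEAST l. l \<in> Lset (cusp k) n \<and> (\<forall>l'\<in>Lset (cusp k) n.
     Ahat (cusp k) \<delta> (\<lambda>_. 0) (0, bw l) n X + Uhat (cusp k) \<delta> (0, bw l) n X
       \<le> Ahat (cusp k) \<delta> (\<lambda>_. 0) (0, bw l') n X + Uhat (cusp k) \<delta> (0, bw l') n X))"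

lemma is_selection_least_minimiser:
  "is_selection (cusp k) \<delta> (\<lambda>_. 0) (\<lambda>n X. (0, bw (least_minimiser k \<delta> n X)))"
  unfolding is_selection_def
proof (intro allI impI)
  fix n X assume "Gam (cusp k) (\<lambda>_. 0) n \<noteq> {}"
  then have ne: "Lset (cusp k) n \<noteq> {}" by (simp add: Gam_def)
  let ?\<Lambda> = "Lset (cusp k) n"
  let ?c = "\<lambda>l. Ahat (cusp k) \<delta> (\<lambda>_. 0) (0, bw l) n X + Uhat (cusp k) \<delta> (0, bw l) n X"
  have "Min (?c ` ?\<Lambda>) \<in> ?c ` ?\<Lambda>" using ne finite_Lset by (intro Min_in) auto
  then obtain l where "l \<in> ?\<Lambda>" "?c l = Min (?c ` ?\<Lambda>)" by auto
  then have "l \<in> ?\<Lambda> \<and> (\<forall>l'\<in>?\<Lambda>. ?c l \<le> ?c l')" using finite_Lset by (auto intro: Min_le)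
  then have "least_minimiser k \<delta> n X \<in> ?\<Lambda> \<and> (\<forall>l'\<in>?\<Lambda>. ?c (least_minimiser k \<delta> n X) \<le> ?c l')"
    unfolding least_minimiser_def by (rule LeastI)
  then show "is_arg_min (\<lambda>\<gamma>. Ahat (cusp k) \<delta> (\<lambda>_. 0) \<gamma> n X + Uhat (cusp k) \<delta> \<gamma> n X)
     (\<lambda>\<gamma>. \<gamma> \<in> Gam (cusp k) (\<lambda>_. 0) n) (0, bw (least_minimiser k \<delta> n X))"
    unfolding is_arg_min_linorder by (auto simp: Gam_def)
qed

lemma is_estimator_fhat_sel:
  fixes k \<delta> :: real
  assumes k: "1 < k" and \<delta>: "1 < \<delta>"
  shows "is_estimator (fhat_sel (cusp k) (\<lambda>n X. (0, bw (least_minimiser k \<delta> n X))))"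
  unfolding is_estimator_def
proof
  fix n :: nat
  let ?P = "\<Pi>\<^sub>M i\<in>{1..n}. (borel :: (real \<times> real) measure)"
  let ?\<Lambda> = "Lset (cusp k) n"
  let ?c = "\<lambda>l X. Ahat (cusp k) \<delta> (\<lambda>_. 0) (0, bw l) n X + Uhat (cusp k) \<delta> (0, bw l) n X"
  have cm [measurable]: "cnt (cusp_cut k h) n \<in> borel_measurable ?P" for h
    by (rule measurable_cnt[OF cusp_cut_measurable])
  have fm [measurable]: "(\<lambda>X. fhat (cusp k) (0, bw l) n X) \<in> borel_measurable ?P" for l
    unfolding fhat_cusp[OF k] by measurable
  have crit: "Measurable.pred ?P (\<lambda>X. l \<in> ?\<Lambda> \<and> (\<forall>l'\<in>?\<Lambda>. ?c l X \<le> ?c l' X))" for l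
  proof (cases "l \<in> ?\<Lambda>")
    case True
    have n: "0 < n" using Lset_cuspD(1)[OF k \<delta> True] .
    have Um [measurable]: "(\<lambda>X. Uhat (cusp k) \<delta> (0, bw j) n X) \<in> borel_measurable ?P" for j
      unfolding Uhat_cusp[OF k \<delta> n] by measurable
    have Am [measurable]: "(\<lambda>X. Ahat (cusp k) \<delta> (\<lambda>_. 0) (0, bw j) n X) \<in> borel_measurable ?P" for j
      unfolding Ahat_Lset by (intro borel_measurable_Max finite_Lset) measurable
    define c where "c = ?c"
    have c: "c j \<in> borel_measurable ?P" for j
      unfolding c_def by (intro borel_measurable_add Am Um)
    have "Measurable.pred ?P (\<lambda>X. c l X \<le> c l' X)" for l'
      unfolding pred_def by (intro borel_measurable_le c)
    then have "Measurable.pred ?P (\<lambda>X. \<forall>l'\<in>?\<Lambda>. c l X \<le> c l' X)"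
      by (intro pred_intros_finite finite_Lset)
    then show ?thesis using True unfolding c_def by simp
  next
    case False
    then show ?thesis by simp
  qed
  have "least_minimiser k \<delta> n \<in> measurable ?P (count_space UNIV)"
    unfolding least_minimiser_def by (intro measurable_Least crit)
  then have "(\<lambda>X. fhat (cusp k) (0, bw (least_minimiser k \<delta> n X)) n X) \<in> borel_measurable ?P"
    by (rule measurable_compose_countable[OF fm])
  then show "fhat_sel (cusp k) (\<lambda>n X. (0, bw (least_minimiser k \<delta> n X))) n \<in> borel_measurable ?P"
    by (simp add: fhat_sel_def[abs_def])
qed

lemma rate_pos: "2 \<le> n \<Longrightarrow> 0 < rate k s n"
  by (simp add: rate_def)

lemma admissible_ARC_rate:
  fixes k \<delta> :: real
  assumes k: "1 < k" and \<delta>: "1 < \<delta>"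
  shows "admissible (cusp k) Kset (ARC_rate k)"
  unfolding admissible_def
proof (intro conjI exI)
  show "is_collection Kset (ARC_rate k)" by (auto simp: is_collection_def)
  show "is_estimator (fhat_sel (cusp k) (\<lambda>n X. (0, bw (least_minimiser k \<delta> n X))))"
    by (rule is_estimator_fhat_sel[OF k \<delta>])
  show "\<forall>(s, L)\<in>Kset. lesssim (\<lambda>n. SUP f\<in>Sigma_class (cusp k) s L.
      risk (cusp k) n (fhat_sel (cusp k) (\<lambda>n X. (0, bw (least_minimiser k \<delta> n X))) n) f)
      (\<lambda>n. ennreal (ARC_rate k (s, L) n))"
  proof
    fix \<theta> assume "\<theta> \<in> Kset"
    then obtain s L where \<theta>: "\<theta> = (s, L)" and s: "0 < s" "s \<le> 1" and L: "0 < L" by auto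
    let ?T = "fhat_sel (cusp k) (\<lambda>n X. (0, bw (least_minimiser k \<delta> n X)))"
    obtain C where C: "0 < C" "\<forall>\<^sub>F n in sequentially. (\<forall>ghat f. is_selection (cusp k) \<delta> (\<lambda>_. 0) ghat \<longrightarrow>
     f \<in> Sigma_class (cusp k) s L \<longrightarrow> risk (cusp k) n (fhat_sel (cusp k) ghat n) f \<le> ennreal (C * rate k s n))"
      using adaptive_risk_bound[OF k \<delta> s L] by blast
    have "\<forall>\<^sub>F n in sequentially. (SUP f\<in>Sigma_class (cusp k) s L. risk (cusp k) n (?T n) f) / ennreal (rate k s n) \<le> ennreal C"
      using C(2) eventually_ge_at_top[of 2]
    proof eventually_elim
      case (elim n)
      have r: "0 < rate k s n" using elim(2) by (rule rate_pos)
      have "(SUP f\<in>Sigma_class (cusp k) s L. risk (cusp k) n (?T n) f) \<le> ennreal (C * rate k s n)"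
        using elim(1) is_selection_least_minimiser[of k \<delta>] by (intro SUP_least) blast
      also have "\<dots> = ennreal (rate k s n) * ennreal C" using r C(1) by (simp add: ennreal_mult mult.commute)
      finally show ?case using r by (intro divide_le_posI_ennreal) auto
    qed
    then have "limsup (\<lambda>n. (SUP f\<in>Sigma_class (cusp k) s L. risk (cusp k) n (?T n) f) / ennreal (rate k s n)) \<le> ennreal C"
      by (rule Limsup_bounded)
    then have "lesssim (\<lambda>n. SUP f\<in>Sigma_class (cusp k) s L. risk (cusp k) n (?T n) f) (\<lambda>n. ennreal (rate k s n))"
      unfolding lesssim_def by (rule order_le_less_trans) simp
    then show "case \<theta> of (s, L) \<Rightarrow> lesssim (\<lambda>n. SUP f\<in>Sigma_class (cusp k) s L. risk (cusp k) n (?T n) f) (\<lambda>n. ennreal (ARC_rate k (s, L) n))"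
      unfolding \<theta> prod.case rate_def .
  qed
qed

theorem theorem4p7:
  fixes k \<delta> :: real
  assumes "1 < k" and "1 < \<delta>"
  shows
    "is_ARC (cusp k) ({0<..1} \<times> {0<..})
       (\<lambda>(s, L) n. (ln (real n) / real n) powr (s / (2 * s + k + 1)))
     \<and>
     (\<forall>(s, L) \<in> {0<..1} \<times> {0<..}. \<exists>C>0. \<forall>ghat. is_selection (cusp k) \<delta> (\<lambda>_. 0) ghat \<longrightarrow>
        limsup (\<lambda>n. SUP f\<in>Sigma_class (cusp k) s L.
            ennreal ((ln (real n) / real n) powr (- (s / (2 * s + k + 1))))
              * risk (cusp k) n (fhat_sel (cusp k) ghat n) f)
          \<le> ennreal C)"
proof (intro conjI)
  show "is_ARC (cusp k) Kset (ARC_rate k)"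
    unfolding is_ARC_def
    using admissible_ARC_rate[OF assms] ARC_optimality[OF assms(1)] by blast
  show "\<forall>(s, L) \<in> Kset. \<exists>C>0. \<forall>ghat. is_selection (cusp k) \<delta> (\<lambda>_. 0) ghat \<longrightarrow>
        limsup (\<lambda>n. SUP f\<in>Sigma_class (cusp k) s L.
            ennreal ((ln (real n) / real n) powr (- (s / (2 * s + k + 1))))
              * risk (cusp k) n (fhat_sel (cusp k) ghat n) f)
          \<le> ennreal C"
  proof
    fix \<theta> assume "\<theta> \<in> Kset"
    then obtain s L where \<theta>: "\<theta> = (s, L)" and s: "0 < s" "s \<le> 1" and L: "0 < L" by auto
    obtain C where C: "0 < C" "\<forall>\<^sub>F n in sequentially. (\<forall>ghat f. is_selection (cusp k) \<delta> (\<lambda>_. 0) ghat \<longrightarrow>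
     f \<in> Sigma_class (cusp k) s L \<longrightarrow> risk (cusp k) n (fhat_sel (cusp k) ghat n) f \<le> ennreal (C * rate k s n))"
      using adaptive_risk_bound[OF assms s L] by blast
    have "limsup (\<lambda>n. SUP f\<in>Sigma_class (cusp k) s L.
            ennreal ((ln (real n) / real n) powr (- (s / (2 * s + k + 1))))
              * risk (cusp k) n (fhat_sel (cusp k) ghat n) f) \<le> ennreal C"
      if sel: "is_selection (cusp k) \<delta> (\<lambda>_. 0) ghat" for ghat
    proof (rule Limsup_bounded)
      show "\<forall>\<^sub>F n in sequentially. (SUP f\<in>Sigma_class (cusp k) s L.
            ennreal ((ln (real n) / real n) powr (- (s / (2 * s + k + 1))))
              * risk (cusp k) n (fhat_sel (cusp k) ghat n) f) \<le> ennreal C"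
        using C(2) eventually_ge_at_top[of 2]
      proof eventually_elim
        case (elim n)
        have r: "0 < rate k s n" using elim(2) by (rule rate_pos)
        have inv: "(ln (real n) / real n) powr (- (s / (2 * s + k + 1))) = 1 / rate k s n"
          by (simp add: rate_def powr_minus_divide)
        show ?case
        proof (rule SUP_least)
          fix f assume f: "f \<in> Sigma_class (cusp k) s L"
          have "ennreal (1 / rate k s n) * risk (cusp k) n (fhat_sel (cusp k) ghat n) f
              \<le> ennreal (1 / rate k s n) * ennreal (C * rate k s n)"
            using elim(1) sel f by (intro mult_left_mono) auto
          also have "\<dots> = ennreal C" using r C(1) by (simp add: ennreal_mult[symmetric])
          finally show "ennreal ((ln (real n) / real n) powr (- (s / (2 * s + k + 1))))
              * risk (cusp k) n (fhat_sel (cusp k) ghat n) f \<le> ennreal C"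
            unfolding inv .
        qed
      qed
    qed
    then have "\<exists>C>0. \<forall>ghat. is_selection (cusp k) \<delta> (\<lambda>_. 0) ghat \<longrightarrow>
        limsup (\<lambda>n. SUP f\<in>Sigma_class (cusp k) s L.
            ennreal ((ln (real n) / real n) powr (- (s / (2 * s + k + 1))))
              * risk (cusp k) n (fhat_sel (cusp k) ghat n) f)
          \<le> ennreal C" using C(1) by blast
    then show "case \<theta> of (s, L) \<Rightarrow> \<exists>C>0. \<forall>ghat. is_selection (cusp k) \<delta> (\<lambda>_. 0) ghat \<longrightarrow>
        limsup (\<lambda>n. SUP f\<in>Sigma_class (cusp k) s L.
            ennreal ((ln (real n) / real n) powr (- (s / (2 * s + k + 1))))
              * risk (cusp k) n (fhat_sel (cusp k) ghat n) f)
          \<le> ennreal C" unfolding \<theta> prod.case .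
  qed
qed

end
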